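(* Let $K$ be a field of characteristic zero, let $d_1,\dots,d_n$ be positive integers, let $V_1,\dots,V_n$ be finite dimensional $K$-vector spaces, and let $X=SV_{\underline d}(\mathbb{P}V_1^*\times\cdots\times\mathbb{P}V_n^* )$ be the Segre--Veronese variety, with tangential variety $\tau(X)$. For every $r\ge 0$, the degree $r$ part of the homogeneous coordinate ring of $\tau(X)$ decomposes as a $GL(V_1)\times\cdots\times GL(V_n)$-representation as $$K[\tau(X)]_r\;\simeq\;\bigoplus_{\substack{\lambda=(\lambda^1,\dots,\lambda^n)\\ \lambda^j\vdash r d_j}}\left(S_{\lambda^1}V_1\otimes\cdots\otimes S_{\lambda^n}V_n\right)^{m_\lambda},$$ where $m_\lambda\in\{0,1\}$ is obtained as follows. Set $$f_\lambda=\max_{j=1,\dots,n}\left\lceil\frac{\lambda^j_2}{d_j}\right\rceil,\qquad e_\lambda=\lambda^1_2+\cdots+\lambda^n_2 .$$ If some $\lambda^j$ has more than two parts, or $e_\lambda<2f_\lambda$, or $e_\lambda>r$, then $m_\lambda=0$; otherwise $m_\lambda=1$.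
   Context: $\underline d=(d_1,\dots,d_n)$. The Segre--Veronese variety $X$ is the image of the embedding $SV_{\underline d}:\mathbb{P}V_1^*\times\cdots\times\mathbb{P}V_n^*\to\mathbb{P}(\mathrm{Sym}^{d_1}V_1^*\otimes\cdots\otimes\mathrm{Sym}^{d_n}V_n^* )$, $([e_1],\dots,[e_n])\mapsto[e_1^{d_1}\otimes\cdots\otimes e_n^{d_n}]$. The tangential variety $\tau(X)$ is the union of all points on all embedded tangent lines to $X$; the affine cone over it is the image of the map $$s:(V_1^*\times\cdots\times V_n^* )\times(V_1^*\times\cdots\times V_n^* )\to \mathrm{Sym}^{d_1}V_1^*\otimes\cdots\otimes\mathrm{Sym}^{d_n}V_n^*,\quad (e,f)\mapsto\sum_{i=1}^n e_1^{d_1}\otimes\cdots\otimes e_i^{d_i-1}f_i\otimes\cdots\otimes e_n^{d_n}.$$ $I(\tau(X))$ is the homogeneous ideal of elements of the polynomial ring $\mathrm{Sym}(\mathrm{Sym}^{d_1}V_1\otimes\cdots\otimes\mathrm{Sym}^{d_n}V_n)$ vanishing on this cone, and $K[\tau(X)]$ is the quotient by this ideal. For a partition $\mu$, $S_\mu$ denotes the Schur functor ($S_{(m)}=\mathrm{Sym}^m$, $S_{(1^m)}=\bigwedge^m$, $S_\mu W=0$ if $\mu$ has more than $\dim W$ parts). Partitions are padded by zeros, so $\lambda^j_2=0$ if $\lambda^j$ has one part. *)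

theory Defs
  imports
    Complex_Main
    "HOL-Library.Function_Algebras"
    "HOL-Library.Set_Algebras"
    "HOL-Combinatorics.Permutations"
begin

text \<open>
  The spaces \<open>V\<^sub>j\<close> are finite dimensional subspaces of one vector space of type \<open>'v\<close>; every
  finite family of finite dimensional spaces is isomorphic to such a family (take the direct sum).
  Everything built from them (duals, tensor products, symmetric powers, polynomials) is a space of
  \<open>K\<close>-valued functions with pointwise operations. A function that is meaningful only on part of its
  type is extended by zero.
\<close>

definition fscale :: "'k::field \<Rightarrow> ('x \<Rightarrow> 'k) \<Rightarrow> 'x \<Rightarrow> 'k" where
  "fscale c f = (\<lambda>x. c * f x)"

lemma vector_space_fscale: "vector_space (fscale :: 'k::field \<Rightarrow> ('x \<Rightarrow> 'k) \<Rightarrow> _)"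
  by unfold_locales (auto simp: fscale_def fun_eq_iff algebra_simps)

abbreviation fspan :: "('x \<Rightarrow> 'k::field) set \<Rightarrow> ('x \<Rightarrow> 'k) set" where
  "fspan \<equiv> module.span fscale"

definition fin_dim_subspace :: "('k::field \<Rightarrow> 'v::ab_group_add \<Rightarrow> 'v) \<Rightarrow> 'v set \<Rightarrow> bool" where
  "fin_dim_subspace scale U \<longleftrightarrow> (\<exists>B. finite B \<and> U = module.span scale B)"

definition dual_space :: "('k::field \<Rightarrow> 'v::ab_group_add \<Rightarrow> 'v) \<Rightarrow> 'v set \<Rightarrow> ('v \<Rightarrow> 'k) set" where
  "dual_space scale U = {\<phi>. (\<forall>x\<in>U. \<forall>y\<in>U. \<phi> (x + y) = \<phi> x + \<phi> y) \<and>
     (\<forall>c. \<forall>x\<in>U. \<phi> (scale c x) = c * \<phi> x) \<and> (\<forall>x. x \<notin> U \<longrightarrow> \<phi> x = 0)}"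

text \<open>
  Automorphisms of \<open>U\<close> are extended by the identity outside \<open>U\<close>, so that \<open>GL(U)\<close> is a group under
  composition of functions.
\<close>

definition GL :: "('k::field \<Rightarrow> 'v::ab_group_add \<Rightarrow> 'v) \<Rightarrow> 'v set \<Rightarrow> ('v \<Rightarrow> 'v) set" where
  "GL scale U = {g. bij_betw g U U \<and> (\<forall>x\<in>U. \<forall>y\<in>U. g (x + y) = g x + g y) \<and>
     (\<forall>c. \<forall>x\<in>U. g (scale c x) = scale c (g x)) \<and> (\<forall>x. x \<notin> U \<longrightarrow> g x = x)}"

definition GL_prod ::
  "('k::field \<Rightarrow> 'v::ab_group_add \<Rightarrow> 'v) \<Rightarrow> ('n \<Rightarrow> 'v set) \<Rightarrow> ('n \<Rightarrow> 'v \<Rightarrow> 'v) set" where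
  "GL_prod scale V = {g. \<forall>j. g j \<in> GL scale (V j)}"

record ('g, 'k, 'a) representation =
  rep_carrier :: "'a set"
  rep_add :: "'a \<Rightarrow> 'a \<Rightarrow> 'a"
  rep_scale :: "'k \<Rightarrow> 'a \<Rightarrow> 'a"
  rep_act :: "'g \<Rightarrow> 'a \<Rightarrow> 'a"

definition rep_iso ::
  "'g set \<Rightarrow> ('g, 'k, 'a) representation \<Rightarrow> ('g, 'k, 'b) representation \<Rightarrow> bool" where
  "rep_iso G A B \<longleftrightarrow> (\<exists>\<Phi>. bij_betw \<Phi> (rep_carrier A) (rep_carrier B) \<and>
     (\<forall>x\<in>rep_carrier A. \<forall>y\<in>rep_carrier A. \<Phi> (rep_add A x y) = rep_add B (\<Phi> x) (\<Phi> y)) \<and>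
     (\<forall>c. \<forall>x\<in>rep_carrier A. \<Phi> (rep_scale A c x) = rep_scale B c (\<Phi> x)) \<and>
     (\<forall>g\<in>G. \<forall>x\<in>rep_carrier A. \<Phi> (rep_act A g x) = rep_act B g (\<Phi> x)))"

text \<open>
  \<open>Sym\<^sup>d U\<^sup>*\<close> is the space of homogeneous polynomial functions of degree \<open>d\<close> on \<open>U\<close> (the field is
  infinite). Hence \<open>Sym\<^bsup>d\<^sub>1\<^esup> V\<^sub>1\<^sup>* \<otimes> \<dots> \<otimes> Sym\<^bsup>d\<^sub>n\<^esup> V\<^sub>n\<^sup>*\<close> is the space of multihomogeneous polynomial
  functions of multidegree \<open>d\<close> on \<open>V\<^sub>1 \<times> \<dots> \<times> V\<^sub>n\<close>. If all \<open>d\<^sub>j\<close> are positive, then these functions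
  vanish outside this product, because functionals vanish outside \<open>V\<^sub>j\<close>.
\<close>

definition sym_tensor ::
  "('k::field \<Rightarrow> 'v::ab_group_add \<Rightarrow> 'v) \<Rightarrow> ('n::finite \<Rightarrow> 'v set) \<Rightarrow> ('n \<Rightarrow> nat)
    \<Rightarrow> (('n \<Rightarrow> 'v) \<Rightarrow> 'k) set" where
  "sym_tensor scale V d =
     fspan {\<lambda>v. \<Prod>j\<in>UNIV. \<Prod>i<d j. \<phi> j i (v j) | \<phi>. \<forall>j i. \<phi> j i \<in> dual_space scale (V j)}"

definition tangent_vector ::
  "('n::finite \<Rightarrow> nat) \<Rightarrow> ('n \<Rightarrow> 'v \<Rightarrow> 'k::field) \<Rightarrow> ('n \<Rightarrow> 'v \<Rightarrow> 'k) \<Rightarrow> ('n \<Rightarrow> 'v) \<Rightarrow> 'k" where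
  "tangent_vector d e f = (\<lambda>v. \<Sum>i\<in>UNIV.
     e i (v i) ^ (d i - 1) * f i (v i) * (\<Prod>j\<in>UNIV - {i}. e j (v j) ^ d j))"

definition tangential_cone ::
  "('k::field \<Rightarrow> 'v::ab_group_add \<Rightarrow> 'v) \<Rightarrow> ('n::finite \<Rightarrow> 'v set) \<Rightarrow> ('n \<Rightarrow> nat)
    \<Rightarrow> (('n \<Rightarrow> 'v) \<Rightarrow> 'k) set" where
  "tangential_cone scale V d = {tangent_vector d e f | e f.
     (\<forall>j. e j \<in> dual_space scale (V j)) \<and> (\<forall>j. f j \<in> dual_space scale (V j))}"

text \<open>
  The symmetric algebra of \<open>Sym\<^bsup>d\<^sub>1\<^esup> V\<^sub>1 \<otimes> \<dots> \<otimes> Sym\<^bsup>d\<^sub>n\<^esup> V\<^sub>n\<close> is the ring of polynomial functions on the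
  dual space \<open>sym_tensor scale V d\<close>. The linear forms on the latter are the elements of the former.
\<close>

definition form_product :: "('y \<Rightarrow> 'k::field) set \<Rightarrow> (('y \<Rightarrow> 'k) \<Rightarrow> 'k) list \<Rightarrow> ('y \<Rightarrow> 'k) \<Rightarrow> 'k" where
  "form_product Y ls = (\<lambda>F. if F \<in> Y then (\<Prod>l\<leftarrow>ls. l F) else 0)"

definition poly_ring :: "('y \<Rightarrow> 'k::field) set \<Rightarrow> (('y \<Rightarrow> 'k) \<Rightarrow> 'k) set" where
  "poly_ring Y = fspan {form_product Y ls | ls. set ls \<subseteq> dual_space fscale Y}"

definition poly_ring_deg :: "('y \<Rightarrow> 'k::field) set \<Rightarrow> nat \<Rightarrow> (('y \<Rightarrow> 'k) \<Rightarrow> 'k) set" where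
  "poly_ring_deg Y r = fspan {form_product Y ls | ls. set ls \<subseteq> dual_space fscale Y \<and> length ls = r}"

definition tangential_ideal ::
  "('k::field \<Rightarrow> 'v::ab_group_add \<Rightarrow> 'v) \<Rightarrow> ('n::finite \<Rightarrow> 'v set) \<Rightarrow> ('n \<Rightarrow> nat)
    \<Rightarrow> ((('n \<Rightarrow> 'v) \<Rightarrow> 'k) \<Rightarrow> 'k) set" where
  "tangential_ideal scale V d =
     {p \<in> poly_ring (sym_tensor scale V d). \<forall>F\<in>tangential_cone scale V d. p F = 0}"

text \<open>
  An element \<open>v\<close> of \<open>U\<close> acts as the functional \<open>\<phi> \<mapsto> \<phi> v\<close> on \<open>U\<^sup>*\<close>, hence \<open>g v\<close> acts as
  \<open>\<phi> \<mapsto> (\<phi> \<circ> g) v\<close>. The same rule gives the action on polynomials on \<open>sym_tensor scale V d\<close>.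
\<close>

definition poly_act ::
  "('n \<Rightarrow> 'v \<Rightarrow> 'v) \<Rightarrow> ((('n \<Rightarrow> 'v) \<Rightarrow> 'k) \<Rightarrow> 'k) \<Rightarrow> (('n \<Rightarrow> 'v) \<Rightarrow> 'k) \<Rightarrow> 'k" where
  "poly_act g p = (\<lambda>F. p (\<lambda>v. F (\<lambda>j. g j (v j))))"

text \<open>
  Elements are cosets \<open>p + I\<close>. In the scalar multiplication, adding \<open>I\<close> matters for the scalar \<open>0\<close>.
\<close>

definition tangential_coord_ring_deg ::
  "('k::field \<Rightarrow> 'v::ab_group_add \<Rightarrow> 'v) \<Rightarrow> ('n::finite \<Rightarrow> 'v set) \<Rightarrow> ('n \<Rightarrow> nat) \<Rightarrow> nat
    \<Rightarrow> ('n \<Rightarrow> 'v \<Rightarrow> 'v, 'k, ((('n \<Rightarrow> 'v) \<Rightarrow> 'k) \<Rightarrow> 'k) set) representation" where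
  "tangential_coord_ring_deg scale V d r = (let I = tangential_ideal scale V d in
     \<lparr> rep_carrier = (\<lambda>p. p +o I) ` poly_ring_deg (sym_tensor scale V d) r,
       rep_add = (\<lambda>A B. A + B),
       rep_scale = (\<lambda>c A. fscale c ` A + I),
       rep_act = (\<lambda>g A. poly_act g ` A) \<rparr>)"

definition partition_of :: "nat list \<Rightarrow> nat \<Rightarrow> bool" where
  "partition_of \<mu> k \<longleftrightarrow> sorted_wrt (\<ge>) \<mu> \<and> 0 \<notin> set \<mu> \<and> sum_list \<mu> = k"

definition nth_part :: "nat list \<Rightarrow> nat \<Rightarrow> nat" where
  "nth_part \<mu> i = (if i \<le> length \<mu> \<and> 0 < i then \<mu> ! (i - 1) else 0)"

text \<open>
  The Young diagram of \<open>\<mu>\<close> is filled with \<open>0, 1, 2, \<dots>\<close> row by row; the following are the row and the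
  column of the box that contains \<open>p\<close>.
\<close>

definition row_of :: "nat list \<Rightarrow> nat \<Rightarrow> nat" where
  "row_of \<mu> p = (LEAST i. p < sum_list (take (Suc i) \<mu>))"

definition col_of :: "nat list \<Rightarrow> nat \<Rightarrow> nat" where
  "col_of \<mu> p = p - sum_list (take (row_of \<mu> p) \<mu>)"

definition row_group :: "nat list \<Rightarrow> (nat \<Rightarrow> nat) set" where
  "row_group \<mu> = {\<sigma>. \<sigma> permutes {..<sum_list \<mu>} \<and> (\<forall>p<sum_list \<mu>. row_of \<mu> (\<sigma> p) = row_of \<mu> p)}"

definition col_group :: "nat list \<Rightarrow> (nat \<Rightarrow> nat) set" where
  "col_group \<mu> = {\<tau>. \<tau> permutes {..<sum_list \<mu>} \<and> (\<forall>p<sum_list \<mu>. col_of \<mu> (\<tau> p) = col_of \<mu> p)}"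

text \<open>
  Tensors in \<open>U \<otimes> \<dots> \<otimes> U\<close> are multilinear functions of lists of functionals on \<open>U\<close>.
\<close>

definition pure_tensor ::
  "('k::field \<Rightarrow> 'v::ab_group_add \<Rightarrow> 'v) \<Rightarrow> 'v set \<Rightarrow> 'v list \<Rightarrow> ('v \<Rightarrow> 'k) list \<Rightarrow> 'k" where
  "pure_tensor scale U vs = (\<lambda>\<phi>s. if length \<phi>s = length vs \<and> set \<phi>s \<subseteq> dual_space scale U
     then \<Prod>i<length vs. (\<phi>s ! i) (vs ! i) else 0)"

definition tensor_power ::
  "('k::field \<Rightarrow> 'v::ab_group_add \<Rightarrow> 'v) \<Rightarrow> 'v set \<Rightarrow> nat \<Rightarrow> (('v \<Rightarrow> 'k) list \<Rightarrow> 'k) set" where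
  "tensor_power scale U k = fspan {pure_tensor scale U vs | vs. length vs = k \<and> set vs \<subseteq> U}"

text \<open>
  With the right action \<open>(v\<^sub>1 \<otimes> \<dots> \<otimes> v\<^sub>k) \<cdot> \<pi> = v\<^bsub>\<pi> 1\<^esub> \<otimes> \<dots> \<otimes> v\<^bsub>\<pi> k\<^esub>\<close> of permutations, precomposition
  with \<open>permute_list \<pi>\<close> is the action of \<open>\<pi>\<^sup>-\<^sup>1\<close>. Since the row and column groups are closed under
  inverses, the operator below is the Young symmetrizer (sum over the row group, followed by
  alternating sum over the column group), and \<open>schur\<close> is its image.
\<close>

definition young_symmetrizer ::
  "nat list \<Rightarrow> ('x list \<Rightarrow> 'k::field) \<Rightarrow> 'x list \<Rightarrow> 'k" where
  "young_symmetrizer \<mu> T = (\<lambda>\<phi>s. \<Sum>\<sigma>\<in>row_group \<mu>. \<Sum>\<tau>\<in>col_group \<mu>.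
     of_int (sign \<tau>) * T (permute_list (\<tau> \<circ> \<sigma>) \<phi>s))"

definition schur ::
  "('k::field \<Rightarrow> 'v::ab_group_add \<Rightarrow> 'v) \<Rightarrow> nat list \<Rightarrow> 'v set \<Rightarrow> (('v \<Rightarrow> 'k) list \<Rightarrow> 'k) set" where
  "schur scale \<mu> U = young_symmetrizer \<mu> ` tensor_power scale U (sum_list \<mu>)"

definition schur_tensor ::
  "('k::field \<Rightarrow> 'v::ab_group_add \<Rightarrow> 'v) \<Rightarrow> ('n::finite \<Rightarrow> 'v set) \<Rightarrow> ('n \<Rightarrow> nat list)
    \<Rightarrow> (('n \<Rightarrow> ('v \<Rightarrow> 'k) list) \<Rightarrow> 'k) set" where
  "schur_tensor scale V lam =
     fspan {\<lambda>x. \<Prod>j\<in>UNIV. T j (x j) | T. \<forall>j. T j \<in> schur scale (lam j) (V j)}"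

definition tensor_act ::
  "('n \<Rightarrow> 'v \<Rightarrow> 'v) \<Rightarrow> (('n \<Rightarrow> ('v \<Rightarrow> 'k) list) \<Rightarrow> 'k) \<Rightarrow> ('n \<Rightarrow> ('v \<Rightarrow> 'k) list) \<Rightarrow> 'k" where
  "tensor_act g T = (\<lambda>x. T (\<lambda>j. map (\<lambda>\<phi>. \<phi> \<circ> g j) (x j)))"

text \<open>
  The direct sum of \<open>m lam\<close> copies of \<open>schur_tensor scale V lam\<close> over \<open>lam \<in> \<Lambda>\<close>, as families indexed by
  \<open>lam\<close> and the number of the copy. It is the direct product, so \<open>\<Lambda>\<close> has to be finite.
\<close>

definition schur_direct_sum ::
  "('k::field \<Rightarrow> 'v::ab_group_add \<Rightarrow> 'v) \<Rightarrow> ('n::finite \<Rightarrow> 'v set) \<Rightarrow> ('n \<Rightarrow> nat list) set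
    \<Rightarrow> (('n \<Rightarrow> nat list) \<Rightarrow> nat)
    \<Rightarrow> ('n \<Rightarrow> 'v \<Rightarrow> 'v, 'k, ('n \<Rightarrow> nat list) \<Rightarrow> nat \<Rightarrow> ('n \<Rightarrow> ('v \<Rightarrow> 'k) list) \<Rightarrow> 'k) representation"
  where
  "schur_direct_sum scale V \<Lambda> m =
     \<lparr> rep_carrier = {F. \<forall>lam c. if lam \<in> \<Lambda> \<and> c < m lam then F lam c \<in> schur_tensor scale V lam
                               else F lam c = 0},
       rep_add = (\<lambda>F F' lam c. F lam c + F' lam c),
       rep_scale = (\<lambda>a F lam c. fscale a (F lam c)),
       rep_act = (\<lambda>g F lam c. tensor_act g (F lam c)) \<rparr>"

definition f_stat :: "('n::finite \<Rightarrow> nat) \<Rightarrow> ('n \<Rightarrow> nat list) \<Rightarrow> int" where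
  "f_stat d lam = Max (range (\<lambda>j. \<lceil>real (nth_part (lam j) 2) / real (d j)\<rceil>))"

definition e_stat :: "('n::finite \<Rightarrow> nat list) \<Rightarrow> int" where
  "e_stat lam = (\<Sum>j\<in>UNIV. int (nth_part (lam j) 2))"

definition tangential_mult :: "('n::finite \<Rightarrow> nat) \<Rightarrow> nat \<Rightarrow> ('n \<Rightarrow> nat list) \<Rightarrow> nat" where
  "tangential_mult d r lam = (if (\<exists>j. length (lam j) > 2) \<or> e_stat lam < 2 * f_stat d lam \<or> e_stat lam > int r
     then 0 else 1)"

end

theory Submission
  imports Defs "HOL-Computational_Algebra.Polynomial" "HOL-Library.FuncSet"
begin

text \<open>
  Pulling polynomials back along the parametrization of the cone identifies \<open>K[\<tau>(X)]\<^sub>r\<close> with a space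
  of functions of \<open>(e, f)\<close>. It is the image of \<open>\<Otimes>\<^sub>j V\<^sub>j\<^bsup>\<otimes>rd\<^sub>j\<^esup>\<close>: distribute the tensor positions over \<open>r\<close>
  blocks with \<open>d\<^sub>j\<close> positions of the factor \<open>j\<close> in each, and send a tensor \<open>A\<close> to the sum of its
  evaluations with \<open>f\<close> in one position of every block and \<open>e\<close> elsewhere.

  The substitution \<open>f + u e\<close> for \<open>f\<close> yields the analogous sums over partial choices of \<open>s \<le> r\<close>
  positions. These filter the function space by \<open>s\<close>; the first nonvanishing sum splits by its degrees
  \<open>a\<^sub>j\<close> in the \<open>f\<^sub>j\<close> into functions invariant under \<open>f\<^sub>j \<mapsto> f\<^sub>j + c e\<^sub>j\<close>, and the component of degree \<open>a\<close>
  is an element of the Schur functor with \<open>\<lambda>\<^sup>j = (rd\<^sub>j - a\<^sub>j, a\<^sub>j)\<close>, evaluated with \<open>e\<close> in the first row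
  and \<open>f\<close> in the second. Hence all multiplicities are at most one.

  If \<open>e\<^sub>\<lambda> \<ge> 2 f\<^sub>\<lambda>\<close>, the Schur functor embeds for a suitable distribution into blocks, because a signed
  count of orientations of a graph does not vanish. If \<open>e\<^sub>\<lambda> < 2 f\<^sub>\<lambda>\<close>, then some block always
  contains a single position, and toggling it shows that the component vanishes.
\<close>

text \<open>No highest weight theory enters: a Schur tensor is recovered from its values with
  \<open>e\<close> in the first rows and \<open>f\<close> in the second, so the decomposition
  becomes a matter of identities between functions of \<open>(e, f)\<close>. A function does not
  determine the tensor that yields it, so tensors are compared only through their sums over choices.
  If these sums vanish for size \<open>r\<close>, they vanish for all smaller sizes, because a
  choice of size s < r extends by one position in (r - s)(d_1 + ... + d_n) ways, a number that is
  nonzero in characteristic zero. Hence the filtration depends on the function alone, not on the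
  tensor or the distribution into blocks, and every shape may use its own distribution. For a Schur
  tensor the sums vanish below the number of its columns of length two; at that size the sum is the
  value with \<open>f\<close> in the second rows times a signed count, and the distribution has to
  be found such that this count is nonzero. The bound e \<le> r holds because a choice has at most
  one position per block. The bound 2 f \<le> e reflects that each of the f stars needs at least the
  two edges of its doubled edge.\<close>

section \<open>Coefficient extraction and inclusion-exclusion\<close>

lemma power_sum_coeff_zero:
  fixes c :: "'i \<Rightarrow> 'k::field_char_0"
  assumes "finite M" "\<And>t. (\<Sum>i\<in>M. c i * t ^ m i) = 0"
  shows "(\<Sum>i\<in>{i\<in>M. m i = N}. c i) = 0"
proof -
  define p where "p = (\<Sum>i\<in>M. monom (c i) (m i))"
  have "poly p t = 0" for t
    using assms(2)[of t] by (simp add: p_def poly_sum poly_monom)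
  then have "p = 0" using poly_all_0_iff_0 by blast
  then have "coeff p N = 0" by simp
  then have "(\<Sum>i\<in>M. if m i = N then c i else 0) = 0"
    by (simp add: p_def coeff_sum)
  then show ?thesis using assms(1) by (simp add: sum.inter_filter)
qed

text \<open>One variable at a time, with the remaining factors absorbed into the coefficients.
  Exponents may repeat, so only the sum of all coefficients belonging to one monomial is
  controlled.\<close>

lemma monomial_sum_coeff_zero:
  fixes c :: "'i \<Rightarrow> 'k::field_char_0"
  assumes "finite U" "finite M" "\<And>t. (\<Sum>i\<in>M. c i * (\<Prod>v\<in>U. t v ^ m i v)) = 0"
  shows "(\<Sum>i\<in>{i\<in>M. \<forall>v\<in>U. m i v = N v}. c i) = 0"
  using assms
proof (induction U arbitrary: M rule: finite_induct)
  case empty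
  then show ?case by simp
next
  case (insert u U)
  let ?M = "{i\<in>M. m i u = N u}"
  have "(\<Sum>i\<in>?M. c i * (\<Prod>v\<in>U. t v ^ m i v)) = 0" for t
  proof (rule power_sum_coeff_zero[OF insert.prems(1)])
    fix s
    have "(\<Prod>v\<in>U. (t(u := s)) v ^ m i v) = (\<Prod>v\<in>U. t v ^ m i v)" for i
      using insert.hyps by (intro prod.cong) auto
    then show "(\<Sum>i\<in>M. c i * (\<Prod>v\<in>U. t v ^ m i v) * s ^ m i u) = 0"
      using insert.prems(2)[of "t(u := s)"] insert.hyps
      by (simp add: algebra_simps)
  qed
  then have "(\<Sum>i\<in>{i\<in>?M. \<forall>v\<in>U. m i v = N v}. c i) = 0"
    using insert.IH[of ?M] insert.prems(1) by simp
  moreover have "{i\<in>?M. \<forall>v\<in>U. m i v = N v} = {i\<in>M. \<forall>v\<in>insert u U. m i v = N v}" by auto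
  ultimately show ?case by simp
qed

lemma sum_sign_Pow:
  assumes "finite D"
  shows "(\<Sum>J\<in>Pow D. (- 1) ^ card J) = (if D = {} then 1 else (0::'k::comm_ring_1))"
proof -
  have "(\<Prod>x\<in>D. (- 1) + (1::'k)) = (\<Sum>J\<in>Pow D. (- 1) ^ card J)"
    by (subst prod_add[OF assms]) simp
  then show ?thesis using assms by (cases "D = {}") (simp_all add: power_0_left)
qed

lemma sum_sign_supersets:
  assumes "finite B" "A \<subseteq> B"
  shows "(\<Sum>I\<in>{I. A \<subseteq> I \<and> I \<subseteq> B}. (- 1) ^ card (B - I)) = (if A = B then 1 else (0::'k::comm_ring_1))"
proof -
  have "(\<Sum>I\<in>{I. A \<subseteq> I \<and> I \<subseteq> B}. (- 1) ^ card (B - I)) = (\<Sum>J\<in>Pow (B - A). (- 1) ^ card J :: 'k)"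
    using assms by (intro sum.reindex_bij_witness[of _ "\<lambda>J. B - J" "\<lambda>I. B - I"]) auto
  also have "\<dots> = (if B - A = {} then 1 else 0)"
    using assms by (intro sum_sign_Pow) auto
  finally show ?thesis using assms(2) by auto
qed

text \<open>Inclusion-exclusion over the image of \<open>h\<close>. This is the combinatorial half
  of polarization: inserting sums over \<open>I\<close> produces the maps into \<open>I\<close>, and
  the alternating sum leaves the maps onto \<open>B\<close>, which are bijections if
  \<open>Q\<close> and \<open>B\<close> have the same size.\<close>

lemma sum_surjective_PiE:
  fixes G :: "('q \<Rightarrow> 'b) \<Rightarrow> 'k::comm_ring_1"
  assumes Q: "finite Q" and B: "finite B" and C: "\<And>q. q \<in> Q \<Longrightarrow> C q \<subseteq> B"
  shows "(\<Sum>I\<in>Pow B. (- 1) ^ card (B - I) * (\<Sum>h\<in>PiE Q (\<lambda>q. C q \<inter> I). G h)) =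
    (\<Sum>h\<in>{h\<in>PiE Q C. h ` Q = B}. G h)"
proof -
  have fin: "finite (PiE Q C)"
    using Q B C by (intro finite_PiE) (auto intro: finite_subset)
  have "(\<Sum>h\<in>PiE Q (\<lambda>q. C q \<inter> I). G h) = (\<Sum>h\<in>PiE Q C. if h ` Q \<subseteq> I then G h else 0)" for I
  proof -
    have "PiE Q (\<lambda>q. C q \<inter> I) = {h\<in>PiE Q C. h ` Q \<subseteq> I}"
      by (auto simp: PiE_def Pi_def)
    then show ?thesis using fin by (simp add: sum.inter_filter)
  qed
  then have "(\<Sum>I\<in>Pow B. (- 1) ^ card (B - I) * (\<Sum>h\<in>PiE Q (\<lambda>q. C q \<inter> I). G h)) =
    (\<Sum>I\<in>Pow B. \<Sum>h\<in>PiE Q C. (- 1) ^ card (B - I) * (if h ` Q \<subseteq> I then G h else 0))"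
    by (simp add: sum_distrib_left)
  also have "\<dots> = (\<Sum>h\<in>PiE Q C. \<Sum>I\<in>Pow B. (- 1) ^ card (B - I) * (if h ` Q \<subseteq> I then G h else 0))"
    by (rule sum.swap)
  also have "\<dots> = (\<Sum>h\<in>PiE Q C. if h ` Q = B then G h else 0)"
  proof (rule sum.cong[OF refl])
    fix h assume h: "h \<in> PiE Q C"
    have "(\<Sum>I\<in>Pow B. (- 1) ^ card (B - I) * (if h ` Q \<subseteq> I then G h else 0)) =
      (\<Sum>I\<in>Pow B. if h ` Q \<subseteq> I then (- 1) ^ card (B - I) * G h else 0)"
      by (rule sum.cong) auto
    also have "\<dots> = (\<Sum>I\<in>{I\<in>Pow B. h ` Q \<subseteq> I}. (- 1) ^ card (B - I) * G h)"
      by (rule sum.inter_filter[symmetric]) (use B in simp)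
    also have "{I\<in>Pow B. h ` Q \<subseteq> I} = {I. h ` Q \<subseteq> I \<and> I \<subseteq> B}" by auto
    also have "(\<Sum>I\<in>{I. h ` Q \<subseteq> I \<and> I \<subseteq> B}. (- 1) ^ card (B - I) * G h) =
      (\<Sum>I\<in>{I. h ` Q \<subseteq> I \<and> I \<subseteq> B}. (- 1) ^ card (B - I)) * G h"
      by (simp add: sum_distrib_right)
    also have "\<dots> = (if h ` Q = B then G h else 0)"
      using sum_sign_supersets[OF B, of "h ` Q", where 'k='k] h C by (fastforce simp: PiE_def Pi_def)
    finally show "(\<Sum>I\<in>Pow B. (- 1) ^ card (B - I) * (if h ` Q \<subseteq> I then G h else 0)) =
      (if h ` Q = B then G h else 0)" .
  qed
  finally show ?thesis using fin by (simp add: sum.inter_filter)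
qed

text \<open>The independent set \<open>{v}\<close> extends to a basis of the field over the
  rationals. This lets a sum-of-squares argument over the rationals decide about zero in a field
  without an order.\<close>

lemma rational_functional_separates:
  fixes v :: "'k::field_char_0"
  assumes "v \<noteq> 0"
  obtains l :: "'k \<Rightarrow> rat" where "\<And>x y. l (x + y) = l x + l y" "\<And>q x. l (of_rat q * x) = q * l x" "l v = 1"
proof -
  interpret kq: vector_space "\<lambda>q (x::'k). of_rat q * x"
    by unfold_locales (auto simp: algebra_simps of_rat_add of_rat_mult)
  interpret qq: vector_space "(*) :: rat \<Rightarrow> rat \<Rightarrow> rat"
    by unfold_locales (auto simp: algebra_simps)
  interpret pr: vector_space_pair "\<lambda>q (x::'k). of_rat q * x" "(*) :: rat \<Rightarrow> rat \<Rightarrow> rat" ..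
  have "kq.independent {v}" using assms by simp
  then obtain g where "Vector_Spaces.linear (\<lambda>q (x::'k). of_rat q * x) (*) g" "g v = 1"
    using pr.linear_independent_extend[of "{v}" "\<lambda>_. 1"] by auto
  then interpret g: Vector_Spaces.linear "\<lambda>q (x::'k). of_rat q * x" "(*)" g by simp
  show ?thesis using that[of g] g.add g.scale \<open>g v = 1\<close> by blast
qed

section \<open>Tensors and their evaluation\<close>

global_interpretation fs: vector_space fscale
  by (rule vector_space_fscale)

lemma fscale_apply: "fscale c f x = c * f x"
  by (simp add: fscale_def)

lemma sum_fun_apply: "(\<Sum>i\<in>I. f i) x = (\<Sum>i\<in>I. f i x)"
  for f :: "'i \<Rightarrow> 'x \<Rightarrow> 'k::field"
  by (induction I rule: infinite_finite_induct) auto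

text \<open>
  As simplification rules these would also rewrite eta-expanded sums of functions that are arguments.
\<close>

declare plus_fun_apply [simp del] zero_fun_apply [simp del]

lemmas fun_apply = plus_fun_apply zero_fun_apply fscale_def sum_fun_apply

locale segre_veronese = vs: vector_space scale
  for scale :: "'k::field_char_0 \<Rightarrow> 'v::ab_group_add \<Rightarrow> 'v" +
  fixes V :: "'n::finite \<Rightarrow> 'v set" and d :: "'n \<Rightarrow> nat" and r :: nat
  assumes fin_dim: "\<And>j. fin_dim_subspace scale (V j)" and d_pos: "\<And>j. d j > 0"
begin

lemma subspace_V: "vs.subspace (V j)"
  using fin_dim[of j] unfolding fin_dim_subspace_def by auto

abbreviation dual :: "'n \<Rightarrow> ('v \<Rightarrow> 'k) set" where
  "dual j \<equiv> dual_space scale (V j)"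

lemma dual_zero: "(\<lambda>_. 0) \<in> dual j"
  by (simp add: dual_space_def)

lemma dual_add: "\<phi> \<in> dual j \<Longrightarrow> \<psi> \<in> dual j \<Longrightarrow> (\<lambda>v. \<phi> v + \<psi> v) \<in> dual j"
  by (auto simp: dual_space_def algebra_simps)

lemma dual_scale: "\<phi> \<in> dual j \<Longrightarrow> (\<lambda>v. c * \<phi> v) \<in> dual j"
  by (auto simp: dual_space_def algebra_simps)

lemma dual_sum: "(\<And>m. m \<in> I \<Longrightarrow> \<psi> m \<in> dual j) \<Longrightarrow> (\<lambda>v. \<Sum>m\<in>I. \<psi> m v) \<in> dual j"
  by (induction I rule: infinite_finite_induct) (auto intro: dual_zero dual_add)

lemma dual_apply_sum:
  assumes "\<phi> \<in> dual j" "finite I" "\<And>i. i \<in> I \<Longrightarrow> w i \<in> V j"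
  shows "\<phi> (\<Sum>i\<in>I. w i) = (\<Sum>i\<in>I. \<phi> (w i))"
  using assms(2,3)
proof (induction I rule: finite_induct)
  case empty
  have "0 \<in> V j" using subspace_V vs.subspace_0 by blast
  then have "\<phi> (scale 0 0) = 0 * \<phi> 0" using assms(1) unfolding dual_space_def by blast
  then show ?case by simp
next
  case (insert i I)
  then have "w i \<in> V j" "(\<Sum>i\<in>I. w i) \<in> V j"
    using subspace_V by (auto intro: vs.subspace_sum)
  then show ?case using insert assms(1) by (simp add: dual_space_def)
qed

text \<open>\<open>b\<close> consists of the coordinate functionals of a basis \<open>B\<close>, so
  the coefficients are the values of \<open>\<phi>\<close> on \<open>B\<close>. Extended by zero,
  they represent \<open>\<phi>\<close> also outside \<open>V j\<close>.\<close>

lemma dual_basis: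
  "\<exists>B b. finite B \<and> B \<subseteq> V j \<and> (\<forall>x\<in>B. b x \<in> dual j) \<and> (\<forall>\<phi>\<in>dual j. \<forall>v. \<phi> v = (\<Sum>x\<in>B. \<phi> x * b x v))"
proof -
  obtain B where B: "B \<subseteq> V j" "vs.independent B" "V j \<subseteq> vs.span B"
    by (rule vs.basis_exists)
  obtain B0 where "finite B0" "V j = vs.span B0" using fin_dim[of j] unfolding fin_dim_subspace_def by auto
  then have fin: "finite B" using B vs.independent_span_bound by blast
  have sp: "vs.span B = V j" using B subspace_V by (simp add: vs.span_subspace)
  define b where "b x v = (if v \<in> V j then vs.representation B v x else 0)" for x v
  have cl: "v + w \<in> V j" "scale c v \<in> V j" if "v \<in> V j" "w \<in> V j" for v w c
    using that subspace_V by (auto intro: vs.subspace_add vs.subspace_scale)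
  have "b x \<in> dual j" for x
    using cl B(2) sp by (auto simp: dual_space_def b_def vs.representation_add vs.representation_scale)
  moreover have "\<phi> v = (\<Sum>x\<in>B. \<phi> x * b x v)" if "\<phi> \<in> dual j" for \<phi> v
  proof (cases "v \<in> V j")
    case True
    have "v = (\<Sum>x\<in>B. scale (vs.representation B v x) x)"
      using vs.sum_representation_eq[OF B(2), of v B] True sp fin by simp
    then have "\<phi> v = (\<Sum>x\<in>B. \<phi> (scale (vs.representation B v x) x))"
      using dual_apply_sum[OF that fin, of "\<lambda>x. scale (vs.representation B v x) x"] cl B(1)
      by (metis (no_types, lifting) subsetD)
    also have "\<dots> = (\<Sum>x\<in>B. vs.representation B v x * \<phi> x)"
      using that B(1) by (intro sum.cong) (auto simp: dual_space_def)
    finally show ?thesis using True by (simp add: b_def mult.commute)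
  next
    case False
    then show ?thesis using that by (simp add: b_def dual_space_def)
  qed
  ultimately show ?thesis
    by (intro exI[of _ B] exI[of _ b] conjI fin B(1) ballI allI)
qed

section \<open>Tensor positions and multilinear evaluation\<close>

text \<open>The positions of all factors are collected in one index set, so that a single evaluation
  and a single permutation group serve all factors at once.\<close>

definition Pos :: "('n \<times> nat) set" where
  "Pos = (SIGMA j:UNIV. {..<r * d j})"

lemma finite_Pos [simp]: "finite Pos"
  by (simp add: Pos_def)

lemma mem_Pos [simp]: "(j, i) \<in> Pos \<longleftrightarrow> i < r * d j"
  by (simp add: Pos_def)

definition covectors :: "('n \<times> nat \<Rightarrow> 'v \<Rightarrow> 'k) set" where
  "covectors = {\<phi>. \<forall>p\<in>Pos. \<phi> p \<in> dual (fst p)}"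

definition tuples :: "('n \<Rightarrow> ('v \<Rightarrow> 'k) list) set" where
  "tuples = {x. \<forall>j. length (x j) = r * d j \<and> set (x j) \<subseteq> dual j}"

text \<open>Schur functors consist of functions of lists, one list for each factor, while the proof
  uses covectors indexed by positions. \<open>tup\<close> and \<open>untup\<close>
  translate.\<close>

definition tup :: "('n \<times> nat \<Rightarrow> 'v \<Rightarrow> 'k) \<Rightarrow> 'n \<Rightarrow> ('v \<Rightarrow> 'k) list" where
  "tup \<phi> = (\<lambda>j. map (\<lambda>i. \<phi> (j, i)) [0..<r * d j])"

definition untup :: "('n \<Rightarrow> ('v \<Rightarrow> 'k) list) \<Rightarrow> 'n \<times> nat \<Rightarrow> 'v \<Rightarrow> 'k" where
  "untup x = (\<lambda>(j, i). x j ! i)"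

lemma tup_cong: "(\<And>p. p \<in> Pos \<Longrightarrow> \<phi> p = \<psi> p) \<Longrightarrow> tup \<phi> = tup \<psi>"
  by (auto simp: tup_def)

lemma tup_untup: "x \<in> tuples \<Longrightarrow> tup (untup x) = x"
  by (auto simp: tup_def untup_def tuples_def fun_eq_iff intro!: nth_equalityI)

lemma untup_covectors: "x \<in> tuples \<Longrightarrow> untup x \<in> covectors"
  by (auto simp: untup_def tuples_def covectors_def subset_eq)

lemma tup_tuples: "\<phi> \<in> covectors \<Longrightarrow> tup \<phi> \<in> tuples"
  by (auto simp: tup_def tuples_def covectors_def image_subset_iff Pos_def)

lemma untup_tup: "p \<in> Pos \<Longrightarrow> untup (tup \<phi>) p = \<phi> p"
  by (cases p) (simp add: untup_def tup_def)

definition pure :: "('n \<times> nat \<Rightarrow> 'v) \<Rightarrow> ('n \<Rightarrow> ('v \<Rightarrow> 'k) list) \<Rightarrow> 'k" where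
  "pure v = (\<lambda>x. if x \<in> tuples then \<Prod>p\<in>Pos. untup x p (v p) else 0)"

definition vectors :: "('n \<times> nat \<Rightarrow> 'v) set" where
  "vectors = {v. \<forall>p\<in>Pos. v p \<in> V (fst p)}"

definition ten :: "(('n \<Rightarrow> ('v \<Rightarrow> 'k) list) \<Rightarrow> 'k) set" where
  "ten = fspan (pure ` vectors)"

lemma pure_eq: "pure v = (\<lambda>x. \<Prod>j\<in>UNIV. pure_tensor scale (V j) (map (\<lambda>i. v (j, i)) [0..<r * d j]) (x j))"
proof
  fix x
  show "pure v x = (\<Prod>j\<in>UNIV. pure_tensor scale (V j) (map (\<lambda>i. v (j, i)) [0..<r * d j]) (x j))"
  proof (cases "x \<in> tuples")
    case True
    then have "(\<Prod>j\<in>UNIV. pure_tensor scale (V j) (map (\<lambda>i. v (j, i)) [0..<r * d j]) (x j)) =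
      (\<Prod>j\<in>UNIV. \<Prod>i<r * d j. (x j ! i) (v (j, i)))"
      by (intro prod.cong) (auto simp: pure_tensor_def tuples_def)
    then show ?thesis
      using True by (simp add: pure_def Pos_def prod.Sigma untup_def split_def)
  next
    case False
    then obtain j where "\<not> (length (x j) = r * d j \<and> set (x j) \<subseteq> dual j)" by (auto simp: tuples_def)
    then have "pure_tensor scale (V j) (map (\<lambda>i. v (j, i)) [0..<r * d j]) (x j) = 0"
      by (auto simp: pure_tensor_def)
    then show ?thesis using False by (auto simp: pure_def intro!: prod_zero[symmetric])
  qed
qed

definition ev :: "(('n \<Rightarrow> ('v \<Rightarrow> 'k) list) \<Rightarrow> 'k) \<Rightarrow> ('n \<times> nat \<Rightarrow> 'v \<Rightarrow> 'k) \<Rightarrow> 'k" where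
  "ev A \<phi> = A (tup \<phi>)"

lemma ev_cong: "(\<And>p. p \<in> Pos \<Longrightarrow> \<phi> p = \<psi> p) \<Longrightarrow> ev A \<phi> = ev A \<psi>"
  unfolding ev_def using tup_cong by metis

lemma ev_zero [simp]: "ev 0 \<phi> = 0" by (simp add: ev_def fun_apply)
lemma ev_add [simp]: "ev (A + B) \<phi> = ev A \<phi> + ev B \<phi>" by (simp add: ev_def fun_apply)
lemma ev_scale [simp]: "ev (fscale c A) \<phi> = c * ev A \<phi>" by (simp add: ev_def fun_apply)
lemma ev_sum [simp]: "ev (\<Sum>i\<in>I. A i) \<phi> = (\<Sum>i\<in>I. ev (A i) \<phi>)" by (simp add: ev_def fun_apply)

lemma ev_pure: "\<phi> \<in> covectors \<Longrightarrow> ev (pure v) \<phi> = (\<Prod>p\<in>Pos. \<phi> p (v p))"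
  by (simp add: ev_def pure_def tup_tuples untup_tup)

lemma ten_induct [consumes 1, case_names zero step]:
  assumes "A \<in> ten" "P 0" "\<And>c v A. v \<in> vectors \<Longrightarrow> A \<in> ten \<Longrightarrow> P A \<Longrightarrow> P (fscale c (pure v) + A)"
  shows "P A"
proof -
  have "A \<in> ten \<and> P A"
    using assms(1) unfolding ten_def
  proof (induction rule: fs.span_induct_alt)
    case base
    then show ?case using assms(2) fs.span_zero by blast
  next
    case (step c x y)
    then obtain v where v: "v \<in> vectors" "x = pure v" by blast
    have "x \<in> fspan (pure ` vectors)" using step(1) by (rule fs.span_base)
    then show ?case using assms(3)[OF v(1), of y c] step v(2)
      by (simp add: ten_def fs.span_add fs.span_scale )
  qed
  then show ?thesis ..
qed

lemma pure_ten: "v \<in> vectors \<Longrightarrow> pure v \<in> ten"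
  by (auto simp: ten_def intro: fs.span_base)
lemma ten_zero: "0 \<in> ten" by (simp add: ten_def fs.span_zero)
lemma ten_add: "A \<in> ten \<Longrightarrow> B \<in> ten \<Longrightarrow> A + B \<in> ten" by (simp add: ten_def fs.span_add)
lemma ten_scale: "A \<in> ten \<Longrightarrow> fscale c A \<in> ten" by (simp add: ten_def fs.span_scale)
lemma ten_sum: "(\<And>i. i \<in> I \<Longrightarrow> A i \<in> ten) \<Longrightarrow> (\<Sum>i\<in>I. A i) \<in> ten" by (simp add: ten_def fs.span_sum)

lemma ten_off: "A \<in> ten \<Longrightarrow> x \<notin> tuples \<Longrightarrow> A x = 0"
  by (induction rule: ten_induct) (auto simp: pure_def fun_apply)

text \<open>Equality of tensors as functions also concerns lists of wrong length or with entries
  outside the duals, where tensors vanish; all other arguments have the form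
  \<open>tup \<phi>\<close>.\<close>

lemma ten_ext:
  assumes "\<And>x. x \<notin> tuples \<Longrightarrow> A x = 0" "\<And>x. x \<notin> tuples \<Longrightarrow> B x = 0"
    "\<And>\<phi>. \<phi> \<in> covectors \<Longrightarrow> ev A \<phi> = ev B \<phi>"
  shows "A = B"
proof
  fix x
  show "A x = B x"
    using assms(1,2)[of x] assms(3)[of "untup x"]
    by (cases "x \<in> tuples") (auto simp: ev_def tup_untup untup_covectors)
qed

lemma ev_multilinear:
  assumes "A \<in> ten" "\<And>p. p \<in> Pos \<Longrightarrow> finite (I p)"
    "\<And>p m. p \<in> Pos \<Longrightarrow> m \<in> I p \<Longrightarrow> \<psi> p m \<in> dual (fst p)"
  shows "ev A (\<lambda>p v. \<Sum>m\<in>I p. \<psi> p m v) = (\<Sum>h\<in>PiE Pos I. ev A (\<lambda>p. \<psi> p (h p)))"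
  using assms(1)
proof (induction rule: ten_induct)
  case zero
  show ?case by simp
next
  case (step c v A)
  have "(\<lambda>p v. \<Sum>m\<in>I p. \<psi> p m v) \<in> covectors"
    using assms(3) by (auto simp: covectors_def intro!: dual_sum)
  then have "ev (pure v) (\<lambda>p v. \<Sum>m\<in>I p. \<psi> p m v) = (\<Prod>p\<in>Pos. \<Sum>m\<in>I p. \<psi> p m (v p))"
    by (simp add: ev_pure)
  also have "\<dots> = (\<Sum>h\<in>PiE Pos I. \<Prod>p\<in>Pos. \<psi> p (h p) (v p))"
    using assms(2) by (intro prod_sum_PiE) auto
  also have "\<dots> = (\<Sum>h\<in>PiE Pos I. ev (pure v) (\<lambda>p. \<psi> p (h p)))"
  proof (rule sum.cong[OF refl])
    fix h assume "h \<in> PiE Pos I"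
    then have "(\<lambda>p. \<psi> p (h p)) \<in> covectors"
      using assms(3) by (auto simp: covectors_def PiE_def Pi_def)
    then show "(\<Prod>p\<in>Pos. \<psi> p (h p) (v p)) = ev (pure v) (\<lambda>p. \<psi> p (h p))" by (simp add: ev_pure)
  qed
  finally show ?case using step by (simp add: sum.distrib sum_distrib_left)
qed

text \<open>In contrast to \<open>ev_multilinear\<close>, the scalar coefficients are kept apart;
  they become powers of the parameter in the substitutions below.\<close>

lemma ev_expand:
  assumes "A \<in> ten" "\<And>p. p \<in> Pos \<Longrightarrow> \<phi> p \<in> dual (fst p)" "\<And>p. p \<in> Pos \<Longrightarrow> \<psi> p \<in> dual (fst p)"
  shows "ev A (\<lambda>p v. a p * \<phi> p v + b p * \<psi> p v) =
    (\<Sum>Y\<in>Pow Pos. (\<Prod>p\<in>Pos - Y. a p) * (\<Prod>p\<in>Y. b p) * ev A (\<lambda>p. if p \<in> Y then \<psi> p else \<phi> p))"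
  using assms(1)
proof (induction rule: ten_induct)
  case zero
  show ?case by simp
next
  case (step c v A)
  have "(\<lambda>p v. a p * \<phi> p v + b p * \<psi> p v) \<in> covectors"
    using assms(2,3) by (auto simp: covectors_def intro!: dual_add dual_scale)
  then have "ev (pure v) (\<lambda>p v. a p * \<phi> p v + b p * \<psi> p v) = (\<Prod>p\<in>Pos. b p * \<psi> p (v p) + a p * \<phi> p (v p))"
    by (simp add: ev_pure add.commute)
  also have "\<dots> = (\<Sum>Y\<in>Pow Pos. (\<Prod>p\<in>Y. b p * \<psi> p (v p)) * (\<Prod>p\<in>Pos-Y. a p * \<phi> p (v p)))"
    by (rule prod_add) simp
  also have "\<dots> = (\<Sum>Y\<in>Pow Pos. (\<Prod>p\<in>Pos - Y. a p) * (\<Prod>p\<in>Y. b p) * ev (pure v) (\<lambda>p. if p \<in> Y then \<psi> p else \<phi> p))"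
  proof (rule sum.cong[OF refl])
    fix Y assume "Y \<in> Pow Pos"
    then have Y: "Y \<subseteq> Pos" by simp
    have "(\<lambda>p. if p \<in> Y then \<psi> p else \<phi> p) \<in> covectors"
      using assms(2,3) by (auto simp: covectors_def)
    then have "ev (pure v) (\<lambda>p. if p \<in> Y then \<psi> p else \<phi> p) = (\<Prod>p\<in>Pos. if p \<in> Y then \<psi> p (v p) else \<phi> p (v p))"
      by (auto simp: ev_pure intro!: prod.cong)
    also have "\<dots> = (\<Prod>p\<in>Y. \<psi> p (v p)) * (\<Prod>p\<in>Pos-Y. \<phi> p (v p))"
      using Y by (subst prod.subset_diff[of Y]) (auto simp: mult.commute intro!: arg_cong2[where f="(*)"] prod.cong)
    finally show "(\<Prod>p\<in>Y. b p * \<psi> p (v p)) * (\<Prod>p\<in>Pos-Y. a p * \<phi> p (v p)) =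
      (\<Prod>p\<in>Pos - Y. a p) * (\<Prod>p\<in>Y. b p) * ev (pure v) (\<lambda>p. if p \<in> Y then \<psi> p else \<phi> p)"
      by (simp add: prod.distrib algebra_simps)
  qed
  finally show ?case using step by (simp add: sum.distrib sum_distrib_left algebra_simps)
qed

section \<open>Permutations of positions within the factors\<close>

definition perms :: "('n \<times> nat \<Rightarrow> 'n \<times> nat) set" where
  "perms = {\<pi>. \<pi> permutes Pos \<and> (\<forall>p. fst (\<pi> p) = fst p)}"

lemma finite_perms [simp]: "finite perms"
  unfolding perms_def by (rule finite_subset[OF _ finite_permutations[OF finite_Pos]]) auto

lemma perms_id: "id \<in> perms"
  by (simp add: perms_def permutes_id)

lemma perms_comp: "\<pi> \<in> perms \<Longrightarrow> \<rho> \<in> perms \<Longrightarrow> \<pi> \<circ> \<rho> \<in> perms"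
  by (simp add: perms_def permutes_compose del: split_paired_All)

lemma perms_inv:
  assumes "\<pi> \<in> perms"
  shows "inv \<pi> \<in> perms"
proof -
  have \<pi>: "\<pi> permutes Pos" using assms by (simp add: perms_def)
  have "fst (\<pi> (inv \<pi> p)) = fst (inv \<pi> p)" for p
    using assms by (simp add: perms_def del: split_paired_All)
  then have "fst (inv \<pi> p) = fst p" for p
    by (simp add: permutes_inverses(1)[OF \<pi>])
  then show ?thesis using \<pi> by (simp add: perms_def permutes_inv del: split_paired_All)
qed

lemma perms_inv_comp: "\<pi> \<in> perms \<Longrightarrow> \<pi> \<circ> inv \<pi> = id" "\<pi> \<in> perms \<Longrightarrow> inv \<pi> \<circ> \<pi> = id"
  by (auto simp: perms_def permutes_inv_o)

lemma perms_mem: "\<pi> \<in> perms \<Longrightarrow> \<pi> p \<in> Pos \<longleftrightarrow> p \<in> Pos"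
  by (simp add: perms_def permutes_in_image)

lemma perms_fst: "\<pi> \<in> perms \<Longrightarrow> fst (\<pi> p) = fst p"
  by (simp add: perms_def del: split_paired_All)

lemma perms_inj: "\<pi> \<in> perms \<Longrightarrow> inj \<pi>"
  by (auto simp: perms_def permutes_inj)

lemma covectors_perm:
  assumes "\<phi> \<in> covectors" "\<pi> \<in> perms"
  shows "\<phi> \<circ> \<pi> \<in> covectors"
proof -
  have "\<phi> (\<pi> p) \<in> dual (fst p)" if "p \<in> Pos" for p
    using assms(1) that perms_mem[OF assms(2), of p] perms_fst[OF assms(2), of p] unfolding covectors_def by force
  then show ?thesis by (simp add: covectors_def)
qed

lemma sum_perms_left:
  assumes "\<pi> \<in> perms"
  shows "(\<Sum>\<rho>\<in>perms. F (\<pi> \<circ> \<rho>)) = (\<Sum>\<rho>\<in>perms. F \<rho>)"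
  by (rule sum.reindex_bij_witness[of _ "\<lambda>\<rho>. inv \<pi> \<circ> \<rho>" "\<lambda>\<rho>. \<pi> \<circ> \<rho>"])
    (use assms in \<open>auto simp: o_assoc perms_inv_comp intro: perms_comp perms_inv\<close>)

lemma sum_perms_right:
  assumes "\<pi> \<in> perms"
  shows "(\<Sum>\<rho>\<in>perms. F (\<rho> \<circ> \<pi>)) = (\<Sum>\<rho>\<in>perms. F \<rho>)"
  by (rule sum.reindex_bij_witness[of _ "\<lambda>\<rho>. \<rho> \<circ> inv \<pi>" "\<lambda>\<rho>. \<rho> \<circ> \<pi>"])
    (use assms in \<open>auto simp: o_assoc[symmetric] perms_inv_comp intro: perms_comp perms_inv\<close>)

text \<open>The entry at position \<open>p\<close> moves to \<open>\<pi> p\<close>, which on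
  covectors is precomposition (\<open>ev_move\<close>). The cutoff outside \<open>tuples\<close>
  keeps the result in \<open>ten\<close>.\<close>

definition move :: "('n \<times> nat \<Rightarrow> 'n \<times> nat) \<Rightarrow> (('n \<Rightarrow> ('v \<Rightarrow> 'k) list) \<Rightarrow> 'k) \<Rightarrow> ('n \<Rightarrow> ('v \<Rightarrow> 'k) list) \<Rightarrow> 'k" where
  "move \<pi> A = (\<lambda>x. if x \<in> tuples then ev A (untup x \<circ> \<pi>) else 0)"

lemma ev_move: "\<phi> \<in> covectors \<Longrightarrow> \<pi> \<in> perms \<Longrightarrow> ev (move \<pi> A) \<phi> = ev A (\<phi> \<circ> \<pi>)"
  unfolding move_def ev_def[of "\<lambda>x. if x \<in> tuples then _ x else _"]
  by (auto simp: tup_tuples perms_mem untup_tup intro: ev_cong)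

lemma move_pure:
  assumes "\<pi> \<in> perms"
  shows "move \<pi> (pure v) = pure (v \<circ> inv \<pi>)"
proof (rule ten_ext)
  fix \<phi> assume \<phi>: "\<phi> \<in> covectors"
  have \<pi>: "\<pi> permutes Pos" using assms by (simp add: perms_def)
  have "ev (move \<pi> (pure v)) \<phi> = (\<Prod>p\<in>Pos. \<phi> (\<pi> p) (v p))"
    using \<phi> assms by (simp add: ev_move ev_pure covectors_perm)
  also have "\<dots> = (\<Prod>p\<in>Pos. \<phi> p (v (inv \<pi> p)))"
    by (rule prod.reindex_bij_witness[of _ "inv \<pi>" \<pi>])
      (use assms in \<open>auto simp: permutes_inverses[OF \<pi>] perms_mem perms_inv\<close>)
  finally show "ev (move \<pi> (pure v)) \<phi> = ev (pure (v \<circ> inv \<pi>)) \<phi>"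
    using \<phi> by (simp add: ev_pure)
qed (auto simp: move_def pure_def)

lemma move_ten: "A \<in> ten \<Longrightarrow> \<pi> \<in> perms \<Longrightarrow> move \<pi> A \<in> ten"
proof (induction rule: ten_induct)
  case zero
  have "move \<pi> 0 = 0" by (auto simp: move_def fun_eq_iff ev_def fun_apply)
  then show ?case by (simp add: ten_zero)
next
  case (step c v A)
  have "move \<pi> (fscale c (pure v) + A) = fscale c (move \<pi> (pure v)) + move \<pi> A"
    by (auto simp: move_def fun_eq_iff ev_def fun_apply)
  moreover have "v \<circ> inv \<pi> \<in> vectors"
    using step perms_inv[of \<pi>] perms_fst[of "inv \<pi>"] perms_mem[of "inv \<pi>"] by (auto simp: vectors_def) (metis fst_conv mem_Pos)
  ultimately show ?case using step by (auto simp: move_pure intro!: ten_add ten_scale pure_ten)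
qed

section \<open>Polarization and sums over choices\<close>

definition pattern :: "('n \<Rightarrow> 'v \<Rightarrow> 'k) \<Rightarrow> ('n \<Rightarrow> 'v \<Rightarrow> 'k) \<Rightarrow> ('n \<times> nat) set \<Rightarrow> 'n \<times> nat \<Rightarrow> 'v \<Rightarrow> 'k" where
  "pattern e f S = (\<lambda>p. if p \<in> S then f (fst p) else e (fst p))"

definition duals :: "('n \<Rightarrow> 'v \<Rightarrow> 'k) set" where
  "duals = {e. \<forall>j. e j \<in> dual j}"

lemma duals_lincomb: "e \<in> duals \<Longrightarrow> f \<in> duals \<Longrightarrow> (\<lambda>j v. a j * e j v + b j * f j v) \<in> duals"
  by (auto simp: duals_def intro!: dual_add dual_scale)

lemma pattern_covectors: "e \<in> duals \<Longrightarrow> f \<in> duals \<Longrightarrow> pattern e f S \<in> covectors"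
  by (auto simp: pattern_def duals_def covectors_def)

lemma pattern_perm: "\<pi> \<in> perms \<Longrightarrow> pattern e f S \<circ> \<pi> = pattern e f (\<pi> -` S)"
  by (auto simp: pattern_def fun_eq_iff perms_fst)

definition stabilizer :: "('n \<times> nat) set \<Rightarrow> ('n \<times> nat \<Rightarrow> 'n \<times> nat) set" where
  "stabilizer X = {\<sigma>\<in>perms. \<forall>p. \<sigma> p \<in> X \<longleftrightarrow> p \<in> X}"

lemma finite_stabilizer [simp]: "finite (stabilizer X)"
  by (simp add: stabilizer_def)

lemma stabilizer_id: "id \<in> stabilizer X"
  by (simp add: stabilizer_def perms_id)

text \<open>The hypothesis concerns only repeated arguments. Inserting the sums of the
  \<open>\<phi> p\<close> over \<open>p \<in> I\<close> and alternating over \<open>I\<close>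
  isolates the terms that use every covector once. They correspond to the permutations that respect
  the factors and \<open>X\<close>; for the second row as \<open>X\<close> these are the row
  permutations.\<close>

lemma polarization:
  assumes X: "X \<subseteq> Pos" and A: "A \<in> ten"
    and zero: "\<And>e f. e \<in> duals \<Longrightarrow> f \<in> duals \<Longrightarrow> ev A (pattern e f X) = 0"
    and \<phi>: "\<phi> \<in> covectors"
  shows "(\<Sum>\<sigma>\<in>stabilizer X. ev A (\<phi> \<circ> \<sigma>)) = 0"
proof -
  \<comment> \<open>\<open>C q\<close> contains the positions whose covector occurs in the sum
    inserted at \<open>q\<close>.\<close>
  define C where "C q = {p\<in>Pos. fst p = fst q \<and> (p \<in> X \<longleftrightarrow> q \<in> X)}" for q :: "'n \<times> nat"
  have *: "(\<Sum>h\<in>PiE Pos (\<lambda>q. C q \<inter> I). ev A (\<lambda>p. \<phi> (h p))) = 0" if I: "I \<subseteq> Pos" for I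
  proof -
    define e where "e j v = (\<Sum>p\<in>{p\<in>I. fst p = j \<and> p \<notin> X}. \<phi> p v)" for j v
    define f where "f j v = (\<Sum>p\<in>{p\<in>I. fst p = j \<and> p \<in> X}. \<phi> p v)" for j v
    have "\<phi> p \<in> dual (fst p)" if "p \<in> I" for p
      using I \<phi> that by (auto simp: covectors_def)
    then have "e \<in> duals" "f \<in> duals"
      unfolding duals_def e_def f_def by (auto intro!: dual_sum)
    then have "0 = ev A (pattern e f X)" using zero by simp
    also have "\<dots> = ev A (\<lambda>q v. \<Sum>m\<in>C q \<inter> I. \<phi> m v)"
    proof (rule ev_cong)
      fix q assume "q \<in> Pos"
      have "C q \<inter> I = {p\<in>I. fst p = fst q \<and> (p \<in> X \<longleftrightarrow> q \<in> X)}" using I by (auto simp: C_def)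
      then show "pattern e f X q = (\<lambda>v. \<Sum>m\<in>C q \<inter> I. \<phi> m v)"
        by (auto simp: pattern_def e_def f_def)
    qed
    also have "\<dots> = (\<Sum>h\<in>PiE Pos (\<lambda>q. C q \<inter> I). ev A (\<lambda>p. \<phi> (h p)))"
      using \<phi> by (intro ev_multilinear[OF A]) (auto simp: C_def covectors_def)
    finally show ?thesis ..
  qed
  have "(\<Sum>h\<in>{h\<in>PiE Pos C. h ` Pos = Pos}. ev A (\<lambda>p. \<phi> (h p))) =
    (\<Sum>I\<in>Pow Pos. (- 1) ^ card (Pos - I) * (\<Sum>h\<in>PiE Pos (\<lambda>q. C q \<inter> I). ev A (\<lambda>p. \<phi> (h p))))"
    by (rule sum_surjective_PiE[symmetric]) (auto simp: C_def)
  also have "\<dots> = 0" using * by simp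
  \<comment> \<open>A map of the finite set \<open>Pos\<close> onto itself is a permutation, and the
    condition \<open>h q \<in> C q\<close> puts it into the stabilizer.\<close>
  also have "(\<Sum>h\<in>{h\<in>PiE Pos C. h ` Pos = Pos}. ev A (\<lambda>p. \<phi> (h p))) = (\<Sum>\<sigma>\<in>stabilizer X. ev A (\<phi> \<circ> \<sigma>))"
  proof (rule sum.reindex_bij_witness[of _ "\<lambda>\<sigma>. restrict \<sigma> Pos" "\<lambda>h p. if p \<in> Pos then h p else p"])
    fix h assume h: "h \<in> {h\<in>PiE Pos C. h ` Pos = Pos}"
    show "restrict (\<lambda>p. if p \<in> Pos then h p else p) Pos = h"
      using h by (auto simp: PiE_def extensional_def restrict_def)
    have inj: "inj_on h Pos" using h by (intro eq_card_imp_inj_on) auto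
    have "bij_betw (\<lambda>p. if p \<in> Pos then h p else p) Pos Pos"
      using inj h by (auto simp: bij_betw_def inj_on_def)
    then have "(\<lambda>p. if p \<in> Pos then h p else p) permutes Pos"
      by (rule bij_imp_permutes) auto
    then show "(\<lambda>p. if p \<in> Pos then h p else p) \<in> stabilizer X"
      using h X unfolding stabilizer_def perms_def C_def PiE_def Pi_def by auto
    show "ev A (\<phi> \<circ> (\<lambda>p. if p \<in> Pos then h p else p)) = ev A (\<lambda>p. \<phi> (h p))"
      by (rule ev_cong) simp
  next
    fix \<sigma> assume \<sigma>: "\<sigma> \<in> stabilizer X"
    then have p: "\<sigma> permutes Pos" by (auto simp: stabilizer_def perms_def)
    show "(\<lambda>p. if p \<in> Pos then restrict \<sigma> Pos p else p) = \<sigma>"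
      using p by (auto simp: fun_eq_iff permutes_not_in)
    show "restrict \<sigma> Pos \<in> {h\<in>PiE Pos C. h ` Pos = Pos}"
      using \<sigma> p permutes_image[OF p] by (auto simp: stabilizer_def C_def perms_mem perms_fst)
  qed
  finally show ?thesis .
qed

lemma ev_scale_args:
  assumes "A \<in> ten" "\<phi> \<in> covectors"
  shows "ev A (\<lambda>p v. a p * \<phi> p v) = (\<Prod>p\<in>Pos. a p) * ev A \<phi>"
proof -
  have "ev A (\<lambda>p v. a p * \<phi> p v + 0 * \<phi> p v) = (\<Sum>Y\<in>Pow Pos.
    (\<Prod>p\<in>Pos - Y. a p) * (\<Prod>p\<in>Y. 0) * ev A (\<lambda>p. if p \<in> Y then \<phi> p else \<phi> p))"
    using assms(2) by (intro ev_expand[OF assms(1)]) (auto simp: covectors_def)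
  also have "\<dots> = (\<Sum>Y\<in>{{}}. (\<Prod>p\<in>Pos - Y. a p) * (\<Prod>p\<in>Y. 0) * ev A (\<lambda>p. if p \<in> Y then \<phi> p else \<phi> p))"
  proof (rule sum.mono_neutral_right)
    show "\<forall>Y\<in>Pow Pos - {{}}. (\<Prod>p\<in>Pos - Y. a p) * (\<Prod>p\<in>Y. 0) * ev A (\<lambda>p. if p \<in> Y then \<phi> p else \<phi> p) = 0"
      by (auto simp: finite_subset[OF _ finite_Pos] card_gt_0_iff)
  qed auto
  finally show ?thesis by simp
qed

definition cnt :: "('n \<times> nat) set \<Rightarrow> 'n \<Rightarrow> nat" where
  "cnt S j = card {p\<in>S. fst p = j}"

lemma sum_cnt: "finite S \<Longrightarrow> (\<Sum>j\<in>UNIV. cnt S j) = card S"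
proof -
  assume S: "finite S"
  have "(\<Sum>j\<in>UNIV. \<Sum>p\<in>{p\<in>S. fst p = j}. 1) = (\<Sum>p\<in>S. 1::nat)"
    by (rule sum.group) (use S in auto)
  then show ?thesis by (simp add: cnt_def)
qed

lemma prod_cnt: "finite S \<Longrightarrow> (\<Prod>p\<in>S. t (fst p)) = (\<Prod>j\<in>UNIV. t j ^ cnt S j)"
  for t :: "'n \<Rightarrow> 'k"
proof -
  assume S: "finite S"
  have "(\<Prod>j\<in>UNIV. \<Prod>p\<in>{p\<in>S. fst p = j}. t (fst p)) = (\<Prod>p\<in>S. t (fst p))"
    by (rule prod.group) (use S in auto)
  moreover have "(\<Prod>p\<in>{p\<in>S. fst p = j}. t (fst p)) = t j ^ cnt S j" for j
    by (simp add: cnt_def)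
  ultimately show ?thesis by simp
qed

text \<open>Replacing \<open>f j\<close> by \<open>t j * f j\<close> multiplies the term of
  \<open>i\<close> by the monomial with exponents \<open>cnt (S i)\<close>. The family of tensors is
  there for the comparison of several shapes at once.\<close>

lemma degree_component:
  assumes M: "finite M" "\<And>i. i \<in> M \<Longrightarrow> A i \<in> ten" "\<And>i. i \<in> M \<Longrightarrow> S i \<subseteq> Pos"
    and zero: "\<And>e f. e \<in> duals \<Longrightarrow> f \<in> duals \<Longrightarrow> (\<Sum>i\<in>M. w i * ev (A i) (pattern e f (S i))) = 0"
    and ef: "e \<in> duals" "f \<in> duals"
  shows "(\<Sum>i\<in>{i\<in>M. cnt (S i) = s}. w i * ev (A i) (pattern e f (S i))) = 0"
proof -
  have "(\<Sum>i\<in>{i\<in>M. \<forall>j\<in>UNIV. cnt (S i) j = s j}. w i * ev (A i) (pattern e f (S i))) = 0"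
  proof (rule monomial_sum_coeff_zero[OF finite_UNIV M(1)])
    fix t :: "'n \<Rightarrow> 'k"
    define f' where "f' j v = t j * f j v" for j v
    have "f' \<in> duals" using duals_lincomb[OF ef(1,2), of "\<lambda>_. 0" t] by (simp add: f'_def[abs_def])
    then have "0 = (\<Sum>i\<in>M. w i * ev (A i) (pattern e f' (S i)))" using zero ef by simp
    also have "\<dots> = (\<Sum>i\<in>M. w i * ev (A i) (pattern e f (S i)) * (\<Prod>j\<in>UNIV. t j ^ cnt (S i) j))"
    proof (rule sum.cong[OF refl])
      fix i assume i: "i \<in> M"
      have "ev (A i) (pattern e f' (S i)) = ev (A i) (\<lambda>p v. (if p \<in> S i then t (fst p) else 1) * pattern e f (S i) p v)"
        by (rule ev_cong) (auto simp: pattern_def f'_def)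
      also have "\<dots> = (\<Prod>p\<in>Pos. if p \<in> S i then t (fst p) else 1) * ev (A i) (pattern e f (S i))"
        using M(2)[OF i] ef by (intro ev_scale_args) (auto intro: pattern_covectors)
      also have "(\<Prod>p\<in>Pos. if p \<in> S i then t (fst p) else 1) = (\<Prod>p\<in>S i. t (fst p))"
        using M(3)[OF i] by (simp add: prod.If_cases Int_absorb1)
      also have "\<dots> = (\<Prod>j\<in>UNIV. t j ^ cnt (S i) j)"
        using M(3)[OF i] finite_subset[OF _ finite_Pos] by (intro prod_cnt) auto
      finally show "w i * ev (A i) (pattern e f' (S i)) = w i * ev (A i) (pattern e f (S i)) * (\<Prod>j\<in>UNIV. t j ^ cnt (S i) j)"
        by simp
    qed
    finally show "(\<Sum>i\<in>M. w i * ev (A i) (pattern e f (S i)) * (\<Prod>j\<in>UNIV. t j ^ cnt (S i) j)) = 0" ..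
  qed
  then show ?thesis by (simp add: fun_eq_iff)
qed

section \<open>Blocks, partial choices and lowering of their size\<close>

definition valid_blocks :: "('n \<times> nat \<Rightarrow> nat) \<Rightarrow> bool" where
  "valid_blocks bl \<longleftrightarrow> (\<forall>p\<in>Pos. bl p < r) \<and> (\<forall>k<r. \<forall>j. card {i. i < r * d j \<and> bl (j, i) = k} = d j)"

text \<open>Injectivity of \<open>bl\<close> admits at most one position per block. Size
  \<open>r\<close> means one position in every block, as in a product of \<open>r\<close> tangent
  vectors; smaller sizes arise when some \<open>f\<close> are replaced by \<open>e\<close>.\<close>

definition choices :: "('n \<times> nat \<Rightarrow> nat) \<Rightarrow> ('n \<times> nat) set set" where
  "choices bl = {S. S \<subseteq> Pos \<and> inj_on bl S}"

lemma finite_choices [simp]: "finite (choices bl)"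
  by (rule finite_subset[of _ "Pow Pos"]) (auto simp: choices_def)

lemma choices_finite: "S \<in> choices bl \<Longrightarrow> finite S"
  by (auto simp: choices_def intro: finite_subset[OF _ finite_Pos])

definition choice_sum :: "('n \<times> nat \<Rightarrow> nat) \<Rightarrow> nat \<Rightarrow> (('n \<Rightarrow> ('v \<Rightarrow> 'k) list) \<Rightarrow> 'k) \<Rightarrow>
    ('n \<Rightarrow> 'v \<Rightarrow> 'k) \<Rightarrow> ('n \<Rightarrow> 'v \<Rightarrow> 'k) \<Rightarrow> 'k" where
  "choice_sum bl s A e f = (\<Sum>S\<in>{S\<in>choices bl. card S = s}. ev A (pattern e f S))"

text \<open>\<open>r - card U\<close> blocks are untouched, and each has \<open>d j\<close>
  positions in factor \<open>j\<close>. That only the size of \<open>U\<close> matters is the basis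
  of both the lowering of sizes and the exchange relation.\<close>

lemma card_free_positions:
  assumes "valid_blocks bl" "U \<in> choices bl"
  shows "card {i. i < r * d j \<and> bl (j, i) \<notin> bl ` U} = (r - card U) * d j"
proof -
  have "card (\<Union>k\<in>{..<r} - bl ` U. {i. i < r * d j \<and> bl (j, i) = k}) =
      (\<Sum>k\<in>{..<r} - bl ` U. card {i. i < r * d j \<and> bl (j, i) = k})"
    by (rule card_UN_disjoint) auto
  also have "\<dots> = (\<Sum>k\<in>{..<r} - bl ` U. d j)"
    using assms(1) by (intro sum.cong) (auto simp: valid_blocks_def)
  also have "\<dots> = card ({..<r} - bl ` U) * d j" by simp
  also have "card ({..<r} - bl ` U) = r - card (bl ` U)"
    using assms by (subst card_Diff_subset) (auto simp: valid_blocks_def choices_def choices_finite)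
  also have "card (bl ` U) = card U"
    using assms(2) by (intro card_image) (simp add: choices_def)
  also have "(\<Union>k\<in>{..<r} - bl ` U. {i. i < r * d j \<and> bl (j, i) = k}) = {i. i < r * d j \<and> bl (j, i) \<notin> bl ` U}"
    using assms(1) by (auto simp: valid_blocks_def)
  finally show ?thesis .
qed

definition free :: "('n \<times> nat \<Rightarrow> nat) \<Rightarrow> ('n \<times> nat) set \<Rightarrow> ('n \<times> nat) set" where
  "free bl U = {p\<in>Pos. bl p \<notin> bl ` U}"

lemma card_free:
  assumes "valid_blocks bl" "U \<in> choices bl"
  shows "card (free bl U) = (r - card U) * (\<Sum>j\<in>UNIV. d j)"
proof -
  have "free bl U = (SIGMA j:UNIV. {i. i < r * d j \<and> bl (j, i) \<notin> bl ` U})"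
    by (auto simp: free_def)
  then show ?thesis
    using card_free_positions[OF assms] by (simp add: sum_distrib_left)
qed

lemma ev_pattern_shift:
  assumes "A \<in> ten" "e \<in> duals" "f \<in> duals" "S \<subseteq> Pos"
  shows "ev A (pattern e (\<lambda>j v. u * e j v + f j v) S) = (\<Sum>Y\<in>Pow S. u ^ card (S - Y) * ev A (pattern e f Y))"
proof -
  \<comment> \<open>The coefficient \<open>0\<close> outside \<open>S\<close> removes all terms
    whose set \<open>Y\<close> is not contained in \<open>S\<close>.\<close>
  let ?a = "\<lambda>p. if p \<in> S then u else 1" and ?b = "\<lambda>p. if p \<in> S then 1 else 0"
  have fS: "finite S" using assms(4) finite_Pos by (rule finite_subset)
  have "ev A (pattern e (\<lambda>j v. u * e j v + f j v) S) = ev A (\<lambda>p v. ?a p * e (fst p) v + ?b p * f (fst p) v)"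
    by (rule ev_cong) (auto simp: pattern_def)
  also have "\<dots> = (\<Sum>Y\<in>Pow Pos. (\<Prod>p\<in>Pos - Y. ?a p) * (\<Prod>p\<in>Y. ?b p) * ev A (\<lambda>p. if p \<in> Y then f (fst p) else e (fst p)))"
    using assms by (intro ev_expand) (auto simp: duals_def)
  also have "\<dots> = (\<Sum>Y\<in>Pow S. (\<Prod>p\<in>Pos - Y. ?a p) * (\<Prod>p\<in>Y. ?b p) * ev A (\<lambda>p. if p \<in> Y then f (fst p) else e (fst p)))"
  proof (rule sum.mono_neutral_right)
    show "\<forall>Y\<in>Pow Pos - Pow S. (\<Prod>p\<in>Pos - Y. ?a p) * (\<Prod>p\<in>Y. ?b p) * ev A (\<lambda>p. if p \<in> Y then f (fst p) else e (fst p)) = 0"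
    proof
      fix Y assume Y: "Y \<in> Pow Pos - Pow S"
      then have "(\<Prod>p\<in>Y. ?b p) = (0::'k)"
        by (intro prod_zero) (auto intro: finite_subset[OF _ finite_Pos])
      then show "(\<Prod>p\<in>Pos - Y. ?a p) * (\<Prod>p\<in>Y. ?b p) * ev A (\<lambda>p. if p \<in> Y then f (fst p) else e (fst p)) = 0"
        by simp
    qed
  qed (use assms(4) in auto)
  also have "\<dots> = (\<Sum>Y\<in>Pow S. u ^ card (S - Y) * ev A (pattern e f Y))"
  proof (rule sum.cong[OF refl])
    fix Y assume Y: "Y \<in> Pow S"
    have "(\<Prod>p\<in>Pos - Y. ?a p) = (\<Prod>p\<in>S - Y. u)"
      using assms(4) Y by (intro prod.mono_neutral_cong_right) auto
    moreover have "(\<Prod>p\<in>Y. ?b p) = (1::'k)" using Y by (intro prod.neutral) auto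
    ultimately show "(\<Prod>p\<in>Pos - Y. ?a p) * (\<Prod>p\<in>Y. ?b p) * ev A (\<lambda>p. if p \<in> Y then f (fst p) else e (fst p)) =
      u ^ card (S - Y) * ev A (pattern e f Y)"
      by (simp add: pattern_def[abs_def])
  qed
  finally show ?thesis .
qed

text \<open>Double counting: instead of removing a position from \<open>S\<close>, start with the
  smaller choice and add an element of \<open>free bl U\<close>, a set whose size depends only on
  \<open>s\<close>.\<close>

lemma sum_choices_remove_one:
  fixes g :: "('n \<times> nat) set \<Rightarrow> 'k"
  assumes "valid_blocks bl"
  shows "(\<Sum>(S,Y)\<in>{(S,Y). S \<in> choices bl \<and> card S = Suc s \<and> Y \<subseteq> S \<and> card (S - Y) = 1}. g Y) =
    of_nat ((r - s) * (\<Sum>j\<in>UNIV. d j)) * (\<Sum>U\<in>{U\<in>choices bl. card U = s}. g U)"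
proof -
  let ?T = "{(S,Y). S \<in> choices bl \<and> card S = Suc s \<and> Y \<subseteq> S \<and> card (S - Y) = 1}"
  have "(\<Sum>(S,Y)\<in>?T. g Y) = (\<Sum>(U,p)\<in>(SIGMA U:{U\<in>choices bl. card U = s}. free bl U). g U)"
  proof (rule sum.reindex_bij_witness[of _ "\<lambda>(U,p). (insert p U, U)" "\<lambda>(S,Y). (Y, the_elem (S - Y))"])
    fix a assume "a \<in> ?T"
    then obtain S Y where a: "a = (S, Y)" "S \<in> choices bl" "card S = Suc s" "Y \<subseteq> S" "card (S - Y) = 1" by auto
    then obtain p where p: "S - Y = {p}" using card_1_singletonE by blast
    then have S: "S = insert p Y" "p \<notin> Y" using a(4) by auto
    have "finite Y" using a(2,4) choices_finite finite_subset by blast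
    then show "(case case a of (S, Y) \<Rightarrow> (Y, the_elem (S - Y)) of (U, p) \<Rightarrow> (insert p U, U)) = a"
      "(case a of (S, Y) \<Rightarrow> (Y, the_elem (S - Y))) \<in> (SIGMA U:{U\<in>choices bl. card U = s}. free bl U)"
      using a S p by (auto simp: choices_def free_def)
    show "(case case a of (S, Y) \<Rightarrow> (Y, the_elem (S - Y)) of (U, p) \<Rightarrow> g U) = (case a of (S, Y) \<Rightarrow> g Y)"
      using a by simp
  next
    fix b assume "b \<in> (SIGMA U:{U\<in>choices bl. card U = s}. free bl U)"
    then obtain U p where b: "b = (U, p)" "U \<in> choices bl" "card U = s" "p \<in> free bl U" by auto
    then have p: "p \<notin> U" by (auto simp: free_def)
    then have "insert p U - U = {p}" by auto
    then show "(case case b of (U, p) \<Rightarrow> (insert p U, U) of (S, Y) \<Rightarrow> (Y, the_elem (S - Y))) = b"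
      "(case b of (U, p) \<Rightarrow> (insert p U, U)) \<in> ?T"
      using b p choices_finite[OF b(2)] by (auto simp: choices_def free_def)
  qed
  also have "\<dots> = (\<Sum>U\<in>{U\<in>choices bl. card U = s}. \<Sum>p\<in>free bl U. g U)"
    by (rule sum.Sigma[symmetric]) (auto simp: free_def)
  also have "\<dots> = (\<Sum>U\<in>{U\<in>choices bl. card U = s}. of_nat ((r - s) * (\<Sum>j\<in>UNIV. d j)) * g U)"
    by (rule sum.cong[OF refl]) (use card_free[OF assms] in auto)
  finally show ?thesis by (simp add: sum_distrib_left)
qed

text \<open>Compare the coefficients of \<open>u\<close> after replacing \<open>f\<close> by
  \<open>u * e + f\<close>. The linear terms turn one \<open>f\<close> of a choice of size
  \<open>Suc s\<close> into \<open>e\<close>, and each choice of size \<open>s\<close> arises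
  equally often, a positive number of times because \<open>s < r\<close>. The index \<open>i\<close>
  allows tensors with different block distributions in one relation.\<close>

lemma choice_sum_lower:
  assumes M: "finite M" "\<And>i. i \<in> M \<Longrightarrow> A i \<in> ten" "\<And>i. i \<in> M \<Longrightarrow> valid_blocks (bl i)"
    and s: "s < r"
    and zero: "\<And>e f. e \<in> duals \<Longrightarrow> f \<in> duals \<Longrightarrow> (\<Sum>i\<in>M. choice_sum (bl i) (Suc s) (A i) e f) = 0"
    and ef: "e \<in> duals" "f \<in> duals"
  shows "(\<Sum>i\<in>M. choice_sum (bl i) s (A i) e f) = 0"
proof -
  let ?T = "\<lambda>i. {(S,Y). S \<in> choices (bl i) \<and> card S = Suc s \<and> Y \<subseteq> S}"
  have T: "?T i = (SIGMA S:{S\<in>choices (bl i). card S = Suc s}. Pow S)" for i by auto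
  have finT: "finite (?T i)" for i
    unfolding T by (rule finite_SigmaI) (auto intro: choices_finite)
  let ?M = "SIGMA i:M. ?T i"
  have fM: "finite ?M" using M(1) finT by (intro finite_SigmaI) auto
  have "(\<Sum>x\<in>{x\<in>?M. card (fst (snd x) - snd (snd x)) = 1}. ev (A (fst x)) (pattern e f (snd (snd x)))) = 0"
  proof (rule power_sum_coeff_zero[OF fM])
    fix u :: 'k
    have f': "(\<lambda>j v. u * e j v + f j v) \<in> duals" using duals_lincomb[OF ef, of "\<lambda>_. u" "\<lambda>_. 1"] by simp
    have "(\<Sum>x\<in>?M. ev (A (fst x)) (pattern e f (snd (snd x))) * u ^ card (fst (snd x) - snd (snd x))) =
      (\<Sum>i\<in>M. \<Sum>y\<in>?T i. ev (A i) (pattern e f (snd y)) * u ^ card (fst y - snd y))"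
      by (subst sum.Sigma) (use M(1) finT in \<open>auto simp: split_def\<close>)
    also have "\<dots> = (\<Sum>i\<in>M. choice_sum (bl i) (Suc s) (A i) e (\<lambda>j v. u * e j v + f j v))"
    proof (rule sum.cong[OF refl])
      fix i assume i: "i \<in> M"
      have "(\<Sum>y\<in>?T i. ev (A i) (pattern e f (snd y)) * u ^ card (fst y - snd y)) =
        (\<Sum>S\<in>{S\<in>choices (bl i). card S = Suc s}. \<Sum>Y\<in>Pow S. ev (A i) (pattern e f Y) * u ^ card (S - Y))"
        unfolding T by (subst sum.Sigma) (auto simp: split_def choices_finite)
      also have "\<dots> = choice_sum (bl i) (Suc s) (A i) e (\<lambda>j v. u * e j v + f j v)"
        unfolding choice_sum_def
      proof (rule sum.cong[OF refl])
        fix S assume "S \<in> {S \<in> choices (bl i). card S = Suc s}"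
        then show "(\<Sum>Y\<in>Pow S. ev (A i) (pattern e f Y) * u ^ card (S - Y)) =
          ev (A i) (pattern e (\<lambda>j v. u * e j v + f j v) S)"
          using ev_pattern_shift[OF M(2)[OF i] ef, of S u] by (simp add: choices_def mult.commute)
      qed
      finally show "(\<Sum>y\<in>?T i. ev (A i) (pattern e f (snd y)) * u ^ card (fst y - snd y)) =
        choice_sum (bl i) (Suc s) (A i) e (\<lambda>j v. u * e j v + f j v)" .
    qed
    also have "\<dots> = 0" using zero[OF ef(1) f'] .
    finally show "(\<Sum>x\<in>?M. ev (A (fst x)) (pattern e f (snd (snd x))) * u ^ card (fst (snd x) - snd (snd x))) = 0" .
  qed
  also have "{x\<in>?M. card (fst (snd x) - snd (snd x)) = 1} =
      (SIGMA i:M. {(S,Y). S \<in> choices (bl i) \<and> card S = Suc s \<and> Y \<subseteq> S \<and> card (S - Y) = 1})" (is "_ = Sigma M ?R")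
    by auto
  also have "(\<Sum>x\<in>Sigma M ?R. ev (A (fst x)) (pattern e f (snd (snd x)))) =
      (\<Sum>i\<in>M. \<Sum>y\<in>?R i. ev (A i) (pattern e f (snd y)))"
  proof -
    have "finite (?R i)" for i by (rule finite_subset[OF _ finT[of i]]) auto
    then show ?thesis by (subst sum.Sigma) (use M(1) in \<open>auto simp: split_def\<close>)
  qed
  also have "\<dots> = (\<Sum>i\<in>M. of_nat ((r - s) * (\<Sum>j\<in>UNIV. d j)) * choice_sum (bl i) s (A i) e f)"
  proof (rule sum.cong[OF refl])
    fix i assume "i \<in> M"
    from sum_choices_remove_one[OF M(3)[OF this], of "\<lambda>Y. ev (A i) (pattern e f Y)" s]
    show "(\<Sum>y\<in>?R i. ev (A i) (pattern e f (snd y))) =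
      of_nat ((r - s) * (\<Sum>j\<in>UNIV. d j)) * choice_sum (bl i) s (A i) e f"
      by (simp add: choice_sum_def split_def)
  qed
  also have "\<dots> = of_nat ((r - s) * (\<Sum>j\<in>UNIV. d j)) * (\<Sum>i\<in>M. choice_sum (bl i) s (A i) e f)"
    by (simp only: sum_distrib_left)
  finally have "of_nat ((r - s) * (\<Sum>j\<in>UNIV. d j)) * (\<Sum>i\<in>M. choice_sum (bl i) s (A i) e f) = 0" .
  moreover have "of_nat ((r - s) * (\<Sum>j\<in>UNIV. d j)) \<noteq> (0::'k)"
  proof -
    have "(\<Sum>j\<in>UNIV. d j) > 0" using d_pos by (intro sum_pos) auto
    then have "(r - s) * (\<Sum>j\<in>UNIV. d j) \<noteq> 0" using s by (simp del: sum_eq_0_iff)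
    then show ?thesis unfolding of_nat_eq_0_iff .
  qed
  ultimately show ?thesis using mult_eq_0_iff by blast
qed

lemma choice_sum_lower_all:
  assumes M: "finite M" "\<And>i. i \<in> M \<Longrightarrow> A i \<in> ten" "\<And>i. i \<in> M \<Longrightarrow> valid_blocks (bl i)"
    and zero: "\<And>e f. e \<in> duals \<Longrightarrow> f \<in> duals \<Longrightarrow> (\<Sum>i\<in>M. choice_sum (bl i) r (A i) e f) = 0"
    and s: "s \<le> r"
  shows "e \<in> duals \<Longrightarrow> f \<in> duals \<Longrightarrow> (\<Sum>i\<in>M. choice_sum (bl i) s (A i) e f) = 0"
  using s
proof (induction arbitrary: e f rule: inc_induct)
  case base
  then show ?case using zero by simp
next
  case (step m)
  show ?case
  proof (rule choice_sum_lower[where A = A and bl = bl])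
    show "m < r" by (rule step.hyps)
  qed (use M step.IH step.prems in auto)
qed

section \<open>Column antisymmetry\<close>

text \<open>Says that \<open>(r * d j - a j, a j)\<close> is a partition for every \<open>j\<close>,
  possibly with second part zero.\<close>

definition shape :: "('n \<Rightarrow> nat) \<Rightarrow> bool" where
  "shape a \<longleftrightarrow> (\<forall>j. 2 * a j \<le> r * d j)"

text \<open>A column of length two is represented by its top box, and \<open>bot\<close> leads to
  the box below. As in the filling of diagrams row by row, the first row occupies the positions
  below \<open>r * d j - a j\<close> and the second row the rest.\<close>

definition columns :: "('n \<Rightarrow> nat) \<Rightarrow> ('n \<times> nat) set" where
  "columns a = (SIGMA j:UNIV. {..<a j})"

definition bot :: "('n \<Rightarrow> nat) \<Rightarrow> 'n \<times> nat \<Rightarrow> 'n \<times> nat" where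
  "bot a = (\<lambda>(j, i). (j, r * d j - a j + i))"

definition bottom_row :: "('n \<Rightarrow> nat) \<Rightarrow> ('n \<times> nat) set" where
  "bottom_row a = bot a ` columns a"

text \<open>Exchanges the two boxes of every column in \<open>T\<close>. These maps form the column
  group of all factors together, an elementary abelian 2-group whose product is the symmetric
  difference of the sets \<open>T\<close>.\<close>

definition swap_columns :: "('n \<Rightarrow> nat) \<Rightarrow> ('n \<times> nat) set \<Rightarrow> 'n \<times> nat \<Rightarrow> 'n \<times> nat" where
  "swap_columns a T = (\<lambda>(j, i). if (j, i) \<in> T then (j, r * d j - a j + i)
     else if r * d j - a j \<le> i \<and> (j, i - (r * d j - a j)) \<in> T then (j, i - (r * d j - a j)) else (j, i))"

text \<open>The sets with exactly one box from every column of length two, encoded by the set of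
  columns that contribute their top box.\<close>

definition flip :: "('n \<Rightarrow> nat) \<Rightarrow> ('n \<times> nat) set \<Rightarrow> ('n \<times> nat) set" where
  "flip a T = T \<union> bot a ` (columns a - T)"

lemma mem_columns [simp]: "(j, i) \<in> columns a \<longleftrightarrow> i < a j"
  by (simp add: columns_def)

lemma finite_columns [simp]: "finite (columns a)"
  by (simp add: columns_def)

lemma card_columns: "card (columns a) = (\<Sum>j\<in>UNIV. a j)"
  by (simp add: columns_def)

lemma mem_bottom_row: "shape a \<Longrightarrow> (j, i) \<in> bottom_row a \<longleftrightarrow> r * d j - a j \<le> i \<and> i < r * d j"
proof -
  assume "shape a"
  then have "2 * a j \<le> r * d j" by (simp add: shape_def)
  then show ?thesis
    by (auto simp: bottom_row_def bot_def image_iff intro!: bexI[of _ "(j, i - (r * d j - a j))"])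
qed

lemma inj_bot: "inj (bot a)"
  by (auto simp: inj_def bot_def)

lemma bot_notin_columns: "shape a \<Longrightarrow> bot a x \<notin> columns a"
proof (cases x)
  case (Pair j i)
  assume "shape a"
  then have "2 * a j \<le> r * d j" by (simp add: shape_def)
  then show ?thesis by (simp add: bot_def Pair)
qed

lemma columns_subset: "shape a \<Longrightarrow> columns a \<subseteq> Pos"
proof
  fix x assume "shape a" "x \<in> columns a"
  moreover obtain j i where "x = (j, i)" by (cases x)
  moreover have "2 * a j \<le> r * d j" using \<open>shape a\<close> by (simp add: shape_def)
  ultimately show "x \<in> Pos" by simp
qed

lemma bottom_row_subset: "shape a \<Longrightarrow> bottom_row a \<subseteq> Pos"
  by (auto simp: mem_bottom_row)

lemma flip_subset: "shape a \<Longrightarrow> T \<subseteq> columns a \<Longrightarrow> flip a T \<subseteq> Pos"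
proof -
  assume "shape a" "T \<subseteq> columns a"
  moreover have "flip a T \<subseteq> T \<union> bottom_row a" by (auto simp: flip_def bottom_row_def)
  ultimately show ?thesis using columns_subset bottom_row_subset by blast
qed

lemma flip_empty: "flip a {} = bottom_row a"
  by (simp add: flip_def bottom_row_def)

lemma card_flip:
  assumes "shape a" "T \<subseteq> columns a"
  shows "card (flip a T) = card (columns a)"
proof -
  have "finite T" using assms(2) finite_columns finite_subset by blast
  have "card (flip a T) = card T + card (bot a ` (columns a - T))"
    unfolding flip_def using assms bot_notin_columns \<open>finite T\<close> by (intro card_Un_disjoint) auto
  also have "card (bot a ` (columns a - T)) = card (columns a - T)"
    by (intro card_image) (use inj_bot in \<open>auto simp: inj_def inj_on_def\<close>)
  also have "\<dots> = card (columns a) - card T"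
    using assms(2) \<open>finite T\<close> by (simp add: card_Diff_subset)
  finally show ?thesis using card_mono[OF finite_columns assms(2)] by simp
qed

lemma swap_columns_fst: "fst (swap_columns a T p) = fst p"
  by (cases p) (simp add: swap_columns_def)

lemma swap_columns_empty: "swap_columns a {} = id"
  by (auto simp: swap_columns_def fun_eq_iff)

lemma swap_columns_top:
  assumes "shape a" "T \<subseteq> columns a" "i < a j"
  shows "swap_columns a T (j, i) = (if (j, i) \<in> T then (j, r * d j - a j + i) else (j, i))"
proof -
  have "2 * a j \<le> r * d j" using assms(1) by (simp add: shape_def)
  then have "\<not> r * d j - a j \<le> i" using assms(3) by linarith
  then show ?thesis by (simp add: swap_columns_def)
qed

lemma swap_columns_bottom:
  assumes "shape a" "T \<subseteq> columns a"
  shows "swap_columns a T (j, r * d j - a j + k) = (if (j, k) \<in> T then (j, k) else (j, r * d j - a j + k))"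
proof -
  have "2 * a j \<le> r * d j" using assms(1) by (simp add: shape_def)
  then have "\<not> r * d j - a j + k < a j" by simp
  then have "(j, r * d j - a j + k) \<notin> T" using assms(2) by auto
  then show ?thesis by (simp add: swap_columns_def)
qed

lemma swap_columns_middle:
  assumes "T \<subseteq> columns a" "a j \<le> i" "i < r * d j - a j"
  shows "swap_columns a T (j, i) = (j, i)"
proof -
  have "(j, i) \<notin> T" using assms(1,2) by auto
  then show ?thesis using assms(3) by (simp add: swap_columns_def)
qed

lemma position_cases:
  obtains (top) "i < a j" | (middle) "a j \<le> i" "i < r * d j - a j" | (bottom) k where "i = r * d j - a j + k"
  by (metis le_add_diff_inverse not_less)

lemma swap_columns_comp:
  assumes a: "shape a" and T: "T \<subseteq> columns a" "T' \<subseteq> columns a"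
  shows "swap_columns a T \<circ> swap_columns a T' = swap_columns a ((T - T') \<union> (T' - T))"
proof
  fix x :: "'n \<times> nat"
  obtain j i where x: "x = (j, i)" by (cases x)
  have T'': "(T - T') \<union> (T' - T) \<subseteq> columns a" using T by blast
  show "(swap_columns a T \<circ> swap_columns a T') x = swap_columns a ((T - T') \<union> (T' - T)) x"
  proof (cases rule: position_cases[of i a j])
    case top
    then show ?thesis
      by (simp add: x swap_columns_top[OF a T(1)] swap_columns_top[OF a T(2)] swap_columns_top[OF a T'']
        swap_columns_bottom[OF a T(1)])
  next
    case middle
    then show ?thesis by (simp add: x swap_columns_middle[OF T(1)] swap_columns_middle[OF T(2)] swap_columns_middle[OF T''])
  next
    case (bottom k)
    have k: "k < a j" if "(j, k) \<in> T \<or> (j, k) \<in> T'" using that T by auto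
    show ?thesis
      using k by (simp add: x bottom swap_columns_bottom[OF a T(1)] swap_columns_bottom[OF a T(2)]
        swap_columns_bottom[OF a T''] swap_columns_top[OF a T(1)])
  qed
qed

lemma swap_columns_involution:
  assumes "shape a" "T \<subseteq> columns a"
  shows "swap_columns a T \<circ> swap_columns a T = id"
  using swap_columns_comp[OF assms(1) assms(2) assms(2)] by (simp add: swap_columns_empty)

lemma swap_columns_perms:
  assumes "shape a" "T \<subseteq> columns a"
  shows "swap_columns a T \<in> perms"
proof -
  have inv: "swap_columns a T (swap_columns a T x) = x" for x
    using swap_columns_involution[OF assms] by (metis comp_apply id_apply)
  have outside: "swap_columns a T x = x" if "x \<notin> Pos" for x
  proof -
    obtain j i where x: "x = (j, i)" by (cases x)
    have *: "2 * a j \<le> r * d j" using assms(1) by (simp add: shape_def)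
    then have "r * d j - a j \<le> i" "\<not> i - (r * d j - a j) < a j" using that by (auto simp: x)
    then obtain k where "i = r * d j - a j + k" "(j, k) \<notin> T"
      using assms(2) by (metis diff_add_inverse le_add_diff_inverse mem_columns subsetD)
    then show ?thesis by (simp add: x swap_columns_bottom[OF assms])
  qed
  have "bij (swap_columns a T)" using inv by (intro o_bij[of "swap_columns a T"]) auto
  then have "swap_columns a T permutes Pos"
    using outside by (simp add: permutes_def bij_iff)
  then show ?thesis by (simp add: perms_def swap_columns_fst del: split_paired_All)
qed

lemma swap_columns_vimage:
  assumes "shape a" "T \<subseteq> columns a"
  shows "swap_columns a T -` bottom_row a = flip a T"
proof (rule set_eqI)
  fix x :: "'n \<times> nat"
  obtain j i where x: "x = (j, i)" by (cases x)
  have a: "2 * a j \<le> r * d j" using assms(1) by (simp add: shape_def)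
  have T: "i < a j" if "(j, i) \<in> T" for i using that assms(2) by auto
  have bot: "(j, r * d j - a j + k) \<in> bot a ` (columns a - T) \<longleftrightarrow> k < a j \<and> (j, k) \<notin> T" for k
    by (force simp: bot_def image_iff)
  have not_bot: "(j, i) \<notin> bot a ` (columns a - T)" if "i < r * d j - a j" for i
    using that by (auto simp: bot_def)
  show "x \<in> swap_columns a T -` bottom_row a \<longleftrightarrow> x \<in> flip a T"
  proof (cases rule: position_cases[of i a j])
    case top
    then have "i < r * d j - a j" using a by linarith
    then show ?thesis
      using top a not_bot[of i] by (auto simp: x swap_columns_top[OF assms] mem_bottom_row[OF assms(1)] flip_def)
  next
    case middle
    then show ?thesis
      using not_bot[of i] T[of i] by (auto simp: x swap_columns_middle assms(2) mem_bottom_row[OF assms(1)] flip_def)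
  next
    case (bottom k)
    have 1: "(j, r * d j - a j + k) \<notin> T" using a T by fastforce
    have 2: "(j, r * d j - a j + k) \<in> bottom_row a \<longleftrightarrow> k < a j"
      using mem_bottom_row[OF assms(1)] a by auto
    have 3: "k < a j \<Longrightarrow> (j, k) \<notin> bottom_row a"
      using mem_bottom_row[OF assms(1)] a by auto
    show ?thesis
      unfolding x bottom vimage_eq flip_def Un_iff bot swap_columns_bottom[OF assms, of j k]
      using 1 2 3 T[of k] by metis
  qed
qed

lemma sign_symdiff:
  assumes "finite T" "finite T'"
  shows "(- 1) ^ card ((T - T') \<union> (T' - T)) = ((- 1) ^ card T * (- 1) ^ card T' :: 'a::comm_ring_1)"
proof -
  have 1: "card ((T - T') \<union> (T' - T)) = card (T - T') + card (T' - T)"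
    using assms by (intro card_Un_disjoint) auto
  have 2: "card T = card (T - T') + card (T \<inter> T')"
    using assms by (subst card_Un_disjoint[symmetric]) (auto intro!: arg_cong[of _ _ card])
  have 3: "card T' = card (T' - T) + card (T \<inter> T')"
    using assms by (subst card_Un_disjoint[symmetric]) (auto intro!: arg_cong[of _ _ card])
  have "(- 1) ^ m * (- 1) ^ m = (1::'a)" for m :: nat
    by (simp flip: power_mult_distrib)
  then have "(- 1) ^ (x + m) * (- 1) ^ (y + m) = ((- 1) ^ (x + y) :: 'a)" for x y m
    by (simp add: power_add algebra_simps)
  then show ?thesis by (simp only: 1 2 3)
qed

lemma sum_Pow_symdiff:
  assumes "T0 \<subseteq> B"
  shows "(\<Sum>T\<in>Pow B. F ((T0 - T) \<union> (T - T0))) = (\<Sum>T\<in>Pow B. F T)"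
  by (rule sum.reindex_bij_witness[of _ "\<lambda>T. (T0 - T) \<union> (T - T0)" "\<lambda>T. (T0 - T) \<union> (T - T0)"])
    (use assms in auto)

section \<open>Schur spaces and their choice sums\<close>

text \<open>The Young symmetrizer of all factors at once. The column group is parametrized by
  subsets of the columns with sign \<open>(- 1) ^ card T\<close>; the row group is the stabilizer of
  the second rows.\<close>

definition symmetrize :: "('n \<Rightarrow> nat) \<Rightarrow> (('n \<Rightarrow> ('v \<Rightarrow> 'k) list) \<Rightarrow> 'k) \<Rightarrow> ('n \<Rightarrow> ('v \<Rightarrow> 'k) list) \<Rightarrow> 'k" where
  "symmetrize a B = (\<Sum>T\<in>Pow (columns a). \<Sum>\<sigma>\<in>stabilizer (bottom_row a).
     fscale ((- 1) ^ card T) (move (swap_columns a T \<circ> \<sigma>) B))"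

lemma stabilizer_perms: "\<sigma> \<in> stabilizer X \<Longrightarrow> \<sigma> \<in> perms"
  by (simp add: stabilizer_def)

lemma symmetrize_ten: "shape a \<Longrightarrow> B \<in> ten \<Longrightarrow> symmetrize a B \<in> ten"
  unfolding symmetrize_def
  by (intro ten_sum ten_scale move_ten perms_comp swap_columns_perms stabilizer_perms) auto

lemma ev_symmetrize:
  assumes "shape a" "\<phi> \<in> covectors"
  shows "ev (symmetrize a B) \<phi> = (\<Sum>T\<in>Pow (columns a). \<Sum>\<sigma>\<in>stabilizer (bottom_row a).
     (- 1) ^ card T * ev B (\<phi> \<circ> swap_columns a T \<circ> \<sigma>))"
proof -
  have "ev (move (swap_columns a T \<circ> \<sigma>) B) \<phi> = ev B (\<phi> \<circ> swap_columns a T \<circ> \<sigma>)"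
    if "T \<in> Pow (columns a)" "\<sigma> \<in> stabilizer (bottom_row a)" for T \<sigma>
    using that assms by (simp add: ev_move perms_comp swap_columns_perms stabilizer_perms o_assoc)
  then show ?thesis by (simp add: symmetrize_def)
qed

definition schur_space :: "('n \<Rightarrow> nat) \<Rightarrow> (('n \<Rightarrow> ('v \<Rightarrow> 'k) list) \<Rightarrow> 'k) set" where
  "schur_space a = symmetrize a ` ten"

lemma schur_space_ten: "shape a \<Longrightarrow> A \<in> schur_space a \<Longrightarrow> A \<in> ten"
  by (auto simp: schur_space_def symmetrize_ten)

text \<open>In \<open>ev_symmetrize\<close> the column swaps stand next to \<open>\<phi>\<close>, so
  another swap only reindexes the sum over \<open>T\<close> by a symmetric difference.\<close>

lemma schur_space_antisym:
  assumes a: "shape a" and A: "A \<in> schur_space a" and \<phi>: "\<phi> \<in> covectors" and T0: "T0 \<subseteq> columns a"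
  shows "ev A (\<phi> \<circ> swap_columns a T0) = (- 1) ^ card T0 * ev A \<phi>"
proof -
  obtain B where B: "A = symmetrize a B" using A by (auto simp: schur_space_def)
  define F where "F T = (\<Sum>\<sigma>\<in>stabilizer (bottom_row a).
     (- 1) ^ card T * ev B (\<phi> \<circ> swap_columns a T \<circ> \<sigma>))" for T
  have fT: "finite T" if "T \<subseteq> columns a" for T using that finite_columns finite_subset by blast
  have "ev A (\<phi> \<circ> swap_columns a T0) = (\<Sum>T\<in>Pow (columns a). \<Sum>\<sigma>\<in>stabilizer (bottom_row a).
     (- 1) ^ card T * ev B (\<phi> \<circ> swap_columns a T0 \<circ> swap_columns a T \<circ> \<sigma>))"
    using a T0 \<phi> by (simp add: B ev_symmetrize covectors_perm swap_columns_perms)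
  also have "\<dots> = (\<Sum>T\<in>Pow (columns a). (- 1) ^ card T0 * F ((T0 - T) \<union> (T - T0)))"
  proof (rule sum.cong[OF refl])
    fix T assume "T \<in> Pow (columns a)"
    then have T: "T \<subseteq> columns a" by simp
    have "(- 1) ^ card T = (- 1) ^ card T0 * ((- 1) ^ card ((T0 - T) \<union> (T - T0)) :: 'k)"
      using fT T0 T by (subst sign_symdiff) (auto simp: mult.assoc[symmetric] simp flip: power_mult_distrib)
    moreover have "\<phi> \<circ> swap_columns a T0 \<circ> swap_columns a T = \<phi> \<circ> swap_columns a ((T0 - T) \<union> (T - T0))"
      using swap_columns_comp[OF a T0 T] by (simp add: o_assoc[symmetric])
    ultimately show "(\<Sum>\<sigma>\<in>stabilizer (bottom_row a).
       (- 1) ^ card T * ev B (\<phi> \<circ> swap_columns a T0 \<circ> swap_columns a T \<circ> \<sigma>)) =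
       (- 1) ^ card T0 * F ((T0 - T) \<union> (T - T0))"
      by (simp add: F_def sum_distrib_left mult.assoc)
  qed
  also have "\<dots> = (- 1) ^ card T0 * (\<Sum>T\<in>Pow (columns a). F T)"
    using sum_Pow_symdiff[OF T0, of F] by (simp add: sum_distrib_left[symmetric])
  also have "(\<Sum>T\<in>Pow (columns a). F T) = ev A \<phi>"
    using a \<phi> by (simp add: B ev_symmetrize F_def)
  finally show ?thesis .
qed

lemma ev_flip:
  assumes a: "shape a" and A: "A \<in> schur_space a" and ef: "e \<in> duals" "f \<in> duals" and T: "T \<subseteq> columns a"
  shows "ev A (pattern e f (flip a T)) = (- 1) ^ card T * ev A (pattern e f (bottom_row a))"
  using schur_space_antisym[OF a A pattern_covectors[OF ef] T, of "bottom_row a"]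
  by (simp add: pattern_perm swap_columns_perms[OF a T] swap_columns_vimage[OF a T])

text \<open>Swapping the column \<open>x\<close> leaves the pattern unchanged but reverses the sign
  of the value, so the value equals its negative.\<close>

lemma ev_pattern_eq_0:
  assumes a: "shape a" and A: "A \<in> schur_space a" and ef: "e \<in> duals" "f \<in> duals"
    and x: "x \<in> columns a" "x \<in> S \<longleftrightarrow> bot a x \<in> S"
  shows "ev A (pattern e f S) = 0"
proof -
  have T: "{x} \<subseteq> columns a" using x by simp
  have "y \<in> swap_columns a {x} -` S \<longleftrightarrow> y \<in> S" for y
    using x by (cases x; cases y) (auto simp: swap_columns_def bot_def)
  then have "swap_columns a {x} -` S = S" by blast
  then have "ev A (pattern e f S) = - ev A (pattern e f S)"
    using schur_space_antisym[OF a A pattern_covectors[OF ef] T, of S]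
    by (simp add: pattern_perm swap_columns_perms[OF a T])
  then have "ev A (pattern e f S) + ev A (pattern e f S) = ev A (pattern e f S) + - ev A (pattern e f S)"
    by (rule arg_cong)
  then have "2 * ev A (pattern e f S) = 0" by (simp only: mult_2 right_minus)
  then show ?thesis by simp
qed

text \<open>A nonzero value requires exactly one box of every column in \<open>S\<close>, and the
  bound on \<open>card S\<close> then leaves no room for further boxes.\<close>

lemma ev_pattern_not_flip:
  assumes a: "shape a" and A: "A \<in> schur_space a" and ef: "e \<in> duals" "f \<in> duals"
    and S: "S \<subseteq> Pos" "card S \<le> card (columns a)" and nz: "ev A (pattern e f S) \<noteq> 0"
  shows "\<exists>T\<subseteq>columns a. S = flip a T"
proof -
  have *: "x \<in> S \<longleftrightarrow> bot a x \<notin> S" if "x \<in> columns a" for x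
    using ev_pattern_eq_0[OF a A ef that, of S] nz by blast
  let ?T = "S \<inter> columns a"
  have "flip a ?T \<subseteq> S" using * by (auto simp: flip_def)
  moreover have "finite S" using S(1) finite_Pos finite_subset by blast
  ultimately have "flip a ?T = S"
    using card_flip[OF a, of ?T] S(2) card_mono[of S "flip a ?T"] by (intro card_subset_eq) auto
  then show ?thesis by blast
qed

lemma choice_sum_schur_less:
  assumes "shape a" "A \<in> schur_space a" "e \<in> duals" "f \<in> duals" "s < card (columns a)"
  shows "choice_sum bl s A e f = 0"
  unfolding choice_sum_def
proof (rule sum.neutral, rule ballI)
  fix S assume S: "S \<in> {S \<in> choices bl. card S = s}"
  show "ev A (pattern e f S) = 0"
  proof (rule ccontr)
    assume "ev A (pattern e f S) \<noteq> 0"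
    then obtain T where "T \<subseteq> columns a" "S = flip a T"
      using ev_pattern_not_flip[OF assms(1-4), of S] S assms(5) by (auto simp: choices_def)
    then show False using card_flip[OF assms(1)] S assms(5) by auto
  qed
qed

text \<open>The signed number of ways to take one box from every column such that no two lie in one
  block. The choice sum of size \<open>card (columns a)\<close> of a Schur tensor depends on the
  blocks only through this number.\<close>

definition leading_coeff :: "('n \<times> nat \<Rightarrow> nat) \<Rightarrow> ('n \<Rightarrow> nat) \<Rightarrow> 'k" where
  "leading_coeff bl a = (\<Sum>T\<in>{T. T \<subseteq> columns a \<and> inj_on bl (flip a T)}. (- 1) ^ card T)"

lemma inj_flip:
  assumes a: "shape a" shows "inj_on (flip a) (Pow (columns a))"
proof (rule inj_on_inverseI[where g = "\<lambda>S. S \<inter> columns a"])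
  fix T assume "T \<in> Pow (columns a)"
  then show "flip a T \<inter> columns a = T" using bot_notin_columns[OF a] by (auto simp: flip_def)
qed

lemma choice_sum_schur:
  assumes a: "shape a" and A: "A \<in> schur_space a" and ef: "e \<in> duals" "f \<in> duals"
  shows "choice_sum bl (card (columns a)) A e f = leading_coeff bl a * ev A (pattern e f (bottom_row a))"
proof -
  let ?C = "{T. T \<subseteq> columns a \<and> inj_on bl (flip a T)}"
  have "choice_sum bl (card (columns a)) A e f = (\<Sum>S\<in>flip a ` ?C. ev A (pattern e f S))"
    unfolding choice_sum_def
  proof (rule sum.mono_neutral_right)
    show "flip a ` ?C \<subseteq> {S \<in> choices bl. card S = card (columns a)}"
      using flip_subset[OF a] card_flip[OF a] by (auto simp: choices_def)
    show "\<forall>S\<in>{S \<in> choices bl. card S = card (columns a)} - flip a ` ?C. ev A (pattern e f S) = 0"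
    proof
      fix S assume S: "S \<in> {S \<in> choices bl. card S = card (columns a)} - flip a ` ?C"
      show "ev A (pattern e f S) = 0"
      proof (rule ccontr)
        assume "ev A (pattern e f S) \<noteq> 0"
        then obtain T where "T \<subseteq> columns a" "S = flip a T"
          using ev_pattern_not_flip[OF assms, of S] S by (auto simp: choices_def)
        then show False using S by (auto simp: choices_def)
      qed
    qed
  qed simp
  also have "\<dots> = (\<Sum>T\<in>?C. ev A (pattern e f (flip a T)))"
    by (subst sum.reindex) (auto intro: inj_on_subset[OF inj_flip[OF a]])
  also have "\<dots> = (\<Sum>T\<in>?C. (- 1) ^ card T * ev A (pattern e f (bottom_row a)))"
    by (rule sum.cong) (auto simp: ev_flip[OF assms])
  finally show ?thesis by (simp add: leading_coeff_def sum_distrib_right)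
qed

section \<open>Recovering a Schur tensor from its values on \<open>e\<close> and
  \<open>f\<close>\<close>

lemma stabilizer_inv:
  assumes "\<sigma> \<in> stabilizer X"
  shows "inv \<sigma> \<in> stabilizer X"
proof -
  have p: "\<sigma> \<in> perms" using assms by (rule stabilizer_perms)
  have "\<sigma> (inv \<sigma> p) = p" for p using perms_inv_comp(1)[OF p] by (metis comp_apply id_apply)
  then have "inv \<sigma> p \<in> X \<longleftrightarrow> p \<in> X" for p
    using assms by (simp add: stabilizer_def del: split_paired_All) metis
  then show ?thesis using perms_inv[OF p] by (simp add: stabilizer_def)
qed

lemma stabilizer_inv_inv: "\<sigma> \<in> stabilizer X \<Longrightarrow> inv (inv \<sigma>) = \<sigma>"
  by (auto simp: stabilizer_def perms_def intro: inv_inv_eq permutes_bij)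

lemma sum_stabilizer_inv: "(\<Sum>\<sigma>\<in>stabilizer X. F (inv \<sigma>)) = (\<Sum>\<sigma>\<in>stabilizer X. F \<sigma>)"
  by (rule sum.reindex_bij_witness[of _ inv inv])
    (auto intro: stabilizer_inv simp: stabilizer_inv_inv)

text \<open>
  Row symmetrization and column antisymmetrization are self-adjoint for the inner product that makes
  the permutations orthonormal, so \<open>\<langle>H, H\<rangle>\<close> vanishes. Positivity needs an ordered field; it carries over
  to \<open>K\<close> because the \<open>\<rat>\<close>-linear functionals on \<open>K\<close> separate points.
\<close>

lemma antisymmetrize_eq_0_rat:
  fixes \<beta> :: "('n \<times> nat \<Rightarrow> 'n \<times> nat) \<Rightarrow> rat"
  assumes a: "shape a"
  defines "G \<equiv> \<lambda>\<pi>. \<Sum>\<sigma>\<in>stabilizer (bottom_row a). \<beta> (\<pi> \<circ> \<sigma>)"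
  defines "H \<equiv> \<lambda>\<pi>. \<Sum>T\<in>Pow (columns a). (- 1) ^ card T * G (\<pi> \<circ> swap_columns a T)"
  assumes zero: "\<And>\<pi>. \<pi> \<in> perms \<Longrightarrow> (\<Sum>\<sigma>\<in>stabilizer (bottom_row a). H (\<pi> \<circ> \<sigma>)) = 0"
    and \<pi>: "\<pi> \<in> perms"
  shows "H \<pi> = 0"
proof -
  let ?St = "stabilizer (bottom_row a)"
  have fT: "finite T" if "T \<subseteq> columns a" for T using that finite_columns finite_subset by blast
  have H_swap: "H (\<pi> \<circ> swap_columns a T0) = (- 1) ^ card T0 * H \<pi>" if T0: "T0 \<subseteq> columns a" for T0 \<pi>
  proof -
    have "H (\<pi> \<circ> swap_columns a T0) = (\<Sum>T\<in>Pow (columns a). (- 1) ^ card T0 *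
      ((- 1) ^ card ((T0 - T) \<union> (T - T0)) * G (\<pi> \<circ> swap_columns a ((T0 - T) \<union> (T - T0)))))"
      unfolding H_def
    proof (rule sum.cong[OF refl])
      fix T assume "T \<in> Pow (columns a)"
      then have T: "T \<subseteq> columns a" by simp
      have "(- 1) ^ card T = (- 1) ^ card T0 * ((- 1) ^ card ((T0 - T) \<union> (T - T0)) :: rat)"
        using fT T0 T by (subst sign_symdiff) (auto simp: mult.assoc[symmetric] simp flip: power_mult_distrib)
      moreover have "\<pi> \<circ> swap_columns a T0 \<circ> swap_columns a T = \<pi> \<circ> swap_columns a ((T0 - T) \<union> (T - T0))"
        using swap_columns_comp[OF a T0 T] by (simp add: o_assoc[symmetric])
      ultimately show "(- 1) ^ card T * G (\<pi> \<circ> swap_columns a T0 \<circ> swap_columns a T) = (- 1) ^ card T0 *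
        ((- 1) ^ card ((T0 - T) \<union> (T - T0)) * G (\<pi> \<circ> swap_columns a ((T0 - T) \<union> (T - T0))))"
        by (simp add: mult.assoc)
    qed
    also have "\<dots> = (- 1) ^ card T0 * (\<Sum>T\<in>Pow (columns a). (- 1) ^ card T * G (\<pi> \<circ> swap_columns a T))"
      using sum_Pow_symdiff[OF T0, of "\<lambda>T. (- 1) ^ card T * G (\<pi> \<circ> swap_columns a T)"]
      by (simp add: sum_distrib_left[symmetric])
    finally show ?thesis by (simp add: H_def)
  qed
  \<comment> \<open>Moving the row sum to the other argument of the inner product turns
    \<open>\<beta>\<close> into its row symmetrization, so \<open>G\<close> is orthogonal to
    \<open>H\<close>.\<close>
  have "0 = (\<Sum>\<pi>\<in>perms. \<beta> \<pi> * (\<Sum>\<sigma>\<in>?St. H (\<pi> \<circ> \<sigma>)))" using zero by simp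
  also have "\<dots> = (\<Sum>\<sigma>\<in>?St. \<Sum>\<pi>\<in>perms. \<beta> \<pi> * H (\<pi> \<circ> \<sigma>))"
    by (simp add: sum_distrib_left sum.swap[of _ perms])
  also have "\<dots> = (\<Sum>\<sigma>\<in>?St. \<Sum>\<pi>\<in>perms. \<beta> (\<pi> \<circ> inv \<sigma>) * H \<pi>)"
  proof (rule sum.cong[OF refl])
    fix \<sigma> assume "\<sigma> \<in> ?St"
    then have \<sigma>: "\<sigma> \<in> perms" by (rule stabilizer_perms)
    show "(\<Sum>\<pi>\<in>perms. \<beta> \<pi> * H (\<pi> \<circ> \<sigma>)) = (\<Sum>\<pi>\<in>perms. \<beta> (\<pi> \<circ> inv \<sigma>) * H \<pi>)"
      using sum_perms_right[OF perms_inv[OF \<sigma>], of "\<lambda>\<pi>. \<beta> \<pi> * H (\<pi> \<circ> \<sigma>)"]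
      by (simp add: o_assoc[symmetric] perms_inv_comp[OF \<sigma>])
  qed
  also have "\<dots> = (\<Sum>\<pi>\<in>perms. (\<Sum>\<sigma>\<in>?St. \<beta> (\<pi> \<circ> inv \<sigma>)) * H \<pi>)"
    by (subst sum.swap) (simp add: sum_distrib_right)
  also have "\<dots> = (\<Sum>\<pi>\<in>perms. G \<pi> * H \<pi>)"
    using sum_stabilizer_inv[of "\<lambda>\<sigma>. \<beta> (_ \<circ> \<sigma>)" "bottom_row a"] by (simp add: G_def)
  finally have GH: "(\<Sum>\<pi>\<in>perms. G \<pi> * H \<pi>) = 0" by simp
  \<comment> \<open>Now the column sum is moved across. By \<open>H_swap\<close> every
    \<open>T\<close> contributes the same amount, so the sum of squares is
    \<open>card (Pow (columns a))\<close> times the inner product of \<open>G\<close> and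
    \<open>H\<close>.\<close>
  have "(\<Sum>\<pi>\<in>perms. H \<pi> * H \<pi>) =
    (\<Sum>T\<in>Pow (columns a). \<Sum>\<pi>\<in>perms. (- 1) ^ card T * (G (\<pi> \<circ> swap_columns a T) * H \<pi>))"
    by (subst (1) H_def) (simp add: sum_distrib_right sum.swap[of _ perms] mult.assoc)
  also have "\<dots> = (\<Sum>T\<in>Pow (columns a). \<Sum>\<pi>\<in>perms. (- 1) ^ card T * (G \<pi> * H (\<pi> \<circ> swap_columns a T)))"
  proof (rule sum.cong[OF refl])
    fix T assume "T \<in> Pow (columns a)"
    then have T: "T \<subseteq> columns a" by simp
    show "(\<Sum>\<pi>\<in>perms. (- 1) ^ card T * (G (\<pi> \<circ> swap_columns a T) * H \<pi>)) =
      (\<Sum>\<pi>\<in>perms. (- 1) ^ card T * (G \<pi> * H (\<pi> \<circ> swap_columns a T)))"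
      using sum_perms_right[OF swap_columns_perms[OF a T], of "\<lambda>\<pi>. (- 1) ^ card T * (G (\<pi> \<circ> swap_columns a T) * H \<pi>)"]
      by (simp add: o_assoc[symmetric] swap_columns_involution[OF a T])
  qed
  also have "\<dots> = (\<Sum>T\<in>Pow (columns a). \<Sum>\<pi>\<in>perms. G \<pi> * H \<pi>)"
    by (intro sum.cong refl) (auto simp: H_swap simp flip: power_mult_distrib)
  also have "\<dots> = 0" using GH by simp
  finally have "(\<Sum>\<pi>\<in>perms. H \<pi> * H \<pi>) = 0" .
  then have "H \<pi> * H \<pi> = 0"
    using \<pi> by (subst (asm) sum_nonneg_eq_0_iff) auto
  then show ?thesis by simp
qed

text \<open>The hypothesis polarizes to the vanishing of all row sums of
  \<open>H \<pi> = ev A (\<phi> \<circ> \<pi>)\<close>. Since \<open>H\<close> is itself the column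
  antisymmetrization of a row symmetrization, it vanishes; a rational functional that is nonzero on
  \<open>H id\<close> would otherwise give a rational counterexample.\<close>

lemma schur_space_inject:
  assumes a: "shape a" and A: "A \<in> schur_space a"
    and zero: "\<And>e f. e \<in> duals \<Longrightarrow> f \<in> duals \<Longrightarrow> ev A (pattern e f (bottom_row a)) = 0"
  shows "A = 0"
proof (rule ten_ext)
  show "A x = 0" if "x \<notin> tuples" for x using ten_off schur_space_ten[OF a A] that by blast
  fix \<phi> assume \<phi>: "\<phi> \<in> covectors"
  obtain B where B: "A = symmetrize a B" "B \<in> ten" using A by (auto simp: schur_space_def)
  define \<beta> where "\<beta> \<pi> = ev B (\<phi> \<circ> \<pi>)" for \<pi>
  define H where "H \<pi> = (\<Sum>T\<in>Pow (columns a). (- 1) ^ card T *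
    (\<Sum>\<sigma>\<in>stabilizer (bottom_row a). \<beta> (\<pi> \<circ> swap_columns a T \<circ> \<sigma>)))" for \<pi>
  have H: "H \<pi> = ev A (\<phi> \<circ> \<pi>)" if "\<pi> \<in> perms" for \<pi>
    using that \<phi> a by (simp add: B H_def \<beta>_def ev_symmetrize covectors_perm o_assoc sum_distrib_left)
  have zero': "(\<Sum>\<sigma>\<in>stabilizer (bottom_row a). H (\<pi> \<circ> \<sigma>)) = 0" if "\<pi> \<in> perms" for \<pi>
  proof -
    have "(\<Sum>\<sigma>\<in>stabilizer (bottom_row a). H (\<pi> \<circ> \<sigma>)) =
      (\<Sum>\<sigma>\<in>stabilizer (bottom_row a). ev A (\<phi> \<circ> \<pi> \<circ> \<sigma>))"
      by (rule sum.cong[OF refl]) (use that in \<open>simp add: H perms_comp stabilizer_perms o_assoc\<close>)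
    also have "\<dots> = 0"
      by (rule polarization[OF bottom_row_subset[OF a] schur_space_ten[OF a A] zero])
        (use covectors_perm[OF \<phi> that] in auto)
    finally show ?thesis .
  qed
  have "H id = 0"
  proof (rule ccontr)
    assume "H id \<noteq> 0"
    then obtain l :: "'k \<Rightarrow> rat" where l: "\<And>x y. l (x + y) = l x + l y"
      "\<And>q x. l (of_rat q * x) = q * l x" "l (H id) = 1"
      using rational_functional_separates by blast
    have l0: "l 0 = 0" using l(2)[of 0 0] by simp
    have ls: "l (\<Sum>i\<in>I. F i) = (\<Sum>i\<in>I. l (F i))" for F :: "'z \<Rightarrow> 'k" and I
      by (induction I rule: infinite_finite_induct) (auto simp: l l0)
    \<comment> \<open>\<open>l\<close> is linear over the rationals only, which is enough because
      the signs are the only coefficients in \<open>H\<close>.\<close>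
    have lm: "l ((- 1) ^ m * x) = (- 1) ^ m * l x" for m x
      using l(2)[of "(- 1) ^ m" x] by (simp add: of_rat_power)
    let ?H = "\<lambda>\<pi>. \<Sum>T\<in>Pow (columns a). (- 1) ^ card T *
      (\<Sum>\<sigma>\<in>stabilizer (bottom_row a). l (\<beta> (\<pi> \<circ> swap_columns a T \<circ> \<sigma>)))"
    have lH: "l (H \<pi>) = ?H \<pi>" for \<pi> by (simp add: H_def ls lm)
    have "?H id = 0"
    proof (rule antisymmetrize_eq_0_rat[OF a, of "\<lambda>\<pi>. l (\<beta> \<pi>)"])
      fix \<pi> assume \<pi>: "\<pi> \<in> perms"
      have "(\<Sum>\<sigma>\<in>stabilizer (bottom_row a). l (H (\<pi> \<circ> \<sigma>))) = 0"
        using zero'[OF \<pi>] l0 by (simp flip: ls)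
      then show "(\<Sum>\<sigma>\<in>stabilizer (bottom_row a). ?H (\<pi> \<circ> \<sigma>)) = 0" by (simp only: lH)
    qed (rule perms_id)
    then show False using lH[of id] l(3) by simp
  qed
  then show "ev A \<phi> = ev 0 \<phi>" using H[OF perms_id] by simp
qed (simp add: fun_apply)

section \<open>Orbit sums and the exchange relation\<close>

lemma cnt_perm_vimage:
  assumes "\<pi> \<in> perms" "S \<subseteq> Pos"
  shows "cnt (\<pi> -` S) = cnt S"
proof
  fix j
  have "bij \<pi>" using assms(1) by (auto simp: perms_def intro: permutes_bij)
  have "card {p \<in> \<pi> -` S. fst p = j} = card (\<pi> ` {p \<in> \<pi> -` S. fst p = j})"
    by (rule card_image[symmetric]) (use perms_inj[OF assms(1)] in \<open>auto intro: inj_on_subset\<close>)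
  also have "\<pi> ` {p \<in> \<pi> -` S. fst p = j} = {p \<in> S. fst p = j}"
  proof (intro equalityI subsetI)
    fix q assume q: "q \<in> {p \<in> S. fst p = j}"
    obtain p where "q = \<pi> p" using \<open>bij \<pi>\<close> by (metis bij_pointE)
    then show "q \<in> \<pi> ` {p \<in> \<pi> -` S. fst p = j}" using q perms_fst[OF assms(1), of p] by auto
  qed (use perms_fst[OF assms(1)] in auto)
  finally show "cnt (\<pi> -` S) j = cnt S j" by (simp add: cnt_def)
qed

lemma card_perm_vimage: "\<pi> \<in> perms \<Longrightarrow> card (\<pi> -` S) = card S"
  by (rule card_vimage_inj) (auto simp: perms_inj perms_def permutes_surj)

text \<open>Within every factor, the positions in \<open>S\<close> and those outside are matched
  separately with the positions inside and outside \<open>X\<close>; \<open>cl\<close> denotes these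
  classes.\<close>

lemma perm_exists:
  assumes "S \<subseteq> Pos" "X \<subseteq> Pos" "cnt S = cnt X"
  obtains \<pi> where "\<pi> \<in> perms" "\<pi> -` X = S"
proof -
  define cl where "cl Z j c = {p\<in>Pos. fst p = j \<and> (p \<in> Z \<longleftrightarrow> c)}" for Z :: "('n \<times> nat) set" and j c
  have fin: "finite (cl Z j c)" for Z j c by (simp add: cl_def)
  have "card (cl S j c) = card (cl X j c)" for j c
  proof -
    have t: "cl Z j True = {p\<in>Z. fst p = j}" if "Z \<subseteq> Pos" for Z using that by (auto simp: cl_def)
    have "card (cl S j True) = card (cl X j True)"
      using fun_cong[OF assms(3), of j] unfolding cnt_def t[OF assms(1)] t[OF assms(2)] .
    moreover have f: "cl Z j False = {p\<in>Pos. fst p = j} - cl Z j True" for Z by (auto simp: cl_def)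
    have "card (cl Z j False) = card {p\<in>Pos. fst p = j} - card (cl Z j True)" for Z
      unfolding f by (rule card_Diff_subset) (auto simp: cl_def)
    ultimately show ?thesis by (cases c) simp_all
  qed
  then have "\<exists>h. bij_betw h (cl S j c) (cl X j c)" for j c
    using fin by (simp add: finite_same_card_bij)
  then obtain h where h: "\<And>j c. bij_betw (h j c) (cl S j c) (cl X j c)" by metis
  define \<pi> where "\<pi> p = (if p \<in> Pos then h (fst p) (p \<in> S) p else p)" for p
  have m: "\<pi> p \<in> cl X (fst p) (p \<in> S)" if "p \<in> Pos" for p
  proof -
    have "p \<in> cl S (fst p) (p \<in> S)" using that by (simp add: cl_def)
    then show ?thesis using bij_betw_apply[OF h] that by (simp add: \<pi>_def)
  qed
  have 1: "\<pi> p \<in> Pos \<and> fst (\<pi> p) = fst p \<and> (\<pi> p \<in> X \<longleftrightarrow> p \<in> S)" if "p \<in> Pos" for p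
    using m[OF that] by (simp add: cl_def)
  have "inj_on \<pi> Pos"
  proof (rule inj_onI)
    fix p q assume pq: "p \<in> Pos" "q \<in> Pos" "\<pi> p = \<pi> q"
    then have eq: "fst q = fst p" "(q \<in> S) = (p \<in> S)" using 1[of p] 1[of q] by auto
    have "p \<in> cl S (fst p) (p \<in> S)" "q \<in> cl S (fst p) (p \<in> S)" using pq eq by (simp_all add: cl_def)
    moreover have "h (fst p) (p \<in> S) p = h (fst p) (p \<in> S) q" using pq eq by (simp add: \<pi>_def)
    ultimately show "p = q" using bij_betw_imp_inj_on[OF h] by (meson inj_onD)
  qed
  moreover have "\<pi> ` Pos \<subseteq> Pos" using 1 by auto
  ultimately have "bij_betw \<pi> Pos Pos"
    by (simp add: bij_betw_def endo_inj_surj)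
  then have "\<pi> permutes Pos" by (rule bij_imp_permutes) (simp add: \<pi>_def)
  moreover have "fst (\<pi> p) = fst p" for p using 1[of p] by (cases "p \<in> Pos") (auto simp: \<pi>_def)
  ultimately have "\<pi> \<in> perms" by (simp add: perms_def del: split_paired_All)
  moreover have "\<pi> -` X = S"
  proof (rule set_eqI)
    fix p show "p \<in> \<pi> -` X \<longleftrightarrow> p \<in> S"
      using 1[of p] assms(1,2) by (cases "p \<in> Pos") (auto simp: \<pi>_def)
  qed
  ultimately show ?thesis by (rule that)
qed

text \<open>A polarization of the degree component: with \<open>f\<close> on \<open>X\<close> and
  \<open>e\<close> elsewhere it gives a multiple of \<open>degree_part bl (cnt X) A\<close>
  (\<open>ev_orbit_sum_pattern\<close>), but as a tensor it accepts arbitrary covectors.\<close>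

definition orbit_sum :: "('n \<times> nat \<Rightarrow> nat) \<Rightarrow> ('n \<times> nat) set \<Rightarrow> (('n \<Rightarrow> ('v \<Rightarrow> 'k) list) \<Rightarrow> 'k) \<Rightarrow> ('n \<Rightarrow> ('v \<Rightarrow> 'k) list) \<Rightarrow> 'k" where
  "orbit_sum bl X A = (\<Sum>\<pi>\<in>{\<pi>\<in>perms. \<pi> -` X \<in> choices bl}. move \<pi> A)"

lemma orbit_sum_ten: "A \<in> ten \<Longrightarrow> orbit_sum bl X A \<in> ten"
  unfolding orbit_sum_def by (intro ten_sum move_ten) auto

lemma ev_orbit_sum:
  assumes "\<phi> \<in> covectors"
  shows "ev (orbit_sum bl X A) \<phi> = (\<Sum>\<pi>\<in>perms. if \<pi> -` X \<in> choices bl then ev A (\<phi> \<circ> \<pi>) else 0)"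
proof -
  have "ev (orbit_sum bl X A) \<phi> = (\<Sum>\<pi>\<in>{\<pi>\<in>perms. \<pi> -` X \<in> choices bl}. ev A (\<phi> \<circ> \<pi>))"
    unfolding orbit_sum_def by (simp add: ev_move assms)
  then show ?thesis by (simp add: sum.inter_filter)
qed

text \<open>Permuting the arguments amounts to replacing \<open>X\<close> by its image under
  \<open>\<sigma>\<close>, while the argument of \<open>A\<close> runs through the same permutations
  of \<open>\<phi>\<close>.\<close>

lemma ev_orbit_sum_perm:
  assumes "\<phi> \<in> covectors" "\<sigma> \<in> perms"
  shows "ev (orbit_sum bl X A) (\<phi> \<circ> \<sigma>) = (\<Sum>\<rho>\<in>perms. if \<rho> -` (inv \<sigma> -` X) \<in> choices bl then ev A (\<phi> \<circ> \<rho>) else 0)"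
proof -
  have "ev (orbit_sum bl X A) (\<phi> \<circ> \<sigma>) = (\<Sum>\<pi>\<in>perms. if \<pi> -` X \<in> choices bl then ev A (\<phi> \<circ> \<sigma> \<circ> \<pi>) else 0)"
    using assms by (simp add: ev_orbit_sum covectors_perm)
  also have "\<dots> = (\<Sum>\<pi>\<in>perms. if (inv \<sigma> \<circ> (\<sigma> \<circ> \<pi>)) -` X \<in> choices bl then ev A (\<phi> \<circ> (\<sigma> \<circ> \<pi>)) else 0)"
    by (rule sum.cong[OF refl]) (simp add: o_assoc perms_inv_comp[OF assms(2)])
  also have "\<dots> = (\<Sum>\<rho>\<in>perms. if (inv \<sigma> \<circ> \<rho>) -` X \<in> choices bl then ev A (\<phi> \<circ> \<rho>) else 0)"
    by (rule sum_perms_left[OF assms(2)])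
  finally show ?thesis by (simp add: vimage_comp)
qed

lemma stabilizer_vimage: "\<sigma> \<in> stabilizer X \<Longrightarrow> \<sigma> -` X = X"
  by (rule set_eqI) (simp add: stabilizer_def del: split_paired_All)

lemma ev_orbit_sum_stabilizer:
  assumes "\<phi> \<in> covectors" "\<sigma> \<in> stabilizer X"
  shows "ev (orbit_sum bl X A) (\<phi> \<circ> \<sigma>) = ev (orbit_sum bl X A) \<phi>"
  using ev_orbit_sum_perm[OF assms(1) stabilizer_perms[OF assms(2)], of bl X A]
    stabilizer_vimage[OF stabilizer_inv[OF assms(2)]]
  by (simp add: ev_orbit_sum assms(1))

definition degree_part :: "('n \<times> nat \<Rightarrow> nat) \<Rightarrow> ('n \<Rightarrow> nat) \<Rightarrow> (('n \<Rightarrow> ('v \<Rightarrow> 'k) list) \<Rightarrow> 'k) \<Rightarrow>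
    ('n \<Rightarrow> 'v \<Rightarrow> 'k) \<Rightarrow> ('n \<Rightarrow> 'v \<Rightarrow> 'k) \<Rightarrow> 'k" where
  "degree_part bl a A e f = (\<Sum>S\<in>{S\<in>choices bl. cnt S = a}. ev A (pattern e f S))"

text \<open>These permutations form a coset of the stabilizer of \<open>X\<close>.\<close>

lemma card_perms_vimage_eq:
  assumes "S \<subseteq> Pos" "X \<subseteq> Pos" "cnt S = cnt X"
  shows "card {\<pi>\<in>perms. \<pi> -` X = S} = card (stabilizer X)"
proof -
  obtain \<pi> where \<pi>: "\<pi> \<in> perms" "\<pi> -` X = S" using perm_exists[OF assms] .
  have "bij_betw (\<lambda>\<sigma>. \<sigma> \<circ> \<pi>) (stabilizer X) {\<pi>\<in>perms. \<pi> -` X = S}"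
  proof (rule bij_betw_byWitness[where f' = "\<lambda>\<rho>. \<rho> \<circ> inv \<pi>"])
    show "\<forall>\<sigma>\<in>stabilizer X. \<sigma> \<circ> \<pi> \<circ> inv \<pi> = \<sigma>" "\<forall>\<rho>\<in>{\<pi>\<in>perms. \<pi> -` X = S}. \<rho> \<circ> inv \<pi> \<circ> \<pi> = \<rho>"
      by (simp_all add: o_assoc[symmetric] perms_inv_comp[OF \<pi>(1)])
    show "(\<lambda>\<sigma>. \<sigma> \<circ> \<pi>) ` stabilizer X \<subseteq> {\<pi>\<in>perms. \<pi> -` X = S}"
    proof (rule image_subsetI)
      fix \<sigma> assume \<sigma>: "\<sigma> \<in> stabilizer X"
      have "(\<sigma> \<circ> \<pi>) -` X = \<pi> -` (\<sigma> -` X)" by (simp add: vimage_comp)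
      then show "\<sigma> \<circ> \<pi> \<in> {\<pi>\<in>perms. \<pi> -` X = S}"
        using \<sigma> \<pi> stabilizer_vimage[OF \<sigma>] perms_comp[OF stabilizer_perms[OF \<sigma>] \<pi>(1)] by simp
    qed
    have inv: "\<pi> (inv \<pi> p) = p" for p using perms_inv_comp(1)[OF \<pi>(1)] by (metis comp_apply id_apply)
    show "(\<lambda>\<rho>. \<rho> \<circ> inv \<pi>) ` {\<pi>\<in>perms. \<pi> -` X = S} \<subseteq> stabilizer X"
    proof (rule image_subsetI)
      fix \<rho> assume \<rho>: "\<rho> \<in> {\<pi>\<in>perms. \<pi> -` X = S}"
      have "\<rho> (inv \<pi> p) \<in> X \<longleftrightarrow> p \<in> X" for p
      proof -
        have "\<rho> (inv \<pi> p) \<in> X \<longleftrightarrow> inv \<pi> p \<in> S" using \<rho> by auto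
        also have "\<dots> \<longleftrightarrow> \<pi> (inv \<pi> p) \<in> X" using \<pi>(2) by auto
        finally show ?thesis by (simp add: inv)
      qed
      then show "\<rho> \<circ> inv \<pi> \<in> stabilizer X"
        using \<rho> \<pi>(1) by (simp add: stabilizer_def perms_comp perms_inv)
    qed
  qed
  then show ?thesis by (rule bij_betw_same_card[symmetric])
qed

lemma ev_orbit_sum_pattern:
  assumes X: "X \<subseteq> Pos" and ef: "e \<in> duals" "f \<in> duals"
  shows "ev (orbit_sum bl X A) (pattern e f X) = of_nat (card (stabilizer X)) * degree_part bl (cnt X) A e f"
proof -
  let ?C = "{S\<in>choices bl. cnt S = cnt X}" and ?P = "{\<pi>\<in>perms. \<pi> -` X \<in> choices bl}"
  have "ev (orbit_sum bl X A) (pattern e f X) = (\<Sum>\<pi>\<in>?P. ev A (pattern e f (\<pi> -` X)))"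
    by (simp add: ev_orbit_sum pattern_covectors[OF ef] sum.inter_filter[symmetric] pattern_perm)
  also have "\<dots> = (\<Sum>S\<in>?C. \<Sum>\<pi>\<in>{\<pi>\<in>?P. \<pi> -` X = S}. ev A (pattern e f (\<pi> -` X)))"
    by (rule sum.group[symmetric]) (use cnt_perm_vimage[OF _ X] in auto)
  also have "\<dots> = (\<Sum>S\<in>?C. of_nat (card (stabilizer X)) * ev A (pattern e f S))"
  proof (rule sum.cong[OF refl])
    fix S assume S: "S \<in> ?C"
    then have "{\<pi>\<in>?P. \<pi> -` X = S} = {\<pi>\<in>perms. \<pi> -` X = S}" by auto
    then show "(\<Sum>\<pi>\<in>{\<pi>\<in>?P. \<pi> -` X = S}. ev A (pattern e f (\<pi> -` X))) =
      of_nat (card (stabilizer X)) * ev A (pattern e f S)"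
      using S card_perms_vimage_eq[OF _ X, of S] by (simp add: choices_def)
  qed
  finally show ?thesis by (simp add: degree_part_def sum_distrib_left)
qed

lemma degree_part_eq_0:
  assumes A: "A \<in> ten" and s: "(\<Sum>j\<in>UNIV. a j) = s"
    and zero: "\<And>e f. e \<in> duals \<Longrightarrow> f \<in> duals \<Longrightarrow> choice_sum bl s A e f = 0"
    and ef: "e \<in> duals" "f \<in> duals"
  shows "degree_part bl a A e f = 0"
proof -
  have "(\<Sum>S\<in>{S\<in>{S\<in>choices bl. card S = s}. cnt S = a}. 1 * ev A (pattern e f S)) = 0"
    by (rule degree_component[where A = "\<lambda>_. A" and S = "\<lambda>S. S"])
      (use A zero ef in \<open>auto simp: choice_sum_def choices_def\<close>)
  moreover have "{S\<in>{S\<in>choices bl. card S = s}. cnt S = a} = {S\<in>choices bl. cnt S = a}"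
    using s by (auto simp: sum_cnt[symmetric] choices_finite)
  ultimately show ?thesis by (simp add: degree_part_def)
qed

text \<open>The orbit sum is invariant under the stabilizer of \<open>X\<close>, so the sum in
  \<open>polarization\<close> is a nonzero multiple of a single value. Thus vanishing on
  \<open>e\<close> and \<open>f\<close> extends to all covectors.\<close>

lemma orbit_sum_eq_0:
  assumes A: "A \<in> ten" and X: "X \<subseteq> Pos"
    and zero: "\<And>e f. e \<in> duals \<Longrightarrow> f \<in> duals \<Longrightarrow> choice_sum bl (card X) A e f = 0"
    and \<phi>: "\<phi> \<in> covectors"
  shows "ev (orbit_sum bl X A) \<phi> = 0"
proof -
  have fX: "finite X" using X finite_Pos finite_subset by blast
  have "ev (orbit_sum bl X A) (pattern e f X) = 0" if "e \<in> duals" "f \<in> duals" for e f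
    using degree_part_eq_0[OF A sum_cnt[OF fX] zero that] by (simp add: ev_orbit_sum_pattern[OF X that])
  then have "(\<Sum>\<sigma>\<in>stabilizer X. ev (orbit_sum bl X A) (\<phi> \<circ> \<sigma>)) = 0"
    by (intro polarization X orbit_sum_ten A \<phi>)
  then have "of_nat (card (stabilizer X)) * ev (orbit_sum bl X A) \<phi> = 0"
    by (simp add: ev_orbit_sum_stabilizer \<phi>)
  moreover have "card (stabilizer X) \<noteq> 0" using stabilizer_id by (auto simp: card_eq_0_iff)
  ultimately show ?thesis by simp
qed

lemma transpose_perms:
  assumes "p \<in> Pos" "q \<in> Pos" "fst p = fst q"
  shows "transpose p q \<in> perms"
proof -
  have "fst (transpose p q x) = fst x" for x
    using assms(3) by (cases "x = p"; cases "x = q") simp_all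
  then show ?thesis
    using permutes_swap_id[OF assms(1,2)] by (simp add: perms_def del: split_paired_All)
qed

lemma insert_choices:
  "z \<notin> U \<Longrightarrow> insert z U \<in> choices bl \<longleftrightarrow> U \<in> choices bl \<and> z \<in> Pos \<and> bl z \<notin> bl ` U"
  by (auto simp: choices_def)

lemma vimage_transpose_pos:
  "q \<in> X \<Longrightarrow> p \<notin> X \<Longrightarrow> transpose p q -` X = insert p (X - {q})"
  by (auto simp: transpose_def split: if_splits)

text \<open>
  Exchanging one bottom position with all top positions counts the extensions of the remaining
  bottom row to a choice; this number is constant, so the result is a multiple of an orbit sum for a
  smaller set, which vanishes.
\<close>

lemma exchange_relation:
  assumes a: "shape a" and A: "A \<in> ten" and bl: "valid_blocks bl"
    and zero: "\<And>s e f. s < card (columns a) \<Longrightarrow> e \<in> duals \<Longrightarrow> f \<in> duals \<Longrightarrow> choice_sum bl s A e f = 0"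
    and x: "(j, l) \<in> columns a" and \<phi>: "\<phi> \<in> covectors"
  defines "B \<equiv> orbit_sum bl (bottom_row a) A"
  shows "ev B \<phi> + (\<Sum>i<r * d j - a j. ev B (\<phi> \<circ> transpose (j, i) (bot a (j, l)))) = 0"
proof -
  define q where "q = bot a (j, l)"
  define X where "X = bottom_row a - {q}"
  have ex: "2 * a j \<le> r * d j" using a by (simp add: shape_def)
  have q: "q \<in> bottom_row a" "q = (j, r * d j - a j + l)" using x by (auto simp: q_def bottom_row_def bot_def)
  have qP: "q \<in> Pos" using q bottom_row_subset[OF a] by auto
  have Xins: "bottom_row a = insert q X" "q \<notin> X" using q by (auto simp: X_def)
  have XP: "X \<subseteq> Pos" using bottom_row_subset[OF a] by (auto simp: X_def)
  have cardX: "card X < card (columns a)"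
  proof -
    have "card (bottom_row a) = card (columns a)" using card_flip[OF a, of "{}"] by (simp add: flip_empty)
    moreover have "finite X" using XP finite_Pos finite_subset by blast
    ultimately show ?thesis using Xins by simp
  qed
  let ?I = "{..<r * d j - a j}"
  \<comment> \<open>The places of factor \<open>j\<close> where the removed position can be put
    back: the whole first row and \<open>q\<close> itself.\<close>
  define Z where "Z = {p\<in>Pos. fst p = j \<and> p \<notin> X}"
  have Zeq: "Z = insert q ((\<lambda>i. (j, i)) ` ?I)"
    using q(2) qP Xins(2) by (auto simp: Z_def X_def mem_bottom_row[OF a])
  have qn: "q \<notin> (\<lambda>i. (j, i)) ` ?I" using q by auto
  define \<chi> where "\<chi> S = (if S \<in> choices bl then 1 else 0 :: 'k)" for S
  have *: "ev B (\<phi> \<circ> transpose (j, i) q) = (\<Sum>\<rho>\<in>perms. \<chi> (\<rho> -` insert (j, i) X) * ev A (\<phi> \<circ> \<rho>))" if "i \<in> ?I" for i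
  proof -
    have "(j, i) \<in> Pos" using that by simp
    moreover have "(j, i) \<notin> bottom_row a" using that by (simp add: mem_bottom_row[OF a])
    ultimately have "transpose (j, i) q -` bottom_row a = insert (j, i) X" "transpose (j, i) q \<in> perms"
      using q qP by (auto simp: vimage_transpose_pos X_def intro!: transpose_perms)
    then show ?thesis
      using ev_orbit_sum_perm[OF \<phi>, of "transpose (j, i) q" bl "bottom_row a" A]
      by (auto simp: B_def \<chi>_def intro!: sum.cong)
  qed
  have "ev B \<phi> + (\<Sum>i\<in>?I. ev B (\<phi> \<circ> transpose (j, i) q)) =
    (\<Sum>\<rho>\<in>perms. \<chi> (\<rho> -` insert q X) * ev A (\<phi> \<circ> \<rho>)) +
    (\<Sum>i\<in>?I. \<Sum>\<rho>\<in>perms. \<chi> (\<rho> -` insert (j, i) X) * ev A (\<phi> \<circ> \<rho>))"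
    using * by (simp add: B_def ev_orbit_sum[OF \<phi>] Xins(1)) (auto simp: \<chi>_def intro!: sum.cong)
  also have "(\<Sum>i\<in>?I. \<Sum>\<rho>\<in>perms. \<chi> (\<rho> -` insert (j, i) X) * ev A (\<phi> \<circ> \<rho>)) =
    (\<Sum>y\<in>(\<lambda>i. (j, i)) ` ?I. \<Sum>\<rho>\<in>perms. \<chi> (\<rho> -` insert y X) * ev A (\<phi> \<circ> \<rho>))"
    by (subst sum.reindex) (auto simp: inj_on_def)
  also have "(\<Sum>\<rho>\<in>perms. \<chi> (\<rho> -` insert q X) * ev A (\<phi> \<circ> \<rho>)) + \<dots> =
    (\<Sum>y\<in>Z. \<Sum>\<rho>\<in>perms. \<chi> (\<rho> -` insert y X) * ev A (\<phi> \<circ> \<rho>))"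
    unfolding Zeq using qn by simp
  also have "\<dots> = (\<Sum>\<rho>\<in>perms. (\<Sum>y\<in>Z. \<chi> (\<rho> -` insert y X)) * ev A (\<phi> \<circ> \<rho>))"
    by (subst sum.swap) (simp add: sum_distrib_right)
  also have "\<dots> = (\<Sum>\<rho>\<in>perms. of_nat ((r - card X) * d j) * (if \<rho> -` X \<in> choices bl then ev A (\<phi> \<circ> \<rho>) else 0))"
  proof (rule sum.cong[OF refl])
    fix \<rho> assume \<rho>: "\<rho> \<in> perms"
    define U where "U = \<rho> -` X"
    have inv: "\<rho> (inv \<rho> p) = p" "inv \<rho> (\<rho> p) = p" for p
      using perms_inv_comp[OF \<rho>] by (metis comp_apply id_apply)+
    have "(\<Sum>y\<in>Z. \<chi> (\<rho> -` insert y X)) = (\<Sum>z\<in>{p\<in>Pos. fst p = j \<and> p \<notin> U}. \<chi> (insert z U))"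
    proof (rule sum.reindex_bij_witness[of _ \<rho> "inv \<rho>"])
      fix y assume y: "y \<in> Z"
      show "inv \<rho> y \<in> {p\<in>Pos. fst p = j \<and> p \<notin> U}"
        using y perms_mem[OF perms_inv[OF \<rho>], of y] perms_fst[OF perms_inv[OF \<rho>], of y]
        by (auto simp: Z_def U_def inv)
      have "\<rho> -` insert y X = insert (inv \<rho> y) U"
      proof (rule set_eqI)
        fix p
        have "\<rho> p = y \<longleftrightarrow> p = inv \<rho> y" using inv by metis
        then show "p \<in> \<rho> -` insert y X \<longleftrightarrow> p \<in> insert (inv \<rho> y) U" by (simp add: U_def)
      qed
      then show "\<chi> (insert (inv \<rho> y) U) = \<chi> (\<rho> -` insert y X)" by simp
    next
      fix z assume "z \<in> {p\<in>Pos. fst p = j \<and> p \<notin> U}"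
      then show "\<rho> z \<in> Z" using perms_mem[OF \<rho>, of z] perms_fst[OF \<rho>, of z] by (auto simp: Z_def U_def)
    qed (simp_all add: inv)
    also have "\<dots> = (\<Sum>z\<in>{p\<in>Pos. fst p = j \<and> p \<notin> U}. if U \<in> choices bl \<and> bl z \<notin> bl ` U then 1 else 0)"
      by (rule sum.cong[OF refl]) (auto simp: \<chi>_def insert_choices)
    also have "\<dots> = (if U \<in> choices bl then of_nat ((r - card X) * d j) else 0)"
    proof (cases "U \<in> choices bl")
      case True
      have "(\<Sum>z\<in>{p\<in>Pos. fst p = j \<and> p \<notin> U}. if U \<in> choices bl \<and> bl z \<notin> bl ` U then 1 else 0 :: 'k) =
        of_nat (card {z\<in>{p\<in>Pos. fst p = j \<and> p \<notin> U}. bl z \<notin> bl ` U})"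
        using True by (simp add: sum.inter_filter[symmetric])
      also have "{z\<in>{p\<in>Pos. fst p = j \<and> p \<notin> U}. bl z \<notin> bl ` U} = Pair j ` {i. i < r * d j \<and> bl (j, i) \<notin> bl ` U}"
        by auto
      also have "card \<dots> = (r - card U) * d j"
        using card_free_positions[OF bl True, of j] by (simp add: card_image inj_on_def)
      also have "card U = card X" by (simp add: U_def card_perm_vimage[OF \<rho>])
      finally show ?thesis using True by simp
    qed simp
    finally show "(\<Sum>y\<in>Z. \<chi> (\<rho> -` insert y X)) * ev A (\<phi> \<circ> \<rho>) =
      of_nat ((r - card X) * d j) * (if \<rho> -` X \<in> choices bl then ev A (\<phi> \<circ> \<rho>) else 0)"
      by (simp add: U_def)
  qed
  also have "\<dots> = of_nat ((r - card X) * d j) * ev (orbit_sum bl X A) \<phi>"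
    by (simp only: ev_orbit_sum[OF \<phi>] sum_distrib_left)
  also have "\<dots> = 0"
    using orbit_sum_eq_0[OF A XP _ \<phi>, of bl] zero[OF cardX] by simp
  finally show ?thesis unfolding q_def .
qed

lemma move_add: "move \<pi> (A + B) = move \<pi> A + move \<pi> B"
  by (auto simp: move_def fun_eq_iff ev_def fun_apply)

lemma move_scale: "move \<pi> (fscale c A) = fscale c (move \<pi> A)"
  by (auto simp: move_def fun_eq_iff ev_def fun_apply)

lemma symmetrize_add: "symmetrize a (A + B) = symmetrize a A + symmetrize a B"
  by (simp add: symmetrize_def move_add fs.scale_right_distrib sum.distrib)

lemma symmetrize_scale: "symmetrize a (fscale c A) = fscale c (symmetrize a A)"
  by (simp add: symmetrize_def move_scale fs.scale_sum_right mult.commute)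

lemma schur_space_add: "A \<in> schur_space a \<Longrightarrow> B \<in> schur_space a \<Longrightarrow> A + B \<in> schur_space a"
  unfolding schur_space_def by (auto simp: symmetrize_add[symmetric] intro: ten_add)

lemma schur_space_scale: "A \<in> schur_space a \<Longrightarrow> fscale c A \<in> schur_space a"
  unfolding schur_space_def by (auto simp: symmetrize_scale[symmetric] intro: ten_scale)

lemma schur_space_zero: "0 \<in> schur_space a"
proof -
  have "symmetrize a (fscale 0 0) = 0" unfolding symmetrize_scale by simp
  then show ?thesis unfolding schur_space_def using ten_zero by (metis fs.scale_zero_left image_eqI)
qed

lemma mem_flip_top:
  assumes "shape a" "T \<subseteq> columns a" "i < r * d j - a j"
  shows "(j, i) \<in> flip a T \<longleftrightarrow> (j, i) \<in> T"
  using assms(3) by (auto simp: flip_def bot_def)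

lemma bot_notin_flip:
  assumes "shape a" "T \<subseteq> columns a" "x \<in> columns a"
  shows "bot a x \<in> flip a T \<longleftrightarrow> x \<notin> T"
  using assms bot_notin_columns[OF assms(1), of x] by (auto simp: flip_def inj_image_mem_iff[OF inj_bot])

lemma flip_insert:
  assumes a: "shape a" and T: "T \<subseteq> columns a" and x: "x \<in> columns a" "x \<notin> T"
  shows "flip a T = insert (bot a x) (flip a (insert x T) - {x})"
proof -
  have "x \<notin> bot a ` (columns a - T)" using bot_notin_columns[OF a] x(1) by (metis imageE)
  moreover have "columns a - T = insert x (columns a - insert x T)" using x by auto
  ultimately show ?thesis using x(2) by (auto simp: flip_def)
qed

text \<open>What counts is the sign of the ratio: it prevents cancellation in the column
  antisymmetrization. The columns are flipped one at a time by the exchange relation. The constant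
  is rational so that its positivity has a meaning.\<close>

lemma ev_orbit_sum_flip:
  assumes a: "shape a" and A: "A \<in> ten" and bl: "valid_blocks bl"
    and zero: "\<And>s e f. s < card (columns a) \<Longrightarrow> e \<in> duals \<Longrightarrow> f \<in> duals \<Longrightarrow> choice_sum bl s A e f = 0"
    and T: "T \<subseteq> columns a"
  defines "B \<equiv> orbit_sum bl (bottom_row a) A"
  shows "\<exists>c::rat. c > 0 \<and> (\<forall>e\<in>duals. \<forall>f\<in>duals. ev B (pattern e f (flip a T)) =
    (- 1) ^ card T * of_rat c * ev B (pattern e f (bottom_row a)))"
proof -
  have "finite T" using T finite_columns finite_subset by blast
  then show ?thesis using T
  proof (induction T rule: finite_induct)
    case empty
    then show ?case by (intro exI[of _ 1]) (simp add: flip_empty)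
  next
    case (insert x T)
    then obtain c where c: "c > 0" "\<And>e f. e \<in> duals \<Longrightarrow> f \<in> duals \<Longrightarrow> ev B (pattern e f (flip a T)) =
      (- 1) ^ card T * of_rat c * ev B (pattern e f (bottom_row a))" by auto
    obtain j l where x: "x = (j, l)" by (cases x)
    let ?S = "flip a (insert x T)" and ?q = "bot a x" and ?p = "r * d j - a j"
    have T: "T \<subseteq> columns a" "x \<in> columns a" "x \<notin> T" using insert by auto
    have ex: "2 * a j \<le> r * d j" using a by (simp add: shape_def)
    \<comment> \<open>The first row positions of factor \<open>j\<close> that carry \<open>f\<close>
      in the pattern of \<open>?S\<close>.\<close>
    define N where "N = {i\<in>{..<?p}. (j, i) \<in> insert x T}"
    have l: "l \<in> N" using T(2) ex by (simp add: N_def x)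
    have fN: "finite N" by (simp add: N_def)
    have cN: "card N \<le> ?p" using card_mono[of "{..<?p}" N] by (auto simp: N_def)
    have cN0: "card N > 0" using l fN by (auto simp: card_gt_0_iff)
    have q: "?q \<in> Pos" "fst ?q = j" "?q \<notin> ?S" "?q \<in> bottom_row a"
    proof -
      show "?q \<in> bottom_row a" using T(2) by (simp add: bottom_row_def)
      then show "?q \<in> Pos" using bottom_row_subset[OF a] by blast
      show "fst ?q = j" by (simp add: x bot_def)
      show "?q \<notin> ?S" using bot_notin_flip[OF a insert.prems T(2)] by simp
    qed
    \<comment> \<open>The position \<open>?q\<close> carries \<open>e\<close>. Exchanging it with a
      top position that carries \<open>e\<close> changes nothing; a top position that carries
      \<open>f\<close> gives the pattern of \<open>flip a T\<close> up to a row permutation.\<close>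
    have *: "of_nat (1 + (?p - card N)) * ev B (pattern e f ?S) = - of_nat (card N) * ev B (pattern e f (flip a T))"
      if ef: "e \<in> duals" "f \<in> duals" for e f
    proof -
      have val: "ev B (pattern e f ?S \<circ> transpose (j, i) ?q) =
        (if i \<in> N then ev B (pattern e f (flip a T)) else ev B (pattern e f ?S))" if i: "i < ?p" for i
      proof -
        have iP: "(j, i) \<in> Pos" using i by simp
        have t: "transpose (j, i) ?q \<in> perms" using iP q by (intro transpose_perms) auto
        have mem: "(j, i) \<in> ?S \<longleftrightarrow> i \<in> N" using mem_flip_top[OF a insert.prems i] i by (simp add: N_def)
        show ?thesis
        proof (cases "i \<in> N")
          case False
          then have "transpose (j, i) ?q -` ?S = ?S"
            using mem q(3) by (auto simp: transpose_def split: if_splits)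
          then show ?thesis using False by (simp add: pattern_perm[OF t])
        next
          case True
          have xP: "x \<in> Pos" using T(2) columns_subset[OF a] by blast
          have st: "transpose (j, i) x \<in> stabilizer (bottom_row a)"
          proof -
            have 1: "(j, i) \<notin> bottom_row a" "x \<notin> bottom_row a"
              using i T(2) ex by (auto simp: mem_bottom_row[OF a] x)
            have "transpose (j, i) x y \<in> bottom_row a \<longleftrightarrow> y \<in> bottom_row a" for y
              using 1 by (cases "y = (j, i)"; cases "y = x") simp_all
            moreover have "transpose (j, i) x \<in> perms" using iP xP by (intro transpose_perms) (auto simp: x)
            ultimately show ?thesis by (simp add: stabilizer_def)
          qed
          have xS: "x \<in> ?S" by (simp add: flip_def)
          have jS: "(j, i) \<in> ?S" using mem True by simp
          have "transpose (j, i) ?q -` ?S = insert ?q (?S - {(j, i)})"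
            using jS q(3) by (subst transpose_commute) (rule vimage_transpose_pos)
          also have "\<dots> = transpose (j, i) x -` insert ?q (?S - {x})"
            using jS xS q(3) by (auto simp: transpose_def split: if_splits)
          also have "insert ?q (?S - {x}) = flip a T" using flip_insert[OF a T] by simp
          finally have "pattern e f ?S \<circ> transpose (j, i) ?q = pattern e f (flip a T) \<circ> transpose (j, i) x"
            by (simp add: pattern_perm[OF t] pattern_perm[OF stabilizer_perms[OF st]])
          then show ?thesis
            using True ev_orbit_sum_stabilizer[OF pattern_covectors[OF ef] st] by (simp add: B_def)
        qed
      qed
      have "0 = ev B (pattern e f ?S) + (\<Sum>i<?p. ev B (pattern e f ?S \<circ> transpose (j, i) ?q))"
        using exchange_relation[OF a A bl zero T(2)[unfolded x] pattern_covectors[OF ef], of ?S]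
        by (simp add: B_def x)
      also have "(\<Sum>i<?p. ev B (pattern e f ?S \<circ> transpose (j, i) ?q)) =
        (\<Sum>i<?p. if i \<in> N then ev B (pattern e f (flip a T)) else ev B (pattern e f ?S))"
        by (rule sum.cong) (auto simp: val)
      also have "\<dots> = of_nat (card N) * ev B (pattern e f (flip a T)) + of_nat (?p - card N) * ev B (pattern e f ?S)"
      proof -
        have "{..<?p} \<inter> {i. i \<in> N} = N" by (auto simp: N_def)
        moreover have "{..<?p} \<inter> - {i. i \<in> N} = {..<?p} - N" by auto
        moreover have "card ({..<?p} - N) = ?p - card N" using fN by (subst card_Diff_subset) (auto simp: N_def)
        ultimately show ?thesis by (simp add: sum.If_cases)
      qed
      finally show ?thesis by (simp add: algebra_simps eq_neg_iff_add_eq_0)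
    qed
    define c' :: rat where "c' = of_nat (card N) / of_nat (1 + (?p - card N)) * c"
    have "c' > 0" using cN0 c(1) by (simp add: c'_def)
    moreover have "ev B (pattern e f ?S) = (- 1) ^ card (insert x T) * of_rat c' * ev B (pattern e f (bottom_row a))"
      if ef: "e \<in> duals" "f \<in> duals" for e f
    proof -
      have nz: "of_nat (1 + (?p - card N)) \<noteq> (0::'k)" unfolding of_nat_eq_0_iff by simp
      have "ev B (pattern e f ?S) = - of_nat (card N) / of_nat (1 + (?p - card N)) * ev B (pattern e f (flip a T))"
        using *[OF ef] nz by (simp add: field_simps del: of_nat_add of_nat_Suc)
      also have "\<dots> = (- 1) ^ card (insert x T) * of_rat c' * ev B (pattern e f (bottom_row a))"
        using insert.hyps c(2)[OF ef] by (simp add: c'_def of_rat_mult of_rat_divide del: of_nat_add of_nat_Suc)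
      finally show ?thesis .
    qed
    ultimately show ?case by blast
  qed
qed

lemma cnt_bottom_row: "cnt (bottom_row a) = a"
proof
  fix j
  have "{p \<in> bottom_row a. fst p = j} = (\<lambda>i. bot a (j, i)) ` {..<a j}"
    by (auto simp: bottom_row_def bot_def)
  then show "cnt (bottom_row a) j = a j"
    using inj_bot[of a] by (simp add: cnt_def card_image inj_def inj_on_def)
qed

text \<open>The symmetrizer is applied to the orbit sum of the second row. Its column signs cancel
  those of \<open>ev_orbit_sum_flip\<close>, so the value with \<open>f\<close> in the second row is
  only multiplied by a positive rational, which is divided out together with the order of the
  stabilizer.\<close>

lemma degree_part_in_schur:
  assumes a: "shape a" and A: "A \<in> ten" and bl: "valid_blocks bl"
    and zero: "\<And>s e f. s < card (columns a) \<Longrightarrow> e \<in> duals \<Longrightarrow> f \<in> duals \<Longrightarrow> choice_sum bl s A e f = 0"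
  obtains A' where "A' \<in> schur_space a"
    "\<And>e f. e \<in> duals \<Longrightarrow> f \<in> duals \<Longrightarrow> ev A' (pattern e f (bottom_row a)) = degree_part bl a A e f"
proof -
  define B where "B = orbit_sum bl (bottom_row a) A"
  have BT: "B \<in> ten" using A by (simp add: B_def orbit_sum_ten)
  have "\<forall>T\<in>Pow (columns a). \<exists>c::rat. c > 0 \<and> (\<forall>e\<in>duals. \<forall>f\<in>duals. ev B (pattern e f (flip a T)) =
    (- 1) ^ card T * of_rat c * ev B (pattern e f (bottom_row a)))"
    unfolding B_def by (intro ballI ev_orbit_sum_flip a A bl zero) auto
  then obtain c :: "('n \<times> nat) set \<Rightarrow> rat" where c: "\<And>T. T \<in> Pow (columns a) \<Longrightarrow> c T > 0"
    "\<And>T e f. T \<in> Pow (columns a) \<Longrightarrow> e \<in> duals \<Longrightarrow> f \<in> duals \<Longrightarrow> ev B (pattern e f (flip a T)) =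
    (- 1) ^ card T * of_rat (c T) * ev B (pattern e f (bottom_row a))" by metis
  define C :: rat where "C = (\<Sum>T\<in>Pow (columns a). c T)"
  have "C > 0" unfolding C_def using c(1) by (intro sum_pos) auto
  let ?n = "card (stabilizer (bottom_row a))"
  have n: "?n \<noteq> 0" using stabilizer_id by (auto simp: card_eq_0_iff)
  have main: "ev (symmetrize a B) (pattern e f (bottom_row a)) = of_nat ?n * of_rat C * of_nat ?n * degree_part bl a A e f"
    if ef: "e \<in> duals" "f \<in> duals" for e f
  proof -
    have "ev (symmetrize a B) (pattern e f (bottom_row a)) =
      (\<Sum>T\<in>Pow (columns a). \<Sum>\<sigma>\<in>stabilizer (bottom_row a). (- 1) ^ card T * ev B (pattern e f (flip a T) \<circ> \<sigma>))"
      using a by (simp add: ev_symmetrize pattern_covectors[OF ef] pattern_perm[OF swap_columns_perms] swap_columns_vimage)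
    also have "\<dots> = (\<Sum>T\<in>Pow (columns a). of_nat ?n * (of_rat (c T) * ev B (pattern e f (bottom_row a))))"
    proof (rule sum.cong[OF refl])
      fix T assume T: "T \<in> Pow (columns a)"
      have "(- 1) ^ card T * ((- 1) ^ card T * y) = (y :: 'k)" for y
        by (simp add: mult.assoc[symmetric] flip: power_mult_distrib)
      then show "(\<Sum>\<sigma>\<in>stabilizer (bottom_row a). (- 1) ^ card T * ev B (pattern e f (flip a T) \<circ> \<sigma>)) =
        of_nat ?n * (of_rat (c T) * ev B (pattern e f (bottom_row a)))"
        using ev_orbit_sum_stabilizer[OF pattern_covectors[OF ef], where X = "bottom_row a" and bl = bl and A = A]
        by (simp add: c(2)[OF T ef] B_def[symmetric] mult.assoc)
    qed
    also have "\<dots> = of_nat ?n * of_rat C * ev B (pattern e f (bottom_row a))"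
      by (simp add: C_def of_rat_sum sum_distrib_left sum_distrib_right mult.assoc)
    also have "ev B (pattern e f (bottom_row a)) = of_nat ?n * degree_part bl a A e f"
      unfolding B_def by (simp add: ev_orbit_sum_pattern[OF bottom_row_subset[OF a] ef] cnt_bottom_row)
    finally show ?thesis by (simp add: mult.assoc)
  qed
  have nz: "of_nat ?n * of_rat C * of_nat ?n \<noteq> (0::'k)" using n \<open>C > 0\<close> by simp
  show ?thesis
  proof (rule that[of "fscale (inverse (of_nat ?n * of_rat C * of_nat ?n)) (symmetrize a B)"])
    show "fscale (inverse (of_nat ?n * of_rat C * of_nat ?n)) (symmetrize a B) \<in> schur_space a"
      by (rule schur_space_scale) (use BT in \<open>simp add: schur_space_def\<close>)
    show "ev (fscale (inverse (of_nat ?n * of_rat C * of_nat ?n)) (symmetrize a B)) (pattern e f (bottom_row a)) = degree_part bl a A e f"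
      if "e \<in> duals" "f \<in> duals" for e f
      unfolding ev_scale main[OF that] mult.assoc[symmetric] left_inverse[OF nz[unfolded mult.assoc[symmetric]]] using nz
      by (simp add: field_simps)
  qed
qed

end

section \<open>Existence and vanishing of components\<close>

text \<open>The numbers counted are congruent modulo \<open>f\<close>, so they differ in
  \<open>i div f\<close>, which is below \<open>t\<close>.\<close>

lemma card_residue_le:
  assumes "m \<le> f * t"
  shows "card {i. i < m \<and> (c + i) mod f = k} \<le> (t::nat)"
proof -
  have "inj_on (\<lambda>i. i div f) {i. i < m \<and> (c + i) mod f = k}"
  proof (rule inj_onI)
    fix i i' assume h: "i \<in> {i. i < m \<and> (c + i) mod f = k}" "i' \<in> {i. i < m \<and> (c + i) mod f = k}" "i div f = i' div f"
    have "i mod f = i' mod f"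
    proof (cases "i \<le> i'")
      case True
      have "f dvd (c + i') - (c + i)" using h True by (subst mod_eq_dvd_iff_nat[symmetric]) auto
      then show ?thesis using True by (simp add: mod_eq_dvd_iff_nat[symmetric])
    next
      case False
      have "f dvd (c + i) - (c + i')" using h False by (subst mod_eq_dvd_iff_nat[symmetric]) auto
      then show ?thesis using False by (simp add: mod_eq_dvd_iff_nat[symmetric])
    qed
    then show "i = i'" using h(3) by (metis div_mult_mod_eq)
  qed
  then have "card {i. i < m \<and> (c + i) mod f = k} = card ((\<lambda>i. i div f) ` {i. i < m \<and> (c + i) mod f = k})"
    by (simp add: card_image)
  also have "\<dots> \<le> card {..<t}"
    using assms by (intro card_mono) (auto intro!: less_mult_imp_div_less simp: mult.commute)
  finally show ?thesis by simp
qed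

lemma sum_card_fibres:
  fixes b :: "'a \<Rightarrow> nat"
  assumes "finite D" "\<And>i. i \<in> D \<Longrightarrow> b i < r"
  shows "(\<Sum>k<r. card {i\<in>D. b i = k}) = card (D :: 'a set)"
proof -
  have "(\<Sum>k<r. \<Sum>i\<in>{i\<in>D. b i = k}. 1) = (\<Sum>i\<in>D. 1::nat)"
    by (rule sum.group) (use assms in auto)
  then show ?thesis by simp
qed

text \<open>Greedy assignment: while a point of \<open>P\<close> is left, fewer than
  \<open>r * m\<close> points are placed, so some fibre has fewer than \<open>m\<close>
  elements.\<close>

lemma extend_to_equal_fibres:
  fixes P :: "'a set" and b :: "'a \<Rightarrow> nat"
  assumes "finite P" "card P = r * m" "D \<subseteq> P" "\<And>i. i \<in> D \<Longrightarrow> b i < r" "\<And>k. k < r \<Longrightarrow> card {i\<in>D. b i = k} \<le> m"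
  shows "\<exists>b'. (\<forall>i\<in>D. b' i = b i) \<and> (\<forall>i\<in>P. b' i < r) \<and> (\<forall>k<r. card {i\<in>P. b' i = k} = m)"
  using assms(3-5)
proof (induction "card (P - D)" arbitrary: D b)
  case 0
  then have D: "D = P" using assms(1) by auto
  have "card {i\<in>P. b i = k} = m" if "k < r" for k
  proof (rule ccontr)
    assume "card {i\<in>P. b i = k} \<noteq> m"
    then have "card {i\<in>P. b i = k} < m" using 0(4)[OF that] D by simp
    then have "(\<Sum>k<r. card {i\<in>P. b i = k}) < (\<Sum>k<r. m)"
      using 0(4) D that by (intro sum_strict_mono_ex1) auto
    moreover have "(\<Sum>k<r. card {i\<in>P. b i = k}) = card P"
      using assms(1) 0(3) D by (intro sum_card_fibres) auto
    ultimately show False using assms(2) by simp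
  qed
  then show ?case using 0(3) D by (intro exI[of _ b]) auto
next
  case (Suc n)
  then obtain i where i: "i \<in> P" "i \<notin> D" by (metis DiffE card.empty equals0I nat.distinct(1))
  have fD: "finite D" using Suc(3) assms(1) finite_subset by blast
  have "card D < r * m"
  proof -
    have "D \<subset> P" using i Suc(3) by auto
    then show ?thesis using assms(1,2) psubset_card_mono by metis
  qed
  have "\<exists>k<r. card {i\<in>D. b i = k} < m"
  proof (rule ccontr)
    assume "\<not> (\<exists>k<r. card {i\<in>D. b i = k} < m)"
    then have "m \<le> card {i\<in>D. b i = k}" if "k < r" for k using that by (meson not_less)
    then have "(\<Sum>k<r. m) \<le> (\<Sum>k<r. card {i\<in>D. b i = k})" by (intro sum_mono) auto
    also have "\<dots> = card D" using fD Suc(4) by (intro sum_card_fibres) auto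
    finally show False using \<open>card D < r * m\<close> by simp
  qed
  then obtain k where k: "k < r" "card {i\<in>D. b i = k} < m" by blast
  let ?b = "b(i := k)"
  have "\<exists>b'. (\<forall>x\<in>insert i D. b' x = ?b x) \<and> (\<forall>i\<in>P. b' i < r) \<and> (\<forall>k<r. card {i\<in>P. b' i = k} = m)"
  proof (rule Suc(1))
    show "n = card (P - insert i D)"
      using Suc(2) i assms(1) by (simp add: Diff_insert[of P i D] card_Diff_singleton)
    show "insert i D \<subseteq> P" using i Suc(3) by auto
    show "?b x < r" if "x \<in> insert i D" for x using that k Suc(4) i by auto
    show "card {x\<in>insert i D. ?b x = k'} \<le> m" if "k' < r" for k'
    proof (cases "k' = k")
      case True
      have "{x\<in>insert i D. ?b x = k'} = insert i {x\<in>D. b x = k}" using True i by auto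
      then show ?thesis using k(2) fD i by simp
    next
      case False
      have "{x\<in>insert i D. ?b x = k'} = {x\<in>D. b x = k'}" using False i by auto
      then show ?thesis using Suc(5)[OF that] by simp
    qed
  qed
  then obtain b' where "\<forall>x\<in>insert i D. b' x = ?b x" "\<forall>i\<in>P. b' i < r" "\<forall>k<r. card {i\<in>P. b' i = k} = m" by blast
  then show ?case using i by (intro exI[of _ b']) auto
qed

text \<open>Concatenates the intervals in an arbitrary order of the index type. Since the columns of
  one factor stay consecutive, they spread evenly over the residues modulo \<open>f\<close>.\<close>

lemma consecutive_numbering:
  fixes a :: "'n::finite \<Rightarrow> nat"
  obtains off :: "'n \<Rightarrow> nat" where "inj_on (\<lambda>(j, i). off j + i) (SIGMA j:UNIV. {..<a j})"
    "\<And>j. off j + a j \<le> (\<Sum>j\<in>UNIV. a j)"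
proof -
  obtain ord :: "'n \<Rightarrow> nat" where ord: "inj ord"
    using finite_imp_inj_to_nat_seg[of "UNIV :: 'n set"] by auto
  define off where "off j = (\<Sum>j'\<in>{j'. ord j' < ord j}. a j')" for j
  have le: "off j + a j \<le> (\<Sum>j'\<in>J. a j')" if "insert j {j'. ord j' < ord j} \<subseteq> J" for j J
  proof -
    have "off j + a j = (\<Sum>j'\<in>insert j {j'. ord j' < ord j}. a j')" by (simp add: off_def)
    also have "\<dots> \<le> (\<Sum>j'\<in>J. a j')" by (rule sum_mono2) (use that in auto)
    finally show ?thesis .
  qed
  have lt: "off j + a j \<le> off j'" if "ord j < ord j'" for j j'
    unfolding off_def[of j'] by (rule le) (use that in auto)
  have "inj_on (\<lambda>(j, i). off j + i) (SIGMA j:UNIV. {..<a j})"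
  proof (rule inj_onI, clarify)
    fix j i j' i' assume h: "i < a j" "i' < a j'" "off j + i = off j' + i'"
    have "ord j = ord j'" using lt[of j j'] lt[of j' j] h by (cases "ord j" "ord j'" rule: linorder_cases) auto
    then have "j = j'" using ord by (simp add: inj_eq)
    then show "j = j' \<and> i = i'" using h(3) by simp
  qed
  then show ?thesis using le[of _ UNIV] by (intro that) auto
qed

context segre_veronese
begin

text \<open>
  The columns are the edges of a graph on the blocks. Up to isolated vertices, its components are
  \<open>f\<close> stars, one edge of which is doubled. An admissible \<open>T\<close> orients the edges such that every
  vertex of a star is the head of exactly one edge; hence exactly \<open>f\<close> edges point to a centre,
  and there is no cancellation.
\<close>

lemma good_blocks:
  assumes a: "shape a" and f: "\<And>j. a j \<le> f * d j" "2 * f \<le> (\<Sum>j\<in>UNIV. a j)" "(\<Sum>j\<in>UNIV. a j) \<le> r"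
  obtains bl where "valid_blocks bl" "leading_coeff bl a \<noteq> 0"
proof -
  let ?e = "\<Sum>j\<in>UNIV. a j"
  obtain off where off: "inj_on (\<lambda>(j, i). off j + i) (columns a)" "\<And>j. off j + a j \<le> ?e"
    unfolding columns_def by (rule consecutive_numbering[of a]) blast
  define \<epsilon> where "\<epsilon> = (\<lambda>(j, i). off j + i)"
  have \<epsilon>: "inj_on \<epsilon> (columns a)" "\<And>x. x \<in> columns a \<Longrightarrow> \<epsilon> x < ?e"
    using off(1) by (auto simp: \<epsilon>_def) (metis add_less_cancel_left off(2) order_less_le_trans)
  \<comment> \<open>The column numbered \<open>x\<close> joins the centre \<open>x mod f\<close>, a
    block below \<open>f\<close>, to the leaf \<open>other x\<close>, a block from \<open>f\<close>
    to \<open>?e - 1\<close>. For \<open>x < f\<close> the columns \<open>x\<close> and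
    \<open>x + f\<close> have both ends in common; the second one exists because
    \<open>2 * f \<le> ?e\<close>.\<close>
  define other where "other x = (if x < f then x + f else x)" for x
  have other: "f \<le> other x" "other x mod f = x mod f" "x < ?e \<Longrightarrow> other x < ?e" for x
    using f(2) by (auto simp: other_def)
  have f0: "f > 0" if "x \<in> columns a" for x
    using that f(1)[of "fst x"] by (cases x) (auto intro: gr0I)
  define b where "b j i = (if i < a j then \<epsilon> (j, i) mod f else other (\<epsilon> (j, i - (r * d j - a j))))" for j i
  have ex: "2 * a j \<le> r * d j" for j using a by (simp add: shape_def)
  have bottom_index: thesis if "r * d j - a j \<le> i" "i < r * d j"
    "\<And>l. i = r * d j - a j + l \<Longrightarrow> l < a j \<Longrightarrow> thesis" for i j thesis
    using that(3)[of "i - (r * d j - a j)"] that(1,2) ex[of j] by linarith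
  have b_top: "b j i = \<epsilon> (j, i) mod f" if "i < a j" for j i using that by (simp add: b_def)
  have b_bot: "b j (r * d j - a j + i) = other (\<epsilon> (j, i))" for j i
    using ex[of j] by (simp add: b_def)
  define D where "D j = {..<a j} \<union> {r * d j - a j..<r * d j}" for j
  have "\<exists>b'. (\<forall>i\<in>D j. b' i = b j i) \<and> (\<forall>i\<in>{..<r * d j}. b' i < r) \<and>
    (\<forall>k<r. card {i\<in>{..<r * d j}. b' i = k} = d j)" for j
  proof (rule extend_to_equal_fibres)
    show "D j \<subseteq> {..<r * d j}" using ex[of j] by (auto simp: D_def)
    fix i assume i: "i \<in> D j"
    show "b j i < r"
    proof (cases "i < a j")
      case True
      then have "(j, i) \<in> columns a" by simp
      then have "\<epsilon> (j, i) mod f < f" using f0 by auto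
      then show ?thesis using b_top[OF True] f(2,3) by simp
    next
      case False
      then have "r * d j - a j \<le> i" "i < r * d j" using i by (auto simp: D_def)
      then obtain l where l: "i = r * d j - a j + l" "l < a j" by (rule bottom_index)
      then show ?thesis using b_bot[of j l] other(3)[OF \<epsilon>(2)[of "(j, l)"]] f(3) by simp
    qed
  next
    fix k assume "k < r"
    show "card {i\<in>D j. b j i = k} \<le> d j"
    proof (cases "k < f")
      case True
      have "{i\<in>D j. b j i = k} \<subseteq> {i. i < a j \<and> (off j + i) mod f = k}"
        using True other(1) by (auto simp: b_def \<epsilon>_def) (metis leD)+
      then have "card {i\<in>D j. b j i = k} \<le> card {i. i < a j \<and> (off j + i) mod f = k}"
        by (intro card_mono) auto
      also have "\<dots> \<le> d j" by (rule card_residue_le[OF f(1)])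
      finally show ?thesis .
    next
      case False
      \<comment> \<open>Only the columns numbered \<open>k\<close> and \<open>k - f\<close> can end
        in the leaf \<open>k\<close>. They lie in one residue class, so the bound for the centres
        applies to leaves as well.\<close>
      have "{i\<in>D j. b j i = k} \<subseteq> (\<lambda>l. r * d j - a j + l) ` {l. l < a j \<and> (off j + l) mod f = k mod f}"
      proof
        fix i assume i: "i \<in> {i\<in>D j. b j i = k}"
        have "\<not> i < a j"
        proof
          assume "i < a j"
          then have "b j i < f" using b_top f0[of "(j, i)"] by simp
          then show False using i False by simp
        qed
        then have "r * d j - a j \<le> i" "i < r * d j" using i by (auto simp: D_def)
        then obtain l where l: "i = r * d j - a j + l" "l < a j" by (rule bottom_index)
        then have "other (\<epsilon> (j, l)) = k" using i b_bot by auto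
        then have "(off j + l) mod f = k mod f" using other(2)[of "\<epsilon> (j, l)"] by (simp add: \<epsilon>_def)
        then show "i \<in> (\<lambda>l. r * d j - a j + l) ` {l. l < a j \<and> (off j + l) mod f = k mod f}" using l by auto
      qed
      then have "card {i\<in>D j. b j i = k} \<le> card ((\<lambda>l. r * d j - a j + l) ` {l. l < a j \<and> (off j + l) mod f = k mod f})"
        by (intro card_mono) auto
      also have "\<dots> \<le> card {l. l < a j \<and> (off j + l) mod f = k mod f}" by (rule card_image_le) auto
      also have "\<dots> \<le> d j" by (rule card_residue_le[OF f(1)])
      finally show ?thesis .
    qed
  qed auto
  then have "\<exists>b'. \<forall>j. (\<forall>i\<in>D j. b' j i = b j i) \<and> (\<forall>i\<in>{..<r * d j}. b' j i < r) \<and>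
    (\<forall>k<r. card {i\<in>{..<r * d j}. b' j i = k} = d j)"
    by (intro choice allI)
  then obtain b' where "\<forall>j. (\<forall>i\<in>D j. b' j i = b j i) \<and> (\<forall>i\<in>{..<r * d j}. b' j i < r) \<and>
    (\<forall>k<r. card {i\<in>{..<r * d j}. b' j i = k} = d j)" ..
  then have b': "\<And>j i. i \<in> D j \<Longrightarrow> b' j i = b j i" "\<And>j i. i < r * d j \<Longrightarrow> b' j i < r"
    "\<And>j k. k < r \<Longrightarrow> card {i\<in>{..<r * d j}. b' j i = k} = d j" by simp_all
  define bl where "bl = (\<lambda>(j, i). b' j i)"
  have top: "bl x = \<epsilon> x mod f" if "x \<in> columns a" for x
    using that b'(1) b_top by (cases x) (auto simp: bl_def D_def)
  have bot: "bl (bot a x) = other (\<epsilon> x)" if "x \<in> columns a" for x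
  proof (cases x)
    case (Pair j i)
    then have "r * d j - a j + i \<in> D j" using that ex[of j] by (auto simp: D_def)
    then show ?thesis using b'(1) b_bot by (simp add: Pair bot_def bl_def)
  qed
  have valid: "valid_blocks bl"
    using b'(2,3) by (auto simp: valid_blocks_def bl_def)
  \<comment> \<open>The head of an edge is the block of the chosen box. The \<open>?e\<close> chosen
    boxes fill all \<open>?e\<close> blocks, and a centre can only be filled by a top box.\<close>
  have eq: "card T = f" if T: "T \<subseteq> columns a" "inj_on bl (flip a T)" for T
  proof -
    have lt: "bl p < ?e" if "p \<in> flip a T" for p
    proof -
      consider "p \<in> columns a" | x where "p = bot a x" "x \<in> columns a" using \<open>p \<in> flip a T\<close> T(1) by (auto simp: flip_def)
      then show ?thesis
      proof cases
        case 1
        then have "\<epsilon> p mod f < f" using f0 by auto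
        then show ?thesis using top[OF 1] f(2) by simp
      next
        case 2
        then show ?thesis using bot other(3) \<epsilon>(2) by simp
      qed
    qed
    have "card (bl ` flip a T) = ?e"
      using card_image[OF T(2)] card_flip[OF a T(1)] by (simp add: card_columns)
    moreover have "bl ` flip a T \<subseteq> {..<?e}" using lt by auto
    ultimately have im: "bl ` flip a T = {..<?e}" by (intro card_subset_eq) auto
    have "bl ` T = {..<f}"
    proof (intro equalityI subsetI)
      fix k assume "k \<in> bl ` T"
      then show "k \<in> {..<f}" using T(1) top f0 by auto
    next
      fix k assume k: "k \<in> {..<f}"
      then have "k \<in> bl ` flip a T" using im f(2) by auto
      then obtain p where p: "p \<in> flip a T" "k = bl p" by auto
      have "p \<in> T"
      proof (rule ccontr)
        assume "p \<notin> T"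
        then obtain x where "p = bot a x" "x \<in> columns a" using p(1) by (auto simp: flip_def)
        then have "f \<le> k" using bot other(1) p(2) by simp
        then show False using k by simp
      qed
      then show "k \<in> bl ` T" using p(2) by auto
    qed
    moreover have "inj_on bl T" using T(2) by (rule inj_on_subset) (auto simp: flip_def)
    ultimately show ?thesis using card_image[of bl T] by simp
  qed
  let ?C = "{T. T \<subseteq> columns a \<and> inj_on bl (flip a T)}"
  have "leading_coeff bl a = (\<Sum>T\<in>?C. (- 1) ^ f)"
    unfolding leading_coeff_def by (rule sum.cong) (use eq in auto)
  also have "\<dots> = of_nat (card ?C) * (- 1) ^ f" by simp
  finally have lc: "leading_coeff bl a = of_nat (card ?C) * (- 1) ^ f" .
  \<comment> \<open>The orientation in which the column numbered \<open>x\<close> points to the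
    block \<open>x\<close>; it shows that the count is positive.\<close>
  define T0 where "T0 = {x\<in>columns a. \<epsilon> x < f}"
  have T0: "bl x = \<epsilon> x" if "x \<in> T0" for x using that top by (auto simp: T0_def)
  have T0': "bl (bot a x) = \<epsilon> x" if "x \<in> columns a - T0" for x using that bot by (auto simp: T0_def other_def)
  have "inj_on bl (flip a T0)"
  proof (rule inj_onI)
    fix p q assume pq: "p \<in> flip a T0" "q \<in> flip a T0" "bl p = bl q"
    have "\<exists>x\<in>columns a. \<epsilon> x = bl p \<and> p = (if x \<in> T0 then x else bot a x)" if "p \<in> flip a T0" for p
    proof -
      consider "p \<in> T0" | x where "p = bot a x" "x \<in> columns a - T0" using \<open>p \<in> flip a T0\<close> by (auto simp: flip_def)
      then show ?thesis
      proof cases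
        case 1
        then show ?thesis using T0[OF 1] by (intro bexI[of _ p]) (auto simp: T0_def)
      next
        case 2
        then show ?thesis using T0'[OF 2(2)] by (intro bexI[of _ x]) auto
      qed
    qed
    from this[OF pq(1)] this[OF pq(2)] show "p = q"
      using pq(3) inj_onD[OF \<epsilon>(1)] by (metis (full_types))
  qed
  then have "T0 \<in> ?C" by (auto simp: T0_def)
  moreover have "finite ?C" by (rule finite_subset[of _ "Pow (columns a)"]) auto
  ultimately have "card ?C \<noteq> 0" by (auto simp: card_eq_0_iff)
  then have "leading_coeff bl a \<noteq> 0" unfolding lc by simp
  with valid show ?thesis by (rule that)
qed

section \<open>Vanishing of the components with e < 2 f\<close>

lemma cnt_Un:
  assumes "finite U" "finite W" "U \<inter> W = {}"
  shows "cnt (U \<union> W) i = cnt U i + cnt W i"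
proof -
  have "{p\<in>U \<union> W. fst p = i} = {p\<in>U. fst p = i} \<union> {p\<in>W. fst p = i}" by auto
  then show ?thesis unfolding cnt_def using assms by (simp only:) (rule card_Un_disjoint, auto)
qed

lemma cnt_factor: "(\<And>p. p \<in> W \<Longrightarrow> fst p = j) \<Longrightarrow> cnt W i = (if i = j then card W else 0)"
proof -
  assume W: "\<And>p. p \<in> W \<Longrightarrow> fst p = j"
  have "{p\<in>W. fst p = i} = (if i = j then W else {})" using W by auto
  then show ?thesis by (simp add: cnt_def)
qed

text \<open>Adding or removing \<open>y\<close> pairs the choices off with opposite signs. Adding is
  always possible because no other position of \<open>Y\<close> shares the block of
  \<open>y\<close>, and removing is allowed because \<open>y\<close> lies in factor
  \<open>j\<close>.\<close>

lemma toggle_sum_eq_0: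
  assumes Y: "Y \<subseteq> Pos" and y: "y \<in> Y" "fst y = j" "\<And>p. p \<in> Y \<Longrightarrow> p \<noteq> y \<Longrightarrow> bl p \<noteq> bl y"
  shows "(\<Sum>U\<in>{U\<in>choices bl. U \<subseteq> Y \<and> (\<forall>p\<in>Y - U. fst p = j)}. (- 1) ^ cnt U j) = (0::'k)"
proof -
  let ?C = "{U\<in>choices bl. U \<subseteq> Y \<and> (\<forall>p\<in>Y - U. fst p = j)}"
  define \<iota> where "\<iota> U = (if y \<in> U then U - {y} else insert y U)" for U
  have fin: "finite U" if "U \<in> ?C" for U using that choices_finite by auto
  have mem: "\<iota> U \<in> ?C" if U: "U \<in> ?C" for U
  proof (cases "y \<in> U")
    case True
    then show ?thesis using U y(2) by (auto simp: \<iota>_def choices_def intro: inj_on_subset)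
  next
    case False
    have "bl y \<notin> bl ` U"
    proof
      assume "bl y \<in> bl ` U"
      then obtain u where u: "u \<in> U" "bl u = bl y" by force
      then have "u \<in> Y" "u \<noteq> y" using U False by auto
      then show False using y(3) u(2) by blast
    qed
    then show ?thesis using U y(1) Y False by (auto simp: \<iota>_def insert_choices)
  qed
  have cnt: "(- 1) ^ cnt (\<iota> U) j = - ((- 1) ^ cnt U j :: 'k)" if U: "U \<in> ?C" for U
  proof (cases "y \<in> U")
    case True
    then have "{p\<in>U. fst p = j} = insert y {p\<in>U - {y}. fst p = j}" using y(2) by auto
    moreover have "finite {p\<in>U - {y}. fst p = j}" using fin[OF U] by simp
    ultimately have "cnt U j = Suc (cnt (U - {y}) j)" by (simp add: cnt_def)
    then show ?thesis using True by (simp add: \<iota>_def)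
  next
    case False
    then have "{p\<in>insert y U. fst p = j} = insert y {p\<in>U. fst p = j}" using y(2) by auto
    moreover have "finite {p\<in>U. fst p = j}" using fin[OF U] by simp
    ultimately have "cnt (insert y U) j = Suc (cnt U j)" using False by (simp add: cnt_def)
    then show ?thesis using False by (simp add: \<iota>_def)
  qed
  have "(\<Sum>U\<in>?C. (- 1) ^ cnt (\<iota> U) j) = (\<Sum>U\<in>?C. (- 1) ^ cnt U j :: 'k)"
    by (rule sum.reindex_bij_witness[of _ \<iota> \<iota>]) (use mem in \<open>auto simp: \<iota>_def\<close>)
  moreover have "(\<Sum>U\<in>?C. (- 1) ^ cnt (\<iota> U) j) = - (\<Sum>U\<in>?C. (- 1) ^ cnt U j :: 'k)"
    by (simp only: sum_negf[symmetric]) (rule sum.cong[OF refl], rule cnt)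
  ultimately have "(\<Sum>U\<in>?C. (- 1) ^ cnt U j) + (\<Sum>U\<in>?C. (- 1) ^ cnt U j :: 'k) = 0" by simp
  then have "2 * (\<Sum>U\<in>?C. (- 1) ^ cnt U j :: 'k) = 0" by (simp only: mult_2)
  then show ?thesis by simp
qed

lemma ev_pattern_shift_factor:
  assumes A: "A \<in> ten" and ef: "e \<in> duals" "f \<in> duals"
  shows "ev A (pattern (e(j := \<lambda>v. e j v + z * f j v)) f U) =
    (\<Sum>W\<in>Pow ({p\<in>Pos. fst p = j} - U). z ^ card W * ev A (pattern e f (U \<union> W)))"
proof -
  let ?F = "{p\<in>Pos. fst p = j} - U"
  let ?b = "\<lambda>p. if p \<in> ?F then z else 0"
  have "ev A (pattern (e(j := \<lambda>v. e j v + z * f j v)) f U) =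
    ev A (\<lambda>p v. 1 * pattern e f U p v + ?b p * f (fst p) v)"
    by (rule ev_cong) (auto simp: pattern_def)
  also have "\<dots> = (\<Sum>Y\<in>Pow Pos. (\<Prod>p\<in>Pos - Y. 1) * (\<Prod>p\<in>Y. ?b p) * ev A (\<lambda>p. if p \<in> Y then f (fst p) else pattern e f U p))"
    using ef pattern_covectors[OF ef, of U] by (intro ev_expand[OF A]) (auto simp: duals_def covectors_def)
  also have "\<dots> = (\<Sum>Y\<in>Pow ?F. (\<Prod>p\<in>Pos - Y. 1) * (\<Prod>p\<in>Y. ?b p) * ev A (\<lambda>p. if p \<in> Y then f (fst p) else pattern e f U p))"
  proof (rule sum.mono_neutral_right)
    show "\<forall>Y\<in>Pow Pos - Pow ?F. (\<Prod>p\<in>Pos - Y. 1) * (\<Prod>p\<in>Y. ?b p) * ev A (\<lambda>p. if p \<in> Y then f (fst p) else pattern e f U p) = 0"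
    proof
      fix Y assume Y: "Y \<in> Pow Pos - Pow ?F"
      then have "(\<Prod>p\<in>Y. ?b p) = 0"
        by (intro prod_zero) (auto intro: finite_subset[OF _ finite_Pos])
      then show "(\<Prod>p\<in>Pos - Y. 1) * (\<Prod>p\<in>Y. ?b p) * ev A (\<lambda>p. if p \<in> Y then f (fst p) else pattern e f U p) = 0"
        by simp
    qed
  qed auto
  also have "\<dots> = (\<Sum>W\<in>Pow ?F. z ^ card W * ev A (pattern e f (U \<union> W)))"
  proof (rule sum.cong[OF refl])
    fix W assume W: "W \<in> Pow ?F"
    have "(\<Prod>p\<in>W. ?b p) = (\<Prod>p\<in>W. z)" using W by (intro prod.cong) auto
    moreover have "ev A (\<lambda>p. if p \<in> W then f (fst p) else pattern e f U p) = ev A (pattern e f (U \<union> W))"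
      by (rule ev_cong) (auto simp: pattern_def)
    ultimately show "(\<Prod>p\<in>Pos - W. 1) * (\<Prod>p\<in>W. ?b p) * ev A (\<lambda>p. if p \<in> W then f (fst p) else pattern e f U p) =
      z ^ card W * ev A (pattern e f (U \<union> W))" by simp
  qed
  finally show ?thesis .
qed

text \<open>For \<open>s < a j\<close> the part of degree \<open>a(j := s)\<close> vanishes
  identically. After the substitution of \<open>e j + z * f j\<close>, its coefficient of
  \<open>z ^ (a j - s)\<close> is a sum over choices \<open>U\<close> enlarged by arbitrary
  positions \<open>W\<close> of factor \<open>j\<close>. The alternating sum over
  \<open>s \<le> a j\<close> therefore retains only the part of degree \<open>a\<close>. Grouped by
  \<open>Y = U \<union> W\<close>, the same sum has toggle sums as coefficients and is zero.\<close>

lemma degree_part_lonely: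
  assumes A: "A \<in> ten"
    and zero: "\<And>s e f. s < (\<Sum>j\<in>UNIV. a j) \<Longrightarrow> e \<in> duals \<Longrightarrow> f \<in> duals \<Longrightarrow> choice_sum bl s A e f = 0"
    and lonely: "\<And>Y. Y \<subseteq> Pos \<Longrightarrow> cnt Y = a \<Longrightarrow> inj_on bl {p\<in>Y. fst p \<noteq> j} \<Longrightarrow>
      \<exists>y\<in>Y. fst y = j \<and> (\<forall>p\<in>Y. p \<noteq> y \<longrightarrow> bl p \<noteq> bl y)"
    and ef: "e \<in> duals" "f \<in> duals"
  shows "degree_part bl a A e f = 0"
proof -
  define Pj where "Pj = {p\<in>Pos. fst p = j}"
  define R where "R s = (SIGMA U:{U\<in>choices bl. cnt U = a(j := s)}. Pow (Pj - U))" for s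
  have fPj: "finite Pj" by (simp add: Pj_def)
  have finR: "finite (R s)" for s unfolding R_def using fPj by (intro finite_SigmaI) auto
  have part: "(\<Sum>x\<in>{x\<in>R s. card (snd x) = a j - s}. ev A (pattern e f (fst x \<union> snd x))) = 0" if s: "s < a j" for s
  proof (rule power_sum_coeff_zero[OF finR])
    fix z :: 'k
    have e': "e(j := \<lambda>v. e j v + z * f j v) \<in> duals" using ef by (auto simp: duals_def intro!: dual_add dual_scale)
    have "(\<Sum>i\<in>UNIV. (a(j := s)) i) < (\<Sum>i\<in>UNIV. a i)"
      by (rule sum_strict_mono_ex1) (use s in auto)
    then have "degree_part bl (a(j := s)) A (e(j := \<lambda>v. e j v + z * f j v)) f = 0"
      using degree_part_eq_0[OF A refl zero e' ef(2)] by simp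
    then have "0 = (\<Sum>U\<in>{U\<in>choices bl. cnt U = a(j := s)}. \<Sum>W\<in>Pow (Pj - U). z ^ card W * ev A (pattern e f (U \<union> W)))"
      unfolding degree_part_def by (simp add: ev_pattern_shift_factor[OF A ef] Pj_def)
    also have "\<dots> = (\<Sum>x\<in>R s. ev A (pattern e f (fst x \<union> snd x)) * z ^ card (snd x))"
      unfolding R_def by (subst sum.Sigma) (use fPj in \<open>auto simp: split_def mult.commute\<close>)
    finally show "(\<Sum>x\<in>R s. ev A (pattern e f (fst x \<union> snd x)) * z ^ card (snd x)) = 0" by simp
  qed
  define Q where "Q = (SIGMA Y:{Y. Y \<subseteq> Pos \<and> cnt Y = a}. {U\<in>choices bl. U \<subseteq> Y \<and> (\<forall>p\<in>Y - U. fst p = j)})"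
  have finQ: "finite Q" unfolding Q_def by (intro finite_SigmaI) auto
  have Qs: "(\<Sum>x\<in>{x\<in>Q. cnt (snd x) j = s}. (- 1) ^ cnt (snd x) j * ev A (pattern e f (fst x))) =
    (- 1) ^ s * (\<Sum>x\<in>{x\<in>R s. card (snd x) = a j - s}. ev A (pattern e f (fst x \<union> snd x)))" if s: "s \<le> a j" for s
  proof -
    have "(\<Sum>x\<in>{x\<in>Q. cnt (snd x) j = s}. ev A (pattern e f (fst x))) =
      (\<Sum>x\<in>{x\<in>R s. card (snd x) = a j - s}. ev A (pattern e f (fst x \<union> snd x)))"
    proof (rule sum.reindex_bij_witness[of _ "\<lambda>(U, W). (U \<union> W, U)" "\<lambda>(Y, U). (U, Y - U)"])
      fix x assume x: "x \<in> {x\<in>Q. cnt (snd x) j = s}"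
      then obtain Y U where YU: "x = (Y, U)" "Y \<subseteq> Pos" "cnt Y = a" "U \<in> choices bl" "U \<subseteq> Y"
        "\<forall>p\<in>Y - U. fst p = j" "cnt U j = s" by (auto simp: Q_def)
      have fY: "finite Y" using YU(2) finite_Pos finite_subset by blast
      have "cnt (U \<union> (Y - U)) i = cnt U i + cnt (Y - U) i" for i
        using fY YU(5) by (intro cnt_Un) (auto intro: finite_subset)
      note c1 = this
      have UY: "U \<union> (Y - U) = Y" using YU(5) by auto
      have cW: "cnt (Y - U) i = (if i = j then card (Y - U) else 0)" for i
        by (rule cnt_factor) (use YU(6) in blast)
      have c: "a i = cnt U i + (if i = j then card (Y - U) else 0)" for i
        using c1[of i] unfolding UY YU(3) cW .
      have "cnt U = a(j := s)" using c YU(7) by (auto simp: fun_eq_iff)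
      then show "(case x of (Y, U) \<Rightarrow> (U, Y - U)) \<in> {x\<in>R s. card (snd x) = a j - s}"
        using YU c[of j] by (auto simp: R_def Pj_def)
      show "(case case x of (Y, U) \<Rightarrow> (U, Y - U) of (U, W) \<Rightarrow> (U \<union> W, U)) = x"
        "ev A (pattern e f (fst (case x of (Y, U) \<Rightarrow> (U, Y - U)) \<union> snd (case x of (Y, U) \<Rightarrow> (U, Y - U)))) = ev A (pattern e f (fst x))"
        using YU(1) UY by auto
    next
      fix x assume x: "x \<in> {x\<in>R s. card (snd x) = a j - s}"
      then obtain U W where UW: "x = (U, W)" "U \<in> choices bl" "cnt U = a(j := s)" "W \<subseteq> Pj - U" "card W = a j - s"
        by (auto simp: R_def)
      have "finite W" using UW(4) fPj finite_subset by blast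
      then have "cnt (U \<union> W) i = cnt U i + cnt W i" for i
        using UW choices_finite by (intro cnt_Un) auto
      moreover have "cnt W i = (if i = j then card W else 0)" for i
        by (rule cnt_factor) (use UW(4) in \<open>auto simp: Pj_def\<close>)
      ultimately have "cnt (U \<union> W) = a"
        using UW(3,5) s by (auto simp: fun_eq_iff)
      then show "(case x of (U, W) \<Rightarrow> (U \<union> W, U)) \<in> {x\<in>Q. cnt (snd x) j = s}"
        using UW by (auto simp: Q_def Pj_def choices_def)
      show "(case case x of (U, W) \<Rightarrow> (U \<union> W, U) of (Y, U) \<Rightarrow> (U, Y - U)) = x"
        using UW by auto
    qed
    moreover have "(\<Sum>x\<in>{x\<in>Q. cnt (snd x) j = s}. (- 1) ^ cnt (snd x) j * ev A (pattern e f (fst x))) =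
      (\<Sum>x\<in>{x\<in>Q. cnt (snd x) j = s}. (- 1) ^ s * ev A (pattern e f (fst x)))"
      by (rule sum.cong) auto
    ultimately show ?thesis by (simp only: sum_distrib_left[symmetric])
  qed
  have le: "cnt (snd x) j \<le> a j" if "x \<in> Q" for x
  proof -
    have "finite (fst x)" using that by (auto simp: Q_def intro: finite_subset[OF _ finite_Pos])
    then have "cnt (snd x) j \<le> cnt (fst x) j"
      unfolding cnt_def using that by (intro card_mono) (auto simp: Q_def)
    then show ?thesis using that by (auto simp: Q_def)
  qed
  \<comment> \<open>The sum over \<open>Q\<close> is grouped by \<open>Y\<close> here and by the
    size \<open>s\<close> of the part of \<open>U\<close> in factor \<open>j\<close> below.\<close>
  have "0 = (\<Sum>Y\<in>{Y. Y \<subseteq> Pos \<and> cnt Y = a}. (\<Sum>U\<in>{U\<in>choices bl. U \<subseteq> Y \<and> (\<forall>p\<in>Y - U. fst p = j)}. (- 1) ^ cnt U j) * ev A (pattern e f Y))"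
  proof (rule sum.neutral[symmetric], rule ballI)
    fix Y assume Y: "Y \<in> {Y. Y \<subseteq> Pos \<and> cnt Y = a}"
    let ?C = "{U\<in>choices bl. U \<subseteq> Y \<and> (\<forall>p\<in>Y - U. fst p = j)}"
    have "(\<Sum>U\<in>?C. (- 1) ^ cnt U j) = (0::'k)"
    proof (cases "?C = {}")
      case True
      then show ?thesis by (simp only: sum.empty)
    next
      case False
      then obtain U where U: "U \<in> choices bl" "U \<subseteq> Y" "\<forall>p\<in>Y - U. fst p = j" by auto
      have "inj_on bl {p\<in>Y. fst p \<noteq> j}"
        by (rule inj_on_subset[of bl U]) (use U in \<open>auto simp: choices_def\<close>)
      then have "\<exists>y\<in>Y. fst y = j \<and> (\<forall>p\<in>Y. p \<noteq> y \<longrightarrow> bl p \<noteq> bl y)"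
        using Y by (intro lonely) auto
      then obtain y where "y \<in> Y" "fst y = j" "\<forall>p\<in>Y. p \<noteq> y \<longrightarrow> bl p \<noteq> bl y" by blast
      then show ?thesis using Y by (intro toggle_sum_eq_0[of Y y]) blast+
    qed
    then show "(\<Sum>U\<in>?C. (- 1) ^ cnt U j) * ev A (pattern e f Y) = 0" by simp
  qed
  also have "\<dots> = (\<Sum>x\<in>Q. (- 1) ^ cnt (snd x) j * ev A (pattern e f (fst x)))"
    unfolding Q_def by (simp only: sum_distrib_right) (subst sum.Sigma, auto simp: split_def)
  also have "\<dots> = (\<Sum>s\<in>{..a j}. \<Sum>x\<in>{x\<in>Q. cnt (snd x) j = s}. (- 1) ^ cnt (snd x) j * ev A (pattern e f (fst x)))"
    by (rule sum.group[symmetric]) (use finQ le in auto)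
  also have "\<dots> = (\<Sum>s\<in>{..a j}. (- 1) ^ s * (\<Sum>x\<in>{x\<in>R s. card (snd x) = a j - s}. ev A (pattern e f (fst x \<union> snd x))))"
    by (rule sum.cong) (use Qs in auto)
  also have "\<dots> = (\<Sum>s\<in>{a j}. (- 1) ^ s * (\<Sum>x\<in>{x\<in>R s. card (snd x) = a j - s}. ev A (pattern e f (fst x \<union> snd x))))"
    by (rule sum.mono_neutral_right) (use part in auto)
  also have "\<dots> = (- 1) ^ a j * degree_part bl a A e f"
  proof -
    have "{x\<in>R (a j). card (snd x) = a j - a j} = (\<lambda>U. (U, {})) ` {U\<in>choices bl. cnt U = a}"
    proof -
      have "finite W" if "W \<subseteq> Pj - U" for U W using that fPj by (meson finite_Diff finite_subset)
      then show ?thesis by (auto simp: R_def)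
    qed
    then show ?thesis by (simp add: degree_part_def sum.reindex inj_on_def)
  qed
  finally have "(- 1) ^ a j * ((- 1) ^ a j * degree_part bl a A e f) = 0" by simp
  then show ?thesis by (simp add: mult.assoc[symmetric] flip: power_mult_distrib)
qed

text \<open>Otherwise every block of \<open>K\<close>, met by factor \<open>j\<close> but by no
  other, holds at least two positions of \<open>Yj\<close>, and every block holds at most
  \<open>d j\<close>. Counting gives \<open>f \<le> card Y' + card K\<close> and
  \<open>2 * card K \<le> a j\<close>. If \<open>d j = 1\<close>, then \<open>K\<close> is empty and
  the total reaches \<open>2 * f\<close>. If \<open>d j \<ge> 2\<close>, then \<open>f(1)\<close>
  and \<open>f(2)\<close> leave no room for \<open>Y'\<close>, and \<open>K\<close> alone forces
  \<open>2 * f \<le> a j\<close>.\<close>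

lemma lonely_position:
  assumes bl: "valid_blocks bl" and f: "(f - 1) * d j < a j" "(\<Sum>j\<in>UNIV. a j) < 2 * f"
    and Y: "Y \<subseteq> Pos" "cnt Y = a" "inj_on bl {p\<in>Y. fst p \<noteq> j}"
  shows "\<exists>y\<in>Y. fst y = j \<and> (\<forall>p\<in>Y. p \<noteq> y \<longrightarrow> bl p \<noteq> bl y)"
proof (rule ccontr)
  assume none: "\<not> ?thesis"
  define Yj where "Yj = {p\<in>Y. fst p = j}"
  define Y' where "Y' = {p\<in>Y. fst p \<noteq> j}"
  have fY: "finite Y" using Y(1) finite_Pos finite_subset by blast
  have fin: "finite Yj" "finite Y'" using fY by (auto simp: Yj_def Y'_def)
  have cYj: "card Yj = a j" using Y(2) by (auto simp: Yj_def cnt_def)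
  have tot: "(\<Sum>j\<in>UNIV. a j) = a j + card Y'"
  proof -
    have "(\<Sum>j\<in>UNIV. a j) = card Y" using sum_cnt[OF fY] Y(2) by simp
    also have "Y = Yj \<union> Y'" by (auto simp: Yj_def Y'_def)
    also have "card \<dots> = card Yj + card Y'" using fin by (intro card_Un_disjoint) (auto simp: Yj_def Y'_def)
    finally show ?thesis using cYj by simp
  qed
  define K where "K = bl ` Yj - bl ` Y'"
  have fK: "finite K" using fin by (simp add: K_def)
  have fibre: "card {p\<in>Yj. bl p = k} \<le> d j" if "k \<in> bl ` Yj" for k
  proof -
    have "k < r" using that Y(1) bl by (auto simp: valid_blocks_def Yj_def)
    then have "card {i. i < r * d j \<and> bl (j, i) = k} = d j" using bl by (auto simp: valid_blocks_def)
    moreover have "{p\<in>Yj. bl p = k} \<subseteq> Pair j ` {i. i < r * d j \<and> bl (j, i) = k}" using Y(1) by (auto simp: Yj_def)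
    ultimately show ?thesis
      using surj_card_le[of "{i. i < r * d j \<and> bl (j, i) = k}" "{p\<in>Yj. bl p = k}" "Pair j"] by simp
  qed
  have two: "2 \<le> card {p\<in>Yj. bl p = k}" if "k \<in> K" for k
  proof -
    obtain y where y: "y \<in> Yj" "bl y = k" using \<open>k \<in> K\<close> unfolding K_def by blast
    then obtain p where p: "p \<in> Y" "p \<noteq> y" "bl p = bl y" using none by (auto simp: Yj_def)
    have "p \<in> Yj"
    proof (rule ccontr)
      assume "p \<notin> Yj"
      then have "p \<in> Y'" using p(1) by (auto simp: Yj_def Y'_def)
      then have "k \<in> bl ` Y'" using p(3) y(2) by (metis imageI)
      then show False using that by (simp add: K_def)
    qed
    then have "{y, p} \<subseteq> {p\<in>Yj. bl p = k}" using y p by auto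
    then have "card {y, p} \<le> card {p\<in>Yj. bl p = k}" using fin by (intro card_mono) auto
    then show ?thesis using p(2) by simp
  qed
  have cY': "card (bl ` Y') = card Y'" using Y(3) by (simp add: Y'_def card_image)
  have group: "(\<Sum>k\<in>bl ` Yj. card {p\<in>Yj. bl p = k}) = a j"
  proof -
    have "(\<Sum>k\<in>bl ` Yj. \<Sum>p\<in>{p\<in>Yj. bl p = k}. 1) = (\<Sum>p\<in>Yj. 1::nat)"
      by (rule sum.group) (use fin in auto)
    then show ?thesis using cYj by simp
  qed
  have up: "a j \<le> (card Y' + card K) * d j"
  proof -
    have "a j \<le> (\<Sum>k\<in>bl ` Yj. d j)" unfolding group[symmetric] by (rule sum_mono) (rule fibre)
    also have "\<dots> = card (bl ` Yj) * d j" by simp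
    also have "card (bl ` Yj) \<le> card (bl ` Y' \<union> K)" using fin by (intro card_mono) (auto simp: K_def)
    also have "\<dots> \<le> card Y' + card K" using card_Un_le[of "bl ` Y'" K] cY' by simp
    finally show ?thesis by (simp add: mult_right_mono)
  qed
  have low: "2 * card K \<le> a j"
  proof -
    have "(\<Sum>k\<in>K. 2) \<le> (\<Sum>k\<in>K. card {p\<in>Yj. bl p = k})" by (rule sum_mono) (rule two)
    also have "\<dots> \<le> a j" unfolding group[symmetric] by (rule sum_mono2) (use fin in \<open>auto simp: K_def\<close>)
    finally show ?thesis by simp
  qed
  have "(f - 1) * d j < (card Y' + card K) * d j" using f(1) up by linarith
  then have ft: "f \<le> card Y' + card K" using f(2) by (auto simp: mult_less_cancel2)
  show False
  proof (cases "d j = 1")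
    case True
    have "K = {}"
    proof (rule ccontr)
      assume "K \<noteq> {}"
      then obtain k where "k \<in> K" by auto
      then show False using two[of k] fibre[of k] True by (auto simp: K_def)
    qed
    then show False using ft f tot True by simp
  next
    case False
    then have "2 \<le> d j" using d_pos[of j] by simp
    then have "(f - 1) * 2 \<le> (f - 1) * d j" by (rule mult_left_mono) simp
    then have "2 * f \<le> a j + 1" using f(1) by linarith
    then have "card Y' = 0" using f(2) tot by linarith
    then show False using ft low f(2) tot by linarith
  qed
qed

end

section \<open>Comparison with Young symmetrizers\<close>

lemma partition_of_cases:
  assumes "partition_of \<mu> k" "length \<mu> \<le> 2"
  obtains "\<mu> = []" "k = 0" "nth_part \<mu> 2 = 0"
    | "\<mu> = [k]" "k > 0" "nth_part \<mu> 2 = 0"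
    | x y where "\<mu> = [x, y]" "k = x + y" "nth_part \<mu> 2 = y" "y \<le> x" "y > 0"
proof -
  consider "\<mu> = []" | x where "\<mu> = [x]" | x y where "\<mu> = [x, y]"
    using assms(2) by (cases \<mu>; cases "tl \<mu>") (auto simp: Suc_le_eq)
  then show ?thesis
    using assms(1) that by cases (auto simp: partition_of_def nth_part_def)
qed

text \<open>Translates the filling that underlies \<open>row_of\<close> and \<open>col_of\<close>
  into the layout of \<open>columns\<close> and \<open>bottom_row\<close>.\<close>

lemma two_row_partition:
  assumes "partition_of \<mu> k" "length \<mu> \<le> 2"
  shows "sum_list \<mu> = k" "2 * nth_part \<mu> 2 \<le> k"
    "i < k \<Longrightarrow> row_of \<mu> i = (if i < k - nth_part \<mu> 2 then 0 else 1)"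
    "i < k \<Longrightarrow> col_of \<mu> i = (if i < k - nth_part \<mu> 2 then i else i - (k - nth_part \<mu> 2))"
proof -
  show 1: "sum_list \<mu> = k" using assms(1) by (simp add: partition_of_def)
  show "2 * nth_part \<mu> 2 \<le> k" using assms by (cases rule: partition_of_cases) auto
  have row: "row_of \<mu> i = (if i < k - nth_part \<mu> 2 then 0 else 1)" if "i < k" for i
    using assms
  proof (cases rule: partition_of_cases)
    case (3 x y)
    show ?thesis
    proof (cases "i < x")
      case True
      then have "(LEAST i'. i < sum_list (take (Suc i') \<mu>)) = 0"
        by (intro Least_equality) (auto simp: 3)
      then show ?thesis using True 3 by (simp add: row_of_def)
    next
      case False
      have "(LEAST i'. i < sum_list (take (Suc i') \<mu>)) = 1"
      proof (rule Least_equality)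
        fix i' assume "i < sum_list (take (Suc i') \<mu>)"
        then show "1 \<le> i'" using False 3 by (cases i') auto
      qed (use that 3 in simp)
      then show ?thesis using False 3 by (simp add: row_of_def)
    qed
  next
    case 2
    then have "(LEAST i'. i < sum_list (take (Suc i') \<mu>)) = 0"
      by (intro Least_equality) (use that in auto)
    then show ?thesis using 2 that by (simp add: row_of_def)
  qed (use that in auto)
  then show "i < k \<Longrightarrow> row_of \<mu> i = (if i < k - nth_part \<mu> 2 then 0 else 1)" .
  show "col_of \<mu> i = (if i < k - nth_part \<mu> 2 then i else i - (k - nth_part \<mu> 2))" if "i < k"
    using assms
    by (cases rule: partition_of_cases) (use row[OF that] that in \<open>auto simp: col_of_def\<close>)
qed

context segre_veronese
begin

text \<open>Schur functors are defined with one permutation for each factor; these families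
  correspond to the permutations of \<open>Pos\<close> in \<open>perms\<close>, and
  \<open>factor_perm\<close> is the way back.\<close>

definition join_perms :: "('n \<Rightarrow> nat \<Rightarrow> nat) \<Rightarrow> 'n \<times> nat \<Rightarrow> 'n \<times> nat" where
  "join_perms \<sigma> = (\<lambda>(j, i). (j, \<sigma> j i))"

definition factor_perm :: "('n \<times> nat \<Rightarrow> 'n \<times> nat) \<Rightarrow> 'n \<Rightarrow> nat \<Rightarrow> nat" where
  "factor_perm \<pi> = (\<lambda>j i. snd (\<pi> (j, i)))"

lemma factor_perm_join_perms [simp]: "factor_perm (join_perms \<sigma>) = \<sigma>"
  by (simp add: join_perms_def factor_perm_def)

lemma join_perms_factor_perm: "(\<And>p. fst (\<pi> p) = fst p) \<Longrightarrow> join_perms (factor_perm \<pi>) = \<pi>"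
  by (auto simp: join_perms_def factor_perm_def fun_eq_iff prod_eq_iff)

lemma join_perms_perms:
  assumes "\<And>j. \<sigma> j permutes {..<r * d j}"
  shows "join_perms \<sigma> \<in> perms"
proof -
  have "bij_betw (join_perms \<sigma>) Pos Pos"
  proof (rule bij_betw_byWitness[where f' = "join_perms (\<lambda>j. inv (\<sigma> j))"])
    show "\<forall>p\<in>Pos. join_perms (\<lambda>j. inv (\<sigma> j)) (join_perms \<sigma> p) = p" "\<forall>p\<in>Pos. join_perms \<sigma> (join_perms (\<lambda>j. inv (\<sigma> j)) p) = p"
      using permutes_inverses[OF assms] by (auto simp: join_perms_def)
    show "join_perms \<sigma> ` Pos \<subseteq> Pos" "join_perms (\<lambda>j. inv (\<sigma> j)) ` Pos \<subseteq> Pos"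
      using permutes_in_image[OF assms] permutes_in_image[OF permutes_inv[OF assms]] by (auto simp: join_perms_def)
  qed
  then have "join_perms \<sigma> permutes Pos"
    by (rule bij_imp_permutes) (use permutes_not_in[OF assms] in \<open>auto simp: join_perms_def\<close>)
  then show ?thesis by (simp add: perms_def join_perms_def split_def)
qed

lemma factor_perm_permutes:
  assumes "\<pi> \<in> perms"
  shows "factor_perm \<pi> j permutes {..<r * d j}"
proof -
  have eq: "join_perms (factor_perm \<pi>) = \<pi>" using perms_fst[OF assms] by (rule join_perms_factor_perm)
  have eq': "join_perms (factor_perm (inv \<pi>)) = inv \<pi>" using perms_fst[OF perms_inv[OF assms]] by (rule join_perms_factor_perm)
  have c: "\<pi> (inv \<pi> p) = p" "inv \<pi> (\<pi> p) = p" for p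
    using perms_inv_comp[OF assms] by (metis comp_apply id_apply)+
  have ap: "\<pi> (j, i) = (j, factor_perm \<pi> j i)" "inv \<pi> (j, i) = (j, factor_perm (inv \<pi>) j i)" for i
    using fun_cong[OF eq, of "(j, i)"] fun_cong[OF eq', of "(j, i)"] by (simp_all add: join_perms_def)
  have "bij_betw (factor_perm \<pi> j) {..<r * d j} {..<r * d j}"
  proof (rule bij_betw_byWitness[where f' = "factor_perm (inv \<pi>) j"])
    show "\<forall>i\<in>{..<r * d j}. factor_perm (inv \<pi>) j (factor_perm \<pi> j i) = i"
      "\<forall>i\<in>{..<r * d j}. factor_perm \<pi> j (factor_perm (inv \<pi>) j i) = i"
      using c[of "(j, _)"] by (auto simp: ap)
    show "factor_perm \<pi> j ` {..<r * d j} \<subseteq> {..<r * d j}"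
      using perms_mem[OF assms, of "(j, _)"] by (auto simp: ap)
    show "factor_perm (inv \<pi>) j ` {..<r * d j} \<subseteq> {..<r * d j}"
      using perms_mem[OF perms_inv[OF assms], of "(j, _)"] by (auto simp: ap)
  qed
  then show ?thesis
  proof (rule bij_imp_permutes)
    fix i assume "i \<notin> {..<r * d j}"
    then have n: "(j, i) \<notin> Pos" by simp
    have "\<pi> permutes Pos" using assms by (simp add: perms_def)
    then have "\<pi> (j, i) = (j, i)" by (rule permutes_not_in[OF _ n])
    then show "factor_perm \<pi> j i = i" by (simp add: factor_perm_def)
  qed
qed

text \<open>Every column contributes one transposition, and this to a single factor.\<close>

lemma sign_factor_perm_swap_columns:
  assumes a: "shape a" and T: "T \<subseteq> columns a"
  shows "(\<Prod>j\<in>UNIV. of_int (sign (factor_perm (swap_columns a T) j))) = ((- 1) ^ card T :: 'k)"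
proof -
  have "finite T" using T finite_columns finite_subset by blast
  then show ?thesis using T
  proof (induction T rule: finite_induct)
    case empty
    have "factor_perm (swap_columns a {}) j = id" for j
      by (auto simp: factor_perm_def swap_columns_empty)
    then show ?case by (simp add: sign_id)
  next
    case (insert x T)
    obtain j0 l where x: "x = (j0, l)" by (cases x)
    have T: "T \<subseteq> columns a" "{x} \<subseteq> columns a" using insert.prems by auto
    have l: "l < a j0" using T(2) by (simp add: x)
    have ex: "2 * a j0 \<le> r * d j0" using a by (simp add: shape_def)
    have "({x} - T) \<union> (T - {x}) = insert x T" using insert.hyps by auto
    then have "swap_columns a (insert x T) = swap_columns a {x} \<circ> swap_columns a T"
      using swap_columns_comp[OF a T(2,1)] by simp
    then have c: "factor_perm (swap_columns a (insert x T)) j = factor_perm (swap_columns a {x}) j \<circ> factor_perm (swap_columns a T) j" for j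
      using swap_columns_fst[of a T] by (auto simp: factor_perm_def fun_eq_iff) (metis fst_conv prod.collapse)
    have perm: "permutation (factor_perm (swap_columns a T') j)" if "T' \<subseteq> columns a" for T' j
      using factor_perm_permutes[OF swap_columns_perms[OF a that]] by (auto intro: permutation_permutes[THEN iffD2])
    define m where "m = r * d j0 - a j0 + l"
    have one: "factor_perm (swap_columns a {x}) j = (if j = j0 then transpose l m else id)" for j
    proof
      fix i
      show "factor_perm (swap_columns a {x}) j i = (if j = j0 then transpose l m else id) i"
        using l ex by (auto simp: factor_perm_def swap_columns_def x transpose_def m_def)
    qed
    have "l \<noteq> m" using l ex by (simp add: m_def)
    then have "of_int (sign (factor_perm (swap_columns a {x}) j)) = (if j = j0 then - 1 else 1 :: 'k)" for j
      unfolding one by (simp add: sign_swap_id sign_id)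
    then have "(\<Prod>j\<in>UNIV. of_int (sign (factor_perm (swap_columns a {x}) j))) = (- 1 :: 'k)"
      by (simp add: prod.delta)
    then show ?case
      using insert.IH[OF T(1)] insert.hyps
      unfolding c sign_compose[OF perm[OF T(2)] perm[OF T(1)]] by (simp add: prod.distrib)
  qed
qed

lemma swap_columns_inj:
  assumes "shape a"
  shows "inj_on (swap_columns a) (Pow (columns a))"
proof (rule inj_onI)
  fix T T' assume "T \<in> Pow (columns a)" "T' \<in> Pow (columns a)" "swap_columns a T = swap_columns a T'"
  then have "flip a T = flip a T'" using swap_columns_vimage[OF assms] by (metis PowD)
  then show "T = T'" using inj_flip[OF assms] \<open>T \<in> _\<close> \<open>T' \<in> _\<close> by (auto dest: inj_onD)
qed

end

locale two_row_shapes = segre_veronese scale V d r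
  for scale :: "'k::field_char_0 \<Rightarrow> 'v::ab_group_add \<Rightarrow> 'v"
    and V :: "'n::finite \<Rightarrow> 'v set" and d :: "'n \<Rightarrow> nat" and r :: nat +
  fixes lam :: "'n \<Rightarrow> nat list"
  assumes part: "\<And>j. partition_of (lam j) (r * d j)" and len: "\<And>j. length (lam j) \<le> 2"
begin

definition second :: "'n \<Rightarrow> nat" where
  "second j = nth_part (lam j) 2"

lemma shape_second: "shape second"
  using two_row_partition(2)[OF part len] by (simp add: shape_def second_def)

lemma sum_list_lam: "sum_list (lam j) = r * d j"
  by (rule two_row_partition(1)[OF part len])

lemma row_of_lam: "i < r * d j \<Longrightarrow> row_of (lam j) i = (if i < r * d j - second j then 0 else 1)"
  unfolding second_def by (rule two_row_partition(3)[OF part len])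

lemma col_of_lam: "i < r * d j \<Longrightarrow> col_of (lam j) i = (if i < r * d j - second j then i else i - (r * d j - second j))"
  unfolding second_def by (rule two_row_partition(4)[OF part len])

lemma row_group_lam: "row_group (lam j) =
  {\<sigma>. \<sigma> permutes {..<r * d j} \<and> (\<forall>i<r * d j. \<sigma> i < r * d j - second j \<longleftrightarrow> i < r * d j - second j)}"
proof -
  have "row_of (lam j) (\<sigma> i) = row_of (lam j) i \<longleftrightarrow> (\<sigma> i < r * d j - second j \<longleftrightarrow> i < r * d j - second j)"
    if "\<sigma> permutes {..<r * d j}" "i < r * d j" for \<sigma> i
    using permutes_in_image[OF that(1), of i] that(2) by (auto simp: row_of_lam)
  then show ?thesis unfolding row_group_def sum_list_lam by auto
qed

lemma row_families: "bij_betw join_perms {\<sigma>. \<forall>j. \<sigma> j \<in> row_group (lam j)} (stabilizer (bottom_row second))"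
proof (rule bij_betw_byWitness[where f' = factor_perm])
  show "\<forall>\<sigma>\<in>{\<sigma>. \<forall>j. \<sigma> j \<in> row_group (lam j)}. factor_perm (join_perms \<sigma>) = \<sigma>" by simp
  show "\<forall>\<pi>\<in>stabilizer (bottom_row second). join_perms (factor_perm \<pi>) = \<pi>"
    by (intro ballI join_perms_factor_perm perms_fst stabilizer_perms)
  show "join_perms ` {\<sigma>. \<forall>j. \<sigma> j \<in> row_group (lam j)} \<subseteq> stabilizer (bottom_row second)"
  proof (rule image_subsetI)
    fix \<sigma> assume "\<sigma> \<in> {\<sigma>. \<forall>j. \<sigma> j \<in> row_group (lam j)}"
    then have \<sigma>: "\<sigma> j permutes {..<r * d j}" "\<And>i. i < r * d j \<Longrightarrow> \<sigma> j i < r * d j - second j \<longleftrightarrow> i < r * d j - second j" for j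
      by (auto simp: row_group_lam)
    have "join_perms \<sigma> (j, i) \<in> bottom_row second \<longleftrightarrow> (j, i) \<in> bottom_row second" for j i
      using permutes_in_image[OF \<sigma>(1), of j i] \<sigma>(2)[of i j]
      by (auto simp: join_perms_def mem_bottom_row[OF shape_second])
    then show "join_perms \<sigma> \<in> stabilizer (bottom_row second)"
      using join_perms_perms[OF \<sigma>(1)] by (auto simp: stabilizer_def)
  qed
  show "factor_perm ` stabilizer (bottom_row second) \<subseteq> {\<sigma>. \<forall>j. \<sigma> j \<in> row_group (lam j)}"
  proof (rule image_subsetI, rule CollectI, rule allI)
    fix \<pi> j assume \<pi>: "\<pi> \<in> stabilizer (bottom_row second)"
    have p: "\<pi> \<in> perms" using \<pi> by (rule stabilizer_perms)
    have u: "\<pi> (j, i) = (j, factor_perm \<pi> j i)" for i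
      using perms_fst[OF p, of "(j, i)"] by (simp add: factor_perm_def prod_eq_iff)
    have "factor_perm \<pi> j i < r * d j - second j \<longleftrightarrow> i < r * d j - second j" if "i < r * d j" for i
    proof -
      have "(j, factor_perm \<pi> j i) \<in> bottom_row second \<longleftrightarrow> (j, i) \<in> bottom_row second"
        using \<pi> unfolding u[symmetric] by (simp add: stabilizer_def)
      then show ?thesis
        using that permutes_in_image[OF factor_perm_permutes[OF p, of j], of i]
        by (auto simp: mem_bottom_row[OF shape_second])
    qed
    then show "factor_perm \<pi> j \<in> row_group (lam j)"
      using factor_perm_permutes[OF p] by (auto simp: row_group_lam)
  qed
qed

text \<open>A column permutation fixes the boxes of columns of length one and fixes or exchanges the
  two boxes of any other column; \<open>T\<close> collects the exchanged columns of all
  factors.\<close>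

lemma col_families:
  "bij_betw (\<lambda>T. factor_perm (swap_columns second T)) (Pow (columns second)) {\<tau>. \<forall>j. \<tau> j \<in> col_group (lam j)}"
  unfolding bij_betw_def
proof (intro conjI equalityI subsetI)
  note a = shape_second
  have ex: "2 * second j \<le> r * d j" for j using a by (simp add: shape_def)
  show "inj_on (\<lambda>T. factor_perm (swap_columns second T)) (Pow (columns second))"
  proof (rule inj_onI)
    fix T T' assume T: "T \<in> Pow (columns second)" "T' \<in> Pow (columns second)"
      "factor_perm (swap_columns second T) = factor_perm (swap_columns second T')"
    then have "join_perms (factor_perm (swap_columns second T)) = join_perms (factor_perm (swap_columns second T'))" by simp
    then have "swap_columns second T = swap_columns second T'"
      by (simp add: join_perms_factor_perm swap_columns_fst)
    then show "T = T'" using swap_columns_inj[OF a] T by (auto dest: inj_onD)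
  qed
  show "\<tau> \<in> {\<tau>. \<forall>j. \<tau> j \<in> col_group (lam j)}" if \<tau>: "\<tau> \<in> (\<lambda>T. factor_perm (swap_columns second T)) ` Pow (columns second)" for \<tau>
  proof -
    obtain T where T: "T \<subseteq> columns second" "\<tau> = factor_perm (swap_columns second T)" using \<tau> by auto
    have "col_of (lam j) (\<tau> j i) = col_of (lam j) i" if i: "i < r * d j" for j i
    proof (cases rule: position_cases[of i second j])
      case top
      then show ?thesis
        using ex[of j] i by (simp add: T(2) factor_perm_def swap_columns_top[OF a T(1)] col_of_lam)
    next
      case middle
      then show ?thesis by (simp add: T(2) factor_perm_def swap_columns_middle[OF T(1)])
    next
      case (bottom k)
      have "\<tau> j i = (if (j, k) \<in> T then k else i)"
        unfolding bottom T(2) factor_perm_def swap_columns_bottom[OF a T(1)] by simp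
      moreover have "k < second j" using bottom i ex[of j] by simp
      then have "col_of (lam j) k = k" using ex[of j] col_of_lam[of k j] by simp
      moreover have "col_of (lam j) i = k" using i bottom col_of_lam[of i j] by simp
      ultimately show ?thesis by simp
    qed
    then show ?thesis
      using factor_perm_permutes[OF swap_columns_perms[OF a T(1)]] by (auto simp: col_group_def sum_list_lam T(2))
  qed
  show "\<tau> \<in> (\<lambda>T. factor_perm (swap_columns second T)) ` Pow (columns second)" if "\<tau> \<in> {\<tau>. \<forall>j. \<tau> j \<in> col_group (lam j)}" for \<tau>
  proof -
    have \<tau>: "\<tau> j permutes {..<r * d j}" "\<And>i. i < r * d j \<Longrightarrow> col_of (lam j) (\<tau> j i) = col_of (lam j) i" for j
      using that by (auto simp: col_group_def sum_list_lam)
    define T where "T = {(j, i). i < second j \<and> \<tau> j i \<noteq> i}"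
    have T: "T \<subseteq> columns second" by (auto simp: T_def)
    have mem_T: "(j, i) \<in> T \<longleftrightarrow> i < second j \<and> \<tau> j i \<noteq> i" for j i by (simp add: T_def)
    have lt: "\<tau> j i < r * d j \<longleftrightarrow> i < r * d j" for j i using permutes_in_image[OF \<tau>(1), of j i] by simp
    have inj: "\<tau> j i = \<tau> j i' \<longleftrightarrow> i = i'" for j i i' using permutes_inj[OF \<tau>(1), of j] by (auto dest: injD)
    have tau_top: "\<tau> j i = i \<or> \<tau> j i = r * d j - second j + i" if "i < second j" for j i
      using \<tau>(2)[of i j] lt[of j i] that ex[of j] by (auto simp: col_of_lam split: if_splits)
    have tau_bottom: "\<tau> j (r * d j - second j + k) = k \<or> \<tau> j (r * d j - second j + k) = r * d j - second j + k" if "k < second j" for j k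
      using \<tau>(2)[of "r * d j - second j + k" j] lt[of j "r * d j - second j + k"] that ex[of j]
      by (auto simp: col_of_lam split: if_splits)
    have "\<tau> j i = factor_perm (swap_columns second T) j i" for j i
    proof (cases rule: position_cases[of i second j])
      case top
      then show ?thesis
        using tau_top[of i j] by (auto simp: factor_perm_def swap_columns_top[OF a T] mem_T)
    next
      case middle
      then have "\<tau> j i = i"
        using \<tau>(2)[of i j] lt[of j i] ex[of j] by (auto simp: col_of_lam split: if_splits)
      then show ?thesis by (simp add: factor_perm_def swap_columns_middle[OF T middle])
    next
      case (bottom k)
      let ?p = "r * d j - second j"
      show ?thesis
      proof (cases "k < second j")
        case True
        have "\<tau> j (?p + k) = (if (j, k) \<in> T then k else ?p + k)"
        proof (cases "\<tau> j k = k")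
          case True
          then have "\<tau> j (?p + k) \<noteq> k" using inj[of j "?p + k" k] ex[of j] \<open>k < second j\<close> by auto
          then show ?thesis using True tau_bottom[of k j] \<open>k < second j\<close> by (auto simp: mem_T)
        next
          case False
          then have "\<tau> j k = ?p + k" using tau_top[of k j] \<open>k < second j\<close> by auto
          then have "\<tau> j (?p + k) \<noteq> ?p + k" using inj[of j "?p + k" k] ex[of j] \<open>k < second j\<close> by auto
          then show ?thesis using False tau_bottom[of k j] \<open>k < second j\<close> by (auto simp: mem_T)
        qed
        then show ?thesis by (simp add: bottom factor_perm_def swap_columns_bottom[OF a T])
      next
        case False
        then have "\<not> i < r * d j" using bottom ex[of j] by simp
        then have "\<tau> j i = i" using permutes_not_in[OF \<tau>(1), of i j] by simp
        then show ?thesis using False by (simp add: bottom factor_perm_def swap_columns_bottom[OF a T] mem_T)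
      qed
    qed
    then show ?thesis using T by (intro image_eqI[of _ _ T]) auto
  qed
qed

end

lemma PiE_UNIV_eq: "PiE UNIV A = {h. \<forall>j. h j \<in> A j}"
  by (auto simp: PiE_def extensional_def)

section \<open>Products over the factors and the group action on tensors\<close>

context segre_veronese
begin

text \<open>Each \<open>t j\<close> is a finite combination of pure tensors. Multiplied out, the
  product becomes a combination of products with one pure tensor per factor.\<close>

lemma prod_tensor_ten:
  assumes t: "\<And>j. t j \<in> tensor_power scale (V j) (r * d j)"
  shows "(\<lambda>x. \<Prod>j\<in>UNIV. t j (x j)) \<in> ten"
proof -
  let ?G = "\<lambda>j. {pure_tensor scale (V j) vs | vs. length vs = r * d j \<and> set vs \<subseteq> V j}"
  have ex: "\<forall>j. \<exists>S u. finite S \<and> S \<subseteq> ?G j \<and> t j = (\<Sum>g\<in>S. fscale (u g) g)"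
  proof
    fix j
    have "t j \<in> fspan (?G j)" using t[of j] by (simp only: tensor_power_def)
    then obtain S u where "finite S" "S \<subseteq> ?G j" "t j = (\<Sum>g\<in>S. fscale (u g) g)"
      unfolding fs.span_explicit by (elim CollectE exE conjE)
    then show "\<exists>S u. finite S \<and> S \<subseteq> ?G j \<and> t j = (\<Sum>g\<in>S. fscale (u g) g)"
      by (intro exI conjI)
  qed
  from choice[OF ex] obtain S where "\<forall>j. \<exists>u. finite (S j) \<and> S j \<subseteq> ?G j \<and> t j = (\<Sum>g\<in>S j. fscale (u g) g)" ..
  from choice[OF this] obtain u where "\<forall>j. finite (S j) \<and> S j \<subseteq> ?G j \<and> t j = (\<Sum>g\<in>S j. fscale (u j g) g)" ..
  then have S: "\<And>j. finite (S j)" "\<And>j. S j \<subseteq> ?G j" "\<And>j. t j = (\<Sum>g\<in>S j. fscale (u j g) g)"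
    by blast+
  have "(\<Prod>j\<in>UNIV. t j (x j)) = (\<Sum>h\<in>PiE UNIV S. (\<Prod>j\<in>UNIV. u j (h j)) * (\<Prod>j\<in>UNIV. h j (x j)))" for x
  proof -
    have "(\<Prod>j\<in>UNIV. t j (x j)) = (\<Prod>j\<in>UNIV. \<Sum>g\<in>S j. u j g * g (x j))"
      by (subst S(3)) (simp add: fun_apply)
    also have "\<dots> = (\<Sum>h\<in>PiE UNIV S. \<Prod>j\<in>UNIV. u j (h j) * h j (x j))"
      using S(1) by (intro prod_sum_PiE) auto
    finally show ?thesis by (simp add: prod.distrib)
  qed
  then have "(\<lambda>x. \<Prod>j\<in>UNIV. t j (x j)) = (\<Sum>h\<in>PiE UNIV S. fscale (\<Prod>j\<in>UNIV. u j (h j)) (\<lambda>x. \<Prod>j\<in>UNIV. h j (x j)))"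
    by (simp add: fun_eq_iff fun_apply)
  also have "\<dots> \<in> ten"
  proof (intro ten_sum ten_scale)
    fix h assume "h \<in> PiE UNIV S"
    then have "\<exists>vs. h j = pure_tensor scale (V j) vs \<and> length vs = r * d j \<and> set vs \<subseteq> V j" for j
      using S(2)[of j] by (fastforce simp: PiE_UNIV_eq)
    then obtain vs where vs: "\<And>j. h j = pure_tensor scale (V j) (vs j)" "\<And>j. length (vs j) = r * d j" "\<And>j. set (vs j) \<subseteq> V j"
      by metis
    define v where "v = (\<lambda>(j, i). vs j ! i)"
    have "map (\<lambda>i. v (j, i)) [0..<r * d j] = vs j" for j
      using vs(2)[of j] by (auto simp: v_def intro!: nth_equalityI)
    then have "(\<lambda>x. \<Prod>j\<in>UNIV. h j (x j)) = pure v" by (simp add: pure_eq vs(1))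
    moreover have "v \<in> vectors" using vs(2,3) by (auto simp: vectors_def v_def subset_eq)
    ultimately show "(\<lambda>x. \<Prod>j\<in>UNIV. h j (x j)) \<in> ten" using pure_ten by simp
  qed
  finally show ?thesis .
qed

lemma tensor_power_off:
  assumes "t \<in> tensor_power scale (V j) k" "\<not> (length \<phi>s = k \<and> set \<phi>s \<subseteq> dual j)"
  shows "t \<phi>s = 0"
  using assms(1) unfolding tensor_power_def
proof (induction rule: fs.span_induct_alt)
  case base
  show ?case by (simp add: fun_apply)
next
  case (step c x y)
  then obtain vs where vs: "x = pure_tensor scale (V j) vs" "length vs = k" by auto
  have "\<not> (length \<phi>s = length vs \<and> set \<phi>s \<subseteq> dual j)" using assms(2) unfolding vs(2) .
  then have "x \<phi>s = 0" unfolding vs(1) pure_tensor_def by (rule if_not_P)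
  then show ?case using step by (simp add: fun_apply)
qed

lemma GL_closed:
  assumes "g \<in> GL scale (V j)"
  shows "v \<in> V j \<Longrightarrow> g v \<in> V j" "v \<notin> V j \<Longrightarrow> g v = v"
    "v \<in> V j \<Longrightarrow> w \<in> V j \<Longrightarrow> g (v + w) = g v + g w" "v \<in> V j \<Longrightarrow> g (scale c v) = scale c (g v)"
  using assms by (auto simp: GL_def bij_betw_def)

text \<open>The implication from left to right uses that \<open>g\<close> maps \<open>V j\<close>
  onto itself and is the identity outside. It is what keeps arguments outside \<open>tuples\<close>
  outside, so that the action preserves vanishing there.\<close>

lemma dual_comp_GL:
  assumes g: "g \<in> GL scale (V j)"
  shows "\<phi> \<circ> g \<in> dual j \<longleftrightarrow> \<phi> \<in> dual j"
proof
  assume "\<phi> \<in> dual j"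
  then show "\<phi> \<circ> g \<in> dual j"
    using GL_closed[OF g] unfolding dual_space_def by auto
next
  assume h: "\<phi> \<circ> g \<in> dual j"
  have surj: "\<exists>v'\<in>V j. v = g v'" if "v \<in> V j" for v
    using g that by (auto simp: GL_def bij_betw_def)
  show "\<phi> \<in> dual j"
    unfolding dual_space_def
  proof (intro CollectI conjI ballI allI impI)
    fix v w assume "v \<in> V j" "w \<in> V j"
    then obtain v' w' where vw: "v' \<in> V j" "w' \<in> V j" "v = g v'" "w = g w'" using surj by meson
    then have "\<phi> (v + w) = (\<phi> \<circ> g) (v' + w')" by (simp add: GL_closed[OF g])
    then show "\<phi> (v + w) = \<phi> v + \<phi> w" using h vw by (simp add: dual_space_def)
  next
    fix c v assume "v \<in> V j"
    then obtain v' where v': "v' \<in> V j" "v = g v'" using surj by meson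
    then have "\<phi> (scale c v) = (\<phi> \<circ> g) (scale c v')" by (simp add: GL_closed[OF g])
    then show "\<phi> (scale c v) = c * \<phi> v" using h v' by (simp add: dual_space_def)
  next
    fix v assume v: "v \<notin> V j"
    then have "(\<phi> \<circ> g) v = 0" using h by (simp add: dual_space_def)
    then show "\<phi> v = 0" using GL_closed(2)[OF g v] by simp
  qed
qed

lemma covectors_GL:
  assumes "g \<in> GL_prod scale V" "\<phi> \<in> covectors"
  shows "(\<lambda>p. \<phi> p \<circ> g (fst p)) \<in> covectors"
  using assms dual_comp_GL by (auto simp: GL_prod_def covectors_def)

lemma ev_tensor_act: "ev (tensor_act g A) \<phi> = ev A (\<lambda>p. \<phi> p \<circ> g (fst p))"
  by (simp add: ev_def tensor_act_def tup_def comp_def)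

lemma tensor_act_off:
  assumes "g \<in> GL_prod scale V" "\<And>x. x \<notin> tuples \<Longrightarrow> A x = 0" "x \<notin> tuples"
  shows "tensor_act g A x = 0"
proof -
  have "(\<lambda>j. map (\<lambda>\<phi>. \<phi> \<circ> g j) (x j)) \<notin> tuples"
    using assms(1,3) dual_comp_GL by (fastforce simp: GL_prod_def tuples_def)
  then show ?thesis using assms(2) by (simp add: tensor_act_def)
qed

lemma tensor_act_ten:
  assumes g: "g \<in> GL_prod scale V" and A: "A \<in> ten"
  shows "tensor_act g A \<in> ten"
  using A
proof (induction rule: ten_induct)
  case zero
  have "tensor_act g 0 = (0 :: ('n \<Rightarrow> ('v \<Rightarrow> 'k) list) \<Rightarrow> 'k)" by (auto simp: tensor_act_def fun_eq_iff fun_apply)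
  then show ?case by (simp add: ten_zero)
next
  case (step c v A)
  have eq: "tensor_act g (fscale c (pure v) + A) = fscale c (tensor_act g (pure v)) + tensor_act g A"
    by (auto simp: tensor_act_def fun_eq_iff fun_apply)
  have "tensor_act g (pure v) = pure (\<lambda>p. g (fst p) (v p))"
  proof (rule ten_ext)
    show "ev (tensor_act g (pure v)) \<phi> = ev (pure (\<lambda>p. g (fst p) (v p))) \<phi>" if "\<phi> \<in> covectors" for \<phi>
      using that by (simp add: ev_tensor_act ev_pure covectors_GL[OF g])
    show "tensor_act g (pure v) x = 0" if "x \<notin> tuples" for x
      using that by (rule tensor_act_off[OF g, rotated]) (simp add: pure_def)
  qed (simp add: pure_def)
  moreover have "(\<lambda>p. g (fst p) (v p)) \<in> vectors"
    using g step(1) GL_closed(1) by (fastforce simp: vectors_def GL_prod_def)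
  ultimately show ?case using step eq by (auto intro!: ten_add ten_scale pure_ten)
qed

lemma tensor_act_schur_space:
  assumes g: "g \<in> GL_prod scale V" and a: "shape a" and A: "A \<in> schur_space a"
  shows "tensor_act g A \<in> schur_space a"
proof -
  obtain B where B: "A = symmetrize a B" "B \<in> ten" using A by (auto simp: schur_space_def)
  have "tensor_act g (symmetrize a B) = symmetrize a (tensor_act g B)"
  proof (rule ten_ext)
    show "tensor_act g (symmetrize a B) x = 0" if "x \<notin> tuples" for x
      using that by (rule tensor_act_off[OF g, rotated]) (rule ten_off[OF symmetrize_ten[OF a B(2)]])
    show "symmetrize a (tensor_act g B) x = 0" if "x \<notin> tuples" for x
      by (rule ten_off[OF symmetrize_ten[OF a tensor_act_ten[OF g B(2)]] that])
    fix \<phi> assume \<phi>: "\<phi> \<in> covectors"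
    have "ev B ((\<lambda>p. \<phi> p \<circ> g (fst p)) \<circ> swap_columns a T \<circ> \<sigma>) =
      ev (tensor_act g B) (\<phi> \<circ> swap_columns a T \<circ> \<sigma>)"
      if "T \<in> Pow (columns a)" "\<sigma> \<in> stabilizer (bottom_row a)" for T \<sigma>
      using that perms_fst[OF stabilizer_perms[OF that(2)]]
      by (simp add: ev_tensor_act comp_def swap_columns_fst)
    then show "ev (tensor_act g (symmetrize a B)) \<phi> = ev (symmetrize a (tensor_act g B)) \<phi>"
      unfolding ev_tensor_act ev_symmetrize[OF a covectors_GL[OF g \<phi>]] ev_symmetrize[OF a \<phi>]
      by (intro sum.cong refl) (simp add: ev_tensor_act)
  qed
  then show ?thesis using B tensor_act_ten[OF g] by (auto simp: schur_space_def)
qed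

end

context two_row_shapes
begin

text \<open>Multiplying out the sums of the factors gives sums over families of row and column
  permutations. \<open>row_families\<close> and \<open>col_families\<close> turn them into the
  stabilizer and the subsets of columns, and the signs multiply to
  \<open>(- 1) ^ card T\<close>.\<close>

lemma prod_young_symmetrizer:
  assumes t: "\<And>j. t j \<in> tensor_power scale (V j) (r * d j)"
  shows "(\<lambda>x. \<Prod>j\<in>UNIV. young_symmetrizer (lam j) (t j) (x j)) = symmetrize second (\<lambda>x. \<Prod>j\<in>UNIV. t j (x j))"
proof (rule ten_ext)
  let ?B = "\<lambda>x. \<Prod>j\<in>UNIV. t j (x j)"
  have perm: "\<sigma> permutes {..<r * d j}" if "\<sigma> \<in> row_group (lam j) \<or> \<sigma> \<in> col_group (lam j)" for \<sigma> j
    using that by (auto simp: row_group_def col_group_def sum_list_lam)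
  show "symmetrize second ?B x = 0" if "x \<notin> tuples" for x
    by (rule ten_off[OF symmetrize_ten[OF shape_second prod_tensor_ten[OF t]] that])
  show "(\<Prod>j\<in>UNIV. young_symmetrizer (lam j) (t j) (x j)) = 0" if x: "x \<notin> tuples" for x
  proof -
    obtain j where j: "\<not> (length (x j) = r * d j \<and> set (x j) \<subseteq> dual j)" using x by (auto simp: tuples_def)
    have "t j (permute_list (\<tau> \<circ> \<sigma>) (x j)) = 0" if "\<sigma> \<in> row_group (lam j)" "\<tau> \<in> col_group (lam j)" for \<sigma> \<tau>
    proof (rule tensor_power_off[OF t])
      have "set (permute_list (\<tau> \<circ> \<sigma>) (x j)) = set (x j)" if "length (x j) = r * d j"
      proof (rule set_permute_list)
        show "\<tau> \<circ> \<sigma> permutes {..<length (x j)}"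
          unfolding that using perm \<open>\<sigma> \<in> _\<close> \<open>\<tau> \<in> _\<close> by (intro permutes_compose) auto
      qed
      then show "\<not> (length (permute_list (\<tau> \<circ> \<sigma>) (x j)) = r * d j \<and> set (permute_list (\<tau> \<circ> \<sigma>) (x j)) \<subseteq> dual j)"
        using j by auto
    qed
    then have "young_symmetrizer (lam j) (t j) (x j) = 0" by (simp add: young_symmetrizer_def)
    then show ?thesis by (intro prod_zero) auto
  qed
  fix \<phi> assume \<phi>: "\<phi> \<in> covectors"
  let ?R = "\<lambda>j. row_group (lam j)" and ?C = "\<lambda>j. col_group (lam j)"
  have finR: "finite (?R j)" and finC: "finite (?C j)" for j
    by (auto simp: row_group_def col_group_def intro: finite_subset[OF _ finite_permutations[of "{..<sum_list (lam j)}"]])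
  let ?s = "\<lambda>\<sigma> \<tau> j. of_int (sign (\<tau> j)) * t j (map (\<lambda>i. \<phi> (j, \<tau> j (\<sigma> j i))) [0..<r * d j])"
  have "ev (\<lambda>x. \<Prod>j\<in>UNIV. young_symmetrizer (lam j) (t j) (x j)) \<phi> =
    (\<Prod>j\<in>UNIV. \<Sum>\<sigma>\<in>?R j. \<Sum>\<tau>\<in>?C j. of_int (sign \<tau>) * t j (map (\<lambda>i. \<phi> (j, \<tau> (\<sigma> i))) [0..<r * d j]))"
  proof -
    have "permute_list (\<tau> \<circ> \<sigma>) (map (\<lambda>i. \<phi> (j, i)) [0..<r * d j]) = map (\<lambda>i. \<phi> (j, \<tau> (\<sigma> i))) [0..<r * d j]"
      if "\<sigma> \<in> ?R j" "\<tau> \<in> ?C j" for \<sigma> \<tau> j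
    proof -
      have "(\<tau> \<circ> \<sigma>) i < r * d j" if "i < r * d j" for i
        using permutes_in_image[OF perm, of \<sigma> j i] permutes_in_image[OF perm, of \<tau> j "\<sigma> i"] that
          \<open>\<sigma> \<in> _\<close> \<open>\<tau> \<in> _\<close> by simp
      then show ?thesis by (auto simp: permute_list_def)
    qed
    then show ?thesis by (simp add: ev_def tup_def young_symmetrizer_def)
  qed
  also have "\<dots> = (\<Sum>\<sigma>\<in>PiE UNIV ?R. \<Prod>j\<in>UNIV. \<Sum>\<tau>\<in>?C j. of_int (sign \<tau>) * t j (map (\<lambda>i. \<phi> (j, \<tau> (\<sigma> j i))) [0..<r * d j]))"
    using finR by (intro prod_sum_PiE) auto
  also have "\<dots> = (\<Sum>\<sigma>\<in>PiE UNIV ?R. \<Sum>\<tau>\<in>PiE UNIV ?C. \<Prod>j\<in>UNIV. ?s \<sigma> \<tau> j)"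
    by (rule sum.cong[OF refl], rule prod_sum_PiE) (use finC in auto)
  also have "\<dots> = (\<Sum>\<sigma>\<in>PiE UNIV ?R. \<Sum>\<tau>\<in>PiE UNIV ?C. (\<Prod>j\<in>UNIV. of_int (sign (\<tau> j))) * ev ?B (\<phi> \<circ> join_perms \<tau> \<circ> join_perms \<sigma>))"
    by (simp add: prod.distrib ev_def tup_def join_perms_def)
  also have "\<dots> = (\<Sum>\<sigma>\<in>PiE UNIV ?R. \<Sum>T\<in>Pow (columns second). (- 1) ^ card T * ev ?B (\<phi> \<circ> swap_columns second T \<circ> join_perms \<sigma>))"
  proof (rule sum.cong[OF refl])
    fix \<sigma>
    have "(\<Sum>\<tau>\<in>PiE UNIV ?C. (\<Prod>j\<in>UNIV. of_int (sign (\<tau> j))) * ev ?B (\<phi> \<circ> join_perms \<tau> \<circ> join_perms \<sigma>)) =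
      (\<Sum>T\<in>Pow (columns second). (\<Prod>j\<in>UNIV. of_int (sign (factor_perm (swap_columns second T) j))) *
        ev ?B (\<phi> \<circ> join_perms (factor_perm (swap_columns second T)) \<circ> join_perms \<sigma>))"
      unfolding PiE_UNIV_eq by (rule sum.reindex_bij_betw[OF col_families, symmetric])
    also have "\<dots> = (\<Sum>T\<in>Pow (columns second). (- 1) ^ card T * ev ?B (\<phi> \<circ> swap_columns second T \<circ> join_perms \<sigma>))"
    proof (rule sum.cong[OF refl])
      fix T assume "T \<in> Pow (columns second)"
      then have "(\<Prod>j\<in>UNIV. of_int (sign (factor_perm (swap_columns second T) j))) = ((- 1) ^ card T :: 'k)"
        using sign_factor_perm_swap_columns[OF shape_second] by simp
      moreover have "join_perms (factor_perm (swap_columns second T)) = swap_columns second T"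
        by (rule join_perms_factor_perm) (rule swap_columns_fst)
      ultimately show "(\<Prod>j\<in>UNIV. of_int (sign (factor_perm (swap_columns second T) j))) *
        ev ?B (\<phi> \<circ> join_perms (factor_perm (swap_columns second T)) \<circ> join_perms \<sigma>) =
        (- 1) ^ card T * ev ?B (\<phi> \<circ> swap_columns second T \<circ> join_perms \<sigma>)" by (simp only:)
    qed
    finally show "(\<Sum>\<tau>\<in>PiE UNIV ?C. (\<Prod>j\<in>UNIV. of_int (sign (\<tau> j))) * ev ?B (\<phi> \<circ> join_perms \<tau> \<circ> join_perms \<sigma>)) =
      (\<Sum>T\<in>Pow (columns second). (- 1) ^ card T * ev ?B (\<phi> \<circ> swap_columns second T \<circ> join_perms \<sigma>))" .
  qed
  also have "\<dots> = (\<Sum>\<sigma>\<in>stabilizer (bottom_row second). \<Sum>T\<in>Pow (columns second). (- 1) ^ card T * ev ?B (\<phi> \<circ> swap_columns second T \<circ> \<sigma>))"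
    unfolding PiE_UNIV_eq by (rule sum.reindex_bij_betw[OF row_families])
  also have "\<dots> = ev (symmetrize second ?B) \<phi>"
    by (subst sum.swap) (simp add: ev_symmetrize[OF shape_second \<phi>])
  finally show "ev (\<lambda>x. \<Prod>j\<in>UNIV. young_symmetrizer (lam j) (t j) (x j)) \<phi> = ev (symmetrize second ?B) \<phi>" .
qed

lemma schur_tensor_eq: "schur_tensor scale V lam = schur_space second"
proof
  let ?G = "{\<lambda>x. \<Prod>j\<in>UNIV. T j (x j) | T. \<forall>j. T j \<in> schur scale (lam j) (V j)}"
  have sub: "fs.subspace (schur_space second)"
    by (rule fs.subspaceI) (auto intro: schur_space_zero schur_space_add schur_space_scale)
  have "?G \<subseteq> schur_space second"
  proof
    fix A assume "A \<in> ?G"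
    then obtain T where T: "A = (\<lambda>x. \<Prod>j\<in>UNIV. T j (x j))" "\<forall>j. T j \<in> schur scale (lam j) (V j)" by auto
    then have "\<forall>j. \<exists>t. T j = young_symmetrizer (lam j) t \<and> t \<in> tensor_power scale (V j) (r * d j)"
      by (auto simp: schur_def sum_list_lam)
    then obtain t where t: "\<And>j. T j = young_symmetrizer (lam j) (t j)" "\<And>j. t j \<in> tensor_power scale (V j) (r * d j)"
      by metis
    show "A \<in> schur_space second"
      unfolding T(1) t(1) prod_young_symmetrizer[OF t(2)] schur_space_def
      by (intro imageI prod_tensor_ten t(2))
  qed
  then show "schur_tensor scale V lam \<subseteq> schur_space second"
    unfolding schur_tensor_def using sub by (rule fs.span_minimal)
  show "schur_space second \<subseteq> schur_tensor scale V lam"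
    unfolding schur_space_def
  proof (rule image_subsetI)
    fix B assume "B \<in> ten"
    then show "symmetrize second B \<in> schur_tensor scale V lam"
    proof (induction rule: ten_induct)
      case zero
      have "symmetrize second 0 = fscale 0 (symmetrize second 0)"
        unfolding symmetrize_scale[symmetric] by simp
      then have "symmetrize second 0 = 0" by (simp only: fs.scale_zero_left)
      then show ?case unfolding schur_tensor_def by (simp add: fs.span_zero)
    next
      case (step c v A)
      let ?t = "\<lambda>j. pure_tensor scale (V j) (map (\<lambda>i. v (j, i)) [0..<r * d j])"
      have t: "?t j \<in> tensor_power scale (V j) (r * d j)" for j
      proof -
        let ?vs = "map (\<lambda>i. v (j, i)) [0..<r * d j]"
        have vs: "set ?vs \<subseteq> V j" "length ?vs = r * d j" using step(1) by (auto simp: vectors_def Pos_def)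
        show ?thesis
          unfolding tensor_power_def
          by (rule fs.span_base, rule CollectI, rule exI[of _ ?vs]) (use vs in blast)
      qed
      have "symmetrize second (pure v) = (\<lambda>x. \<Prod>j\<in>UNIV. young_symmetrizer (lam j) (?t j) (x j))"
        unfolding pure_eq by (rule prod_young_symmetrizer[OF t, symmetric])
      also have "\<dots> \<in> schur_tensor scale V lam"
        unfolding schur_tensor_def
      proof (rule fs.span_base)
        have "\<forall>j. young_symmetrizer (lam j) (?t j) \<in> schur scale (lam j) (V j)"
          unfolding schur_def sum_list_lam using t by blast
        then show "(\<lambda>x. \<Prod>j\<in>UNIV. young_symmetrizer (lam j) (?t j) (x j)) \<in> ?G"
          by (intro CollectI exI[of _ "\<lambda>j. young_symmetrizer (lam j) (?t j)"] conjI refl)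
      qed
      finally show ?case using step(3) unfolding schur_tensor_def symmetrize_add symmetrize_scale
        by (intro fs.span_add fs.span_scale)
    qed
  qed
qed

end

section \<open>Polynomials on the tangential cone\<close>

lemma dual_fspan_sum:
  assumes "l \<in> dual_space fscale (fspan G)" "\<And>i. i \<in> I \<Longrightarrow> F i \<in> fspan G"
  shows "l (\<Sum>i\<in>I. fscale (c i) (F i)) = (\<Sum>i\<in>I. c i * l (F i))"
  using assms(2)
proof (induction I rule: infinite_finite_induct)
  case (insert i I)
  have "(\<Sum>i\<in>I. fscale (c i) (F i)) \<in> fspan G" "fscale (c i) (F i) \<in> fspan G"
    using insert by (auto intro!: fs.span_sum fs.span_scale)
  then show ?case using insert assms(1) by (simp add: dual_space_def)
next
  have "l (fscale 0 0) = 0 * l 0" using assms(1) fs.span_zero unfolding dual_space_def by blast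
  then have l0: "l 0 = 0" by (simp only: fs.scale_zero_left mult_zero_left)
  { case (infinite I) then show ?case using l0 by simp }
  { case empty then show ?case using l0 by simp }
qed

context segre_veronese
begin

abbreviation Y :: "(('n \<Rightarrow> 'v) \<Rightarrow> 'k) set" where
  "Y \<equiv> sym_tensor scale V d"

text \<open>The positions of a single block: products of linear forms of multidegree
  \<open>d\<close> have one linear form for each slot.\<close>

definition slots :: "('n \<times> nat) set" where
  "slots = (SIGMA j:UNIV. {..<d j})"

lemma finite_slots [simp]: "finite slots"
  by (simp add: slots_def)

lemma mem_slots [simp]: "(j, i) \<in> slots \<longleftrightarrow> i < d j"
  by (simp add: slots_def)

definition form_tensor :: "('n \<times> nat \<Rightarrow> 'v \<Rightarrow> 'k) \<Rightarrow> ('n \<Rightarrow> 'v) \<Rightarrow> 'k" where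
  "form_tensor \<phi> = (\<lambda>v. \<Prod>q\<in>slots. \<phi> q (v (fst q)))"

lemma form_tensor_mem:
  assumes "\<And>q. q \<in> slots \<Longrightarrow> \<phi> q \<in> dual (fst q)"
  shows "form_tensor \<phi> \<in> Y"
proof -
  define \<psi> where "\<psi> j i = (if i < d j then \<phi> (j, i) else (\<lambda>_. 0))" for j i
  have "form_tensor \<phi> = (\<lambda>v. \<Prod>j\<in>UNIV. \<Prod>i<d j. \<psi> j i (v j))"
    by (simp add: form_tensor_def slots_def prod.Sigma split_def \<psi>_def)
  moreover have "\<forall>j i. \<psi> j i \<in> dual j" using assms dual_zero by (force simp: \<psi>_def)
  ultimately show ?thesis unfolding sym_tensor_def by (intro fs.span_base) blast
qed

text \<open>
  With the factor \<open>d\<^sub>j\<close> each of the \<open>d\<^sub>j\<close> positions of the factor \<open>j\<close> contributes one term; since \<open>d\<^sub>j\<close> is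
  invertible, the cone does not change.
\<close>

definition tangent :: "('n \<Rightarrow> 'v \<Rightarrow> 'k) \<Rightarrow> ('n \<Rightarrow> 'v \<Rightarrow> 'k) \<Rightarrow> ('n \<Rightarrow> 'v) \<Rightarrow> 'k" where
  "tangent e f = tangent_vector d e (\<lambda>j v. of_nat (d j) * f j v)"

lemma tangent_eq: "tangent e f = (\<Sum>p\<in>slots. form_tensor (pattern e f {p}))"
proof
  fix v :: "'n \<Rightarrow> 'v"
  have "(\<Prod>q\<in>slots. pattern e f {(j, i)} q (v (fst q))) =
    e j (v j) ^ (d j - 1) * f j (v j) * (\<Prod>j'\<in>UNIV - {j}. e j' (v j') ^ d j')" if i: "i < d j" for j i
  proof -
    have "(\<Prod>q\<in>slots. pattern e f {(j, i)} q (v (fst q))) =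
      (\<Prod>j'\<in>UNIV. \<Prod>i'<d j'. if j' = j \<and> i' = i then f j (v j) else e j' (v j'))"
      by (simp add: slots_def prod.Sigma split_def) (auto simp: pattern_def intro!: prod.cong)
    also have "\<dots> = (\<Prod>i'<d j. if i' = i then f j (v j) else e j (v j)) *
      (\<Prod>j'\<in>UNIV - {j}. \<Prod>i'<d j'. if j' = j \<and> i' = i then f j (v j) else e j' (v j'))"
      by (subst prod.remove[of _ j]) auto
    also have "(\<Prod>j'\<in>UNIV - {j}. \<Prod>i'<d j'. if j' = j \<and> i' = i then f j (v j) else e j' (v j')) =
      (\<Prod>j'\<in>UNIV - {j}. e j' (v j') ^ d j')"
      by (intro prod.cong) auto
    also have "(\<Prod>i'<d j. if i' = i then f j (v j) else e j (v j)) = f j (v j) * e j (v j) ^ (d j - 1)"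
    proof -
      have "(\<Prod>i'<d j. if i' = i then f j (v j) else e j (v j)) = f j (v j) * (\<Prod>i'\<in>{..<d j} - {i}. e j (v j))"
        using i by (subst prod.remove[of _ i]) (auto intro!: prod.cong)
      then show ?thesis using i by simp
    qed
    finally show ?thesis by (simp add: mult_ac)
  qed
  note slot = this
  have sum_slots: "(\<Sum>p\<in>slots. G p) = (\<Sum>j\<in>UNIV. \<Sum>i<d j. G (j, i))" for G :: "'n \<times> nat \<Rightarrow> 'k"
    by (simp add: slots_def sum.Sigma split_def)
  have "(\<Sum>p\<in>slots. form_tensor (pattern e f {p}) v) = (\<Sum>j\<in>UNIV. \<Sum>i<d j.
    e j (v j) ^ (d j - 1) * f j (v j) * (\<Prod>j'\<in>UNIV - {j}. e j' (v j') ^ d j'))"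
    unfolding sum_slots form_tensor_def by (intro sum.cong refl slot) simp
  also have "\<dots> = tangent e f v"
    by (simp add: tangent_def tangent_vector_def algebra_simps)
  finally show "tangent e f v = (\<Sum>p\<in>slots. form_tensor (pattern e f {p})) v" by (simp add: fun_apply)
qed

lemma pattern_slots: "e \<in> duals \<Longrightarrow> f \<in> duals \<Longrightarrow> pattern e f S q \<in> dual (fst q)"
  by (simp add: pattern_def duals_def)

lemma tangent_mem: "e \<in> duals \<Longrightarrow> f \<in> duals \<Longrightarrow> tangent e f \<in> Y"
  unfolding tangent_eq sym_tensor_def
  by (intro fs.span_sum form_tensor_mem[unfolded sym_tensor_def] pattern_slots)

text \<open>The coordinates of a covector in the dual basis are its values on the basis vectors. So
  expanding the argument of \<open>l\<close> produces evaluations at basis vectors, which is how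
  pure tensors of basis vectors act on covectors.\<close>

lemma linear_form_expand:
  assumes l: "l \<in> dual_space fscale Y"
    and B: "\<And>j. finite (B j)" "\<And>j x. x \<in> B j \<Longrightarrow> b j x \<in> dual j"
      "\<And>j \<phi> v. \<phi> \<in> dual j \<Longrightarrow> \<phi> v = (\<Sum>x\<in>B j. \<phi> x * b j x v)"
    and ef: "e \<in> duals" "f \<in> duals"
  shows "l (tangent e f) = (\<Sum>h\<in>PiE slots (\<lambda>q. B (fst q)). l (form_tensor (\<lambda>q. b (fst q) (h q))) *
    (\<Sum>p\<in>slots. \<Prod>q\<in>slots. pattern e f {p} q (h q)))"
proof -
  let ?H = "PiE slots (\<lambda>q. B (fst q))"
  have mem: "form_tensor (\<lambda>q. b (fst q) (h q)) \<in> Y" if "h \<in> ?H" for h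
    using that B(2) by (intro form_tensor_mem) (auto simp: PiE_def Pi_def)
  have "form_tensor \<phi> v = (\<Sum>h\<in>?H. (\<Prod>q\<in>slots. \<phi> q (h q)) * form_tensor (\<lambda>q. b (fst q) (h q)) v)"
    if \<phi>: "\<And>q. q \<in> slots \<Longrightarrow> \<phi> q \<in> dual (fst q)" for \<phi> v
  proof -
    have "form_tensor \<phi> v = (\<Prod>q\<in>slots. \<Sum>x\<in>B (fst q). \<phi> q x * b (fst q) x (v (fst q)))"
      unfolding form_tensor_def by (rule prod.cong[OF refl]) (use B(3)[OF \<phi>] in blast)
    also have "\<dots> = (\<Sum>h\<in>?H. \<Prod>q\<in>slots. \<phi> q (h q) * b (fst q) (h q) (v (fst q)))"
      using B(1) by (intro prod_sum_PiE) auto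
    finally show ?thesis by (simp add: prod.distrib form_tensor_def)
  qed
  then have "form_tensor (pattern e f {p}) = (\<Sum>h\<in>?H. fscale (\<Prod>q\<in>slots. pattern e f {p} q (h q)) (form_tensor (\<lambda>q. b (fst q) (h q))))" for p
    using pattern_slots[OF ef] by (simp add: fun_eq_iff fun_apply)
  then have 1: "l (form_tensor (pattern e f {p})) = (\<Sum>h\<in>?H. (\<Prod>q\<in>slots. pattern e f {p} q (h q)) * l (form_tensor (\<lambda>q. b (fst q) (h q))))" for p
    using dual_fspan_sum[OF l[unfolded sym_tensor_def] mem[unfolded sym_tensor_def], of ?H] by simp
  have "l (tangent e f) = l (\<Sum>p\<in>slots. fscale 1 (form_tensor (pattern e f {p})))"
    by (simp add: tangent_eq)
  also have "\<dots> = (\<Sum>p\<in>slots. 1 * l (form_tensor (pattern e f {p})))"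
    by (rule dual_fspan_sum[OF l[unfolded sym_tensor_def]])
      (intro form_tensor_mem[unfolded sym_tensor_def] pattern_slots[OF ef])
  also have "\<dots> = (\<Sum>h\<in>?H. \<Sum>p\<in>slots. (\<Prod>q\<in>slots. pattern e f {p} q (h q)) * l (form_tensor (\<lambda>q. b (fst q) (h q))))"
    unfolding 1 mult_1 by (rule sum.swap)
  finally show ?thesis by (simp add: sum_distrib_left sum_distrib_right mult.commute)
qed

definition block :: "('n \<times> nat \<Rightarrow> nat) \<Rightarrow> nat \<Rightarrow> ('n \<times> nat) set" where
  "block bl k = {p\<in>Pos. bl p = k}"

lemma finite_block [simp]: "finite (block bl k)"
  by (simp add: block_def)

text \<open>Distributing the product over the blocks selects one position \<open>\<chi> k\<close> in
  each; the images of these selections are the choices of full size.\<close>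

lemma choice_sum_pure:
  assumes bl: "valid_blocks bl" and ef: "e \<in> duals" "f \<in> duals"
  shows "choice_sum bl r (pure v) e f = (\<Prod>k<r. \<Sum>p\<in>block bl k. \<Prod>q\<in>block bl k. pattern e f {p} q (v q))"
proof -
  have "(\<Prod>k<r. \<Sum>p\<in>block bl k. \<Prod>q\<in>block bl k. pattern e f {p} q (v q)) =
    (\<Sum>\<chi>\<in>PiE {..<r} (block bl). \<Prod>k<r. \<Prod>q\<in>block bl k. pattern e f {\<chi> k} q (v q))"
    by (rule prod_sum_PiE) auto
  also have "\<dots> = (\<Sum>\<chi>\<in>PiE {..<r} (block bl). ev (pure v) (pattern e f (\<chi> ` {..<r})))"
  proof (rule sum.cong[OF refl])
    fix \<chi> assume \<chi>: "\<chi> \<in> PiE {..<r} (block bl)"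
    have "(\<Prod>k<r. \<Prod>q\<in>block bl k. pattern e f {\<chi> k} q (v q)) =
      (\<Prod>k<r. \<Prod>q\<in>block bl k. pattern e f (\<chi> ` {..<r}) q (v q))"
    proof (intro prod.cong refl)
      fix k q assume k: "k \<in> {..<r}" and q: "q \<in> block bl k"
      have "q \<in> \<chi> ` {..<r} \<longleftrightarrow> q = \<chi> k"
        using \<chi> k q by (auto simp: PiE_def Pi_def block_def)
      then show "pattern e f {\<chi> k} q (v q) = pattern e f (\<chi> ` {..<r}) q (v q)" by (simp add: pattern_def)
    qed
    also have "\<dots> = (\<Prod>q\<in>Pos. pattern e f (\<chi> ` {..<r}) q (v q))"
      unfolding block_def by (rule prod.group) (use bl in \<open>auto simp: valid_blocks_def\<close>)
    finally show "(\<Prod>k<r. \<Prod>q\<in>block bl k. pattern e f {\<chi> k} q (v q)) = ev (pure v) (pattern e f (\<chi> ` {..<r}))"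
      by (simp add: ev_pure pattern_covectors[OF ef])
  qed
  also have "\<dots> = (\<Sum>S\<in>{S\<in>choices bl. card S = r}. ev (pure v) (pattern e f S))"
  proof (rule sum.reindex_bij_witness[of _ "\<lambda>S. \<lambda>k\<in>{..<r}. the_inv_into S bl k" "\<lambda>\<chi>. \<chi> ` {..<r}"])
    fix \<chi> assume \<chi>: "\<chi> \<in> PiE {..<r} (block bl)"
    have b: "bl (\<chi> k) = k" "\<chi> k \<in> Pos" if "k < r" for k using \<chi> that by (auto simp: PiE_def Pi_def block_def)
    have inj: "inj_on \<chi> {..<r}" using b(1) by (metis inj_onI lessThan_iff)
    have inj': "inj_on bl (\<chi> ` {..<r})" using b(1) by (auto simp: inj_on_def)
    then show "\<chi> ` {..<r} \<in> {S\<in>choices bl. card S = r}"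
      using b(2) inj by (auto simp: choices_def card_image)
    have "the_inv_into (\<chi> ` {..<r}) bl k = \<chi> k" if "k < r" for k
      using the_inv_into_f_f[OF inj', of "\<chi> k"] that b(1) by auto
    then show "(\<lambda>k\<in>{..<r}. the_inv_into (\<chi> ` {..<r}) bl k) = \<chi>"
      using \<chi> by (auto simp: fun_eq_iff PiE_def extensional_def)
  next
    fix S assume "S \<in> {S\<in>choices bl. card S = r}"
    then have S: "S \<subseteq> Pos" "inj_on bl S" "card S = r" by (auto simp: choices_def)
    have im: "bl ` S = {..<r}"
    proof (rule card_subset_eq)
      show "bl ` S \<subseteq> {..<r}" using S(1) bl by (auto simp: valid_blocks_def)
      show "card (bl ` S) = card {..<r}" using S(2,3) by (simp add: card_image)
    qed simp
    have "(\<lambda>k\<in>{..<r}. the_inv_into S bl k) ` {..<r} = the_inv_into S bl ` (bl ` S)" unfolding im by auto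
    also have "\<dots> = S" using the_inv_into_onto[OF S(2)] by simp
    finally show "(\<lambda>k\<in>{..<r}. the_inv_into S bl k) ` {..<r} = S" .
    show "(\<lambda>k\<in>{..<r}. the_inv_into S bl k) \<in> PiE {..<r} (block bl)"
      using the_inv_into_into[OF S(2)] f_the_inv_into_f[OF S(2)] S(1) im by (auto simp: block_def)
  qed auto
  finally show ?thesis by (simp add: choice_sum_def)
qed

section \<open>From polynomials to tensors\<close>

definition standard_blocks :: "'n \<times> nat \<Rightarrow> nat" where
  "standard_blocks = (\<lambda>(j, i). i div d j)"

lemma standard_blocks_eq: "k < r \<Longrightarrow> block standard_blocks k = (\<lambda>(j, m). (j, k * d j + m)) ` slots"
proof (intro equalityI subsetI)
  fix p assume k: "k < r" and p: "p \<in> (\<lambda>(j, m). (j, k * d j + m)) ` slots"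
  then obtain j m where jm: "p = (j, k * d j + m)" "m < d j" by auto
  have "k * d j + m < Suc k * d j" using jm(2) by simp
  also have "\<dots> \<le> r * d j" using k by (intro mult_right_mono) auto
  finally show "p \<in> block standard_blocks k" using jm by (simp add: block_def standard_blocks_def)
next
  fix p assume "p \<in> block standard_blocks k"
  then obtain j i where ji: "p = (j, i)" "i div d j = k" by (cases p) (auto simp: block_def standard_blocks_def)
  have "i = k * d j + i mod d j" using ji(2) by (metis div_mult_mod_eq)
  then show "p \<in> (\<lambda>(j, m). (j, k * d j + m)) ` slots"
    using d_pos[of j] ji(1) by (intro image_eqI[of _ _ "(j, i mod d j)"]) auto
qed

lemma valid_standard_blocks: "valid_blocks standard_blocks"
  unfolding valid_blocks_def
proof (intro conjI ballI allI impI)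
  fix p assume "p \<in> Pos"
  then show "standard_blocks p < r"
    using d_pos by (cases p) (auto simp: standard_blocks_def less_mult_imp_div_less)
next
  fix k j assume k: "k < r"
  have "{i. i < r * d j \<and> standard_blocks (j, i) = k} = (\<lambda>m. k * d j + m) ` {..<d j}"
  proof -
    have "Pair j ` {i. i < r * d j \<and> standard_blocks (j, i) = k} = {p\<in>block standard_blocks k. fst p = j}"
      by (auto simp: block_def)
    also have "\<dots> = Pair j ` ((\<lambda>m. k * d j + m) ` {..<d j})"
      unfolding standard_blocks_eq[OF k] by (auto simp: slots_def)
    finally show ?thesis by (rule inj_image_eq_iff[THEN iffD1, rotated]) (simp add: inj_def)
  qed
  then show "card {i. i < r * d j \<and> standard_blocks (j, i) = k} = d j"
    by (simp add: card_image inj_on_def)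
qed

text \<open>Each of the \<open>r\<close> linear forms is expanded in basis tensors on one block.
  Basis tensors on all blocks combine into a pure tensor on \<open>Pos\<close>, whose choice sum is
  the product.\<close>

lemma poly_to_ten:
  assumes "p \<in> poly_ring_deg Y r"
  shows "\<exists>A\<in>ten. \<forall>e\<in>duals. \<forall>f\<in>duals. p (tangent e f) = choice_sum standard_blocks r A e f"
  using assms unfolding poly_ring_deg_def
proof (induction rule: fs.span_induct_alt)
  case base
  show ?case by (intro bexI[of _ 0] ten_zero) (simp add: choice_sum_def ev_def fun_apply)
next
  case (step c x y)
  then obtain ls where ls: "x = form_product Y ls" "set ls \<subseteq> dual_space fscale Y" "length ls = r" by auto
  from step obtain A where A: "A \<in> ten" "\<And>e f. e \<in> duals \<Longrightarrow> f \<in> duals \<Longrightarrow> y (tangent e f) = choice_sum standard_blocks r A e f"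
    by auto
  have "\<forall>j. \<exists>B b. finite B \<and> B \<subseteq> V j \<and> (\<forall>x\<in>B. b x \<in> dual j) \<and> (\<forall>\<phi>\<in>dual j. \<forall>v. \<phi> v = (\<Sum>x\<in>B. \<phi> x * b x v))"
    by (intro allI dual_basis)
  from choice[OF this] obtain B where "\<forall>j. \<exists>b. finite (B j) \<and> B j \<subseteq> V j \<and> (\<forall>x\<in>B j. b x \<in> dual j) \<and> (\<forall>\<phi>\<in>dual j. \<forall>v. \<phi> v = (\<Sum>x\<in>B j. \<phi> x * b x v))" ..
  from choice[OF this] obtain b where "\<forall>j. finite (B j) \<and> B j \<subseteq> V j \<and> (\<forall>x\<in>B j. b j x \<in> dual j) \<and> (\<forall>\<phi>\<in>dual j. \<forall>v. \<phi> v = (\<Sum>x\<in>B j. \<phi> x * b j x v))" ..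
  then have B: "\<And>j. finite (B j)" "\<And>j. B j \<subseteq> V j" "\<And>j x. x \<in> B j \<Longrightarrow> b j x \<in> dual j"
    "\<And>j \<phi> v. \<phi> \<in> dual j \<Longrightarrow> \<phi> v = (\<Sum>x\<in>B j. \<phi> x * b j x v)" by blast+
  let ?H = "PiE slots (\<lambda>q. B (fst q))"
  define c' where "c' k h = (ls ! k) (form_tensor (\<lambda>q. b (fst q) (h q)))" for k h
  \<comment> \<open>Position \<open>i\<close> of factor \<open>j\<close> is the slot
    \<open>i mod d j\<close> of the block \<open>i div d j\<close>.\<close>
  define w where "w \<eta> = (\<lambda>(j, i). \<eta> (i div d j) (j, i mod d j))" for \<eta> :: "nat \<Rightarrow> 'n \<times> nat \<Rightarrow> 'v"
  define A' where "A' = (\<Sum>\<eta>\<in>PiE {..<r} (\<lambda>_. ?H). fscale (\<Prod>k<r. c' k (\<eta> k)) (pure (w \<eta>)))"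
  have "A' \<in> ten"
    unfolding A'_def
  proof (intro ten_sum ten_scale pure_ten)
    fix \<eta> assume \<eta>: "\<eta> \<in> PiE {..<r} (\<lambda>_. ?H)"
    show "w \<eta> \<in> vectors"
      unfolding vectors_def
    proof (intro CollectI ballI)
      fix p assume "p \<in> Pos"
      then obtain j i where p: "p = (j, i)" "i < r * d j" by (cases p) auto
      then have "i div d j < r" "(j, i mod d j) \<in> slots" using d_pos[of j] by (auto simp: less_mult_imp_div_less)
      then have "\<eta> (i div d j) (j, i mod d j) \<in> B j" using \<eta> by (fastforce simp: PiE_def Pi_def)
      then show "w \<eta> p \<in> V (fst p)" using B(2) p by (auto simp: w_def)
    qed
  qed
  have x: "x (tangent e f) = choice_sum standard_blocks r A' e f" if ef: "e \<in> duals" "f \<in> duals" for e f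
  proof -
    have "x (tangent e f) = (\<Prod>k<r. (ls ! k) (tangent e f))"
      using tangent_mem[OF ef] ls by (simp add: form_product_def prod.list_conv_set_nth atLeast0LessThan)
    also have "\<dots> = (\<Prod>k<r. \<Sum>h\<in>?H. c' k h * (\<Sum>p\<in>slots. \<Prod>q\<in>slots. pattern e f {p} q (h q)))"
      unfolding c'_def by (intro prod.cong refl linear_form_expand B ef) (use ls in auto)
    also have "\<dots> = (\<Sum>\<eta>\<in>PiE {..<r} (\<lambda>_. ?H). \<Prod>k<r. c' k (\<eta> k) * (\<Sum>p\<in>slots. \<Prod>q\<in>slots. pattern e f {p} q (\<eta> k q)))"
      by (rule prod_sum_PiE) (use B(1) in \<open>auto intro: finite_PiE\<close>)
    also have "\<dots> = (\<Sum>\<eta>\<in>PiE {..<r} (\<lambda>_. ?H). (\<Prod>k<r. c' k (\<eta> k)) * choice_sum standard_blocks r (pure (w \<eta>)) e f)"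
    proof (rule sum.cong[OF refl])
      fix \<eta>
      have "(\<Sum>p\<in>block standard_blocks k. \<Prod>q\<in>block standard_blocks k. pattern e f {p} q (w \<eta> q)) =
        (\<Sum>p\<in>slots. \<Prod>q\<in>slots. pattern e f {p} q (\<eta> k q))" if k: "k < r" for k
      proof -
        let ?s = "\<lambda>(j, m). (j, k * d j + m)"
        have inj: "inj_on ?s slots" by (auto simp: inj_on_def)
        have "pattern e f {?s p} (?s q) (w \<eta> (?s q)) = pattern e f {p} q (\<eta> k q)" if "q \<in> slots" for p q
          using that d_pos by (cases p; cases q) (auto simp: pattern_def w_def)
        then show ?thesis
          unfolding standard_blocks_eq[OF k] sum.reindex[OF inj] prod.reindex[OF inj] by simp
      qed
      then show "(\<Prod>k<r. c' k (\<eta> k) * (\<Sum>p\<in>slots. \<Prod>q\<in>slots. pattern e f {p} q (\<eta> k q))) =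
        (\<Prod>k<r. c' k (\<eta> k)) * choice_sum standard_blocks r (pure (w \<eta>)) e f"
        by (simp add: choice_sum_pure[OF valid_standard_blocks ef] prod.distrib)
    qed
    also have "\<dots> = choice_sum standard_blocks r A' e f"
      unfolding choice_sum_def A'_def ev_sum ev_scale by (simp only: sum_distrib_left) (rule sum.swap)
    finally show ?thesis .
  qed
  show ?case
  proof (intro bexI[of _ "fscale c A' + A"] ballI)
    fix e f assume ef: "e \<in> duals" "f \<in> duals"
    show "(fscale c x + y) (tangent e f) = choice_sum standard_blocks r (fscale c A' + A) e f"
      using x[OF ef] A(2)[OF ef] by (simp add: plus_fun_apply fscale_apply choice_sum_def sum.distrib sum_distrib_left)
  qed (use A(1) \<open>A' \<in> ten\<close> in \<open>intro ten_add ten_scale\<close>)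
qed

lemma poly_ring_deg_scale: "p \<in> poly_ring_deg Y s \<Longrightarrow> fscale c p \<in> poly_ring_deg Y s"
  by (simp add: poly_ring_deg_def fs.span_scale)

lemma poly_ring_deg_add: "p \<in> poly_ring_deg Y s \<Longrightarrow> q \<in> poly_ring_deg Y s \<Longrightarrow> p + q \<in> poly_ring_deg Y s"
  by (simp add: poly_ring_deg_def fs.span_add)

section \<open>From tensors to polynomials\<close>

lemma card_slots_factor: "card {q\<in>slots. fst q = j} = d j"
proof -
  have "{q\<in>slots. fst q = j} = Pair j ` {..<d j}" by auto
  then show ?thesis by (simp add: card_image inj_on_def)
qed

lemma card_block_factor:
  assumes "valid_blocks bl" "k < r"
  shows "card {p\<in>block bl k. fst p = j} = d j"
proof -
  have "{p\<in>block bl k. fst p = j} = Pair j ` {i. i < r * d j \<and> bl (j, i) = k}" by (auto simp: block_def)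
  then show ?thesis using assms by (simp add: card_image inj_on_def valid_blocks_def)
qed

text \<open>The polarization of the multiform \<open>F\<close> at the vectors of the block, without
  normalization. It is linear in \<open>F\<close> by construction, hence an admissible factor of a
  polynomial.\<close>

definition block_form :: "('n \<times> nat) set \<Rightarrow> ('n \<times> nat \<Rightarrow> 'v) \<Rightarrow> (('n \<Rightarrow> 'v) \<Rightarrow> 'k) \<Rightarrow> 'k" where
  "block_form B v = (\<lambda>F. if F \<in> Y then \<Sum>I\<in>Pow B. (- 1) ^ card (B - I) * F (\<lambda>j. \<Sum>p\<in>{p\<in>I. fst p = j}. v p) else 0)"

lemma block_form_dual: "block_form B v \<in> dual_space fscale Y"
proof -
  have "F + G \<in> Y" if "F \<in> Y" "G \<in> Y" for F G using that by (simp add: sym_tensor_def fs.span_add)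
  moreover have "fscale c F \<in> Y" if "F \<in> Y" for c F using that by (simp add: sym_tensor_def fs.span_scale)
  ultimately show ?thesis
    unfolding dual_space_def block_form_def
    by (auto simp: fun_apply algebra_simps sum.distrib sum_distrib_left)
qed

lemma block_form_form_tensor:
  assumes B: "B \<subseteq> Pos" and v: "v \<in> vectors" and \<phi>: "\<And>q. q \<in> slots \<Longrightarrow> \<phi> q \<in> dual (fst q)"
  shows "block_form B v (form_tensor \<phi>) =
    (\<Sum>h\<in>{h\<in>PiE slots (\<lambda>q. {p\<in>B. fst p = fst q}). h ` slots = B}. \<Prod>q\<in>slots. \<phi> q (v (h q)))"
proof -
  have fB: "finite B" using B finite_Pos finite_subset by blast
  have "form_tensor \<phi> (\<lambda>j. \<Sum>p\<in>{p\<in>I. fst p = j}. v p) =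
    (\<Sum>h\<in>PiE slots (\<lambda>q. {p\<in>B. fst p = fst q} \<inter> I). \<Prod>q\<in>slots. \<phi> q (v (h q)))" if I: "I \<subseteq> B" for I
  proof -
    have fI: "finite I" using I fB finite_subset by blast
    have "form_tensor \<phi> (\<lambda>j. \<Sum>p\<in>{p\<in>I. fst p = j}. v p) = (\<Prod>q\<in>slots. \<Sum>p\<in>{p\<in>B. fst p = fst q} \<inter> I. \<phi> q (v p))"
      unfolding form_tensor_def
    proof (rule prod.cong[OF refl])
      fix q assume q: "q \<in> slots"
      have eq: "{p\<in>B. fst p = fst q} \<inter> I = {p\<in>I. fst p = fst q}" using I by auto
      have "v p \<in> V (fst q)" if "p \<in> {p\<in>I. fst p = fst q}" for p
      proof -
        have "p \<in> Pos" "fst p = fst q" using that I B by auto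
        then show ?thesis using v unfolding vectors_def by (metis (mono_tags, lifting) mem_Collect_eq)
      qed
      then show "\<phi> q (\<Sum>p\<in>{p\<in>I. fst p = fst q}. v p) = (\<Sum>p\<in>{p\<in>B. fst p = fst q} \<inter> I. \<phi> q (v p))"
        unfolding eq using fI by (intro dual_apply_sum[OF \<phi>[OF q]]) auto
    qed
    also have "\<dots> = (\<Sum>h\<in>PiE slots (\<lambda>q. {p\<in>B. fst p = fst q} \<inter> I). \<Prod>q\<in>slots. \<phi> q (v (h q)))"
      using fB by (intro prod_sum_PiE) auto
    finally show ?thesis .
  qed
  then have "block_form B v (form_tensor \<phi>) = (\<Sum>I\<in>Pow B. (- 1) ^ card (B - I) *
    (\<Sum>h\<in>PiE slots (\<lambda>q. {p\<in>B. fst p = fst q} \<inter> I). \<Prod>q\<in>slots. \<phi> q (v (h q))))"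
    using form_tensor_mem[of \<phi>] \<phi> by (simp add: block_form_def)
  also have "\<dots> = (\<Sum>h\<in>{h\<in>PiE slots (\<lambda>q. {p\<in>B. fst p = fst q}). h ` slots = B}. \<Prod>q\<in>slots. \<phi> q (v (h q)))"
    by (rule sum_surjective_PiE) (use fB in auto)
  finally show ?thesis .
qed

text \<open>A map of the slots onto the block that respects the factors is a bijection, since both
  have \<open>d j\<close> elements in factor \<open>j\<close>. All these bijections contribute the
  same sum, so their number serves as \<open>c\<close>.\<close>

lemma block_form_tangent:
  assumes bl: "valid_blocks bl" and k: "k < r" and v: "v \<in> vectors"
  shows "\<exists>c\<noteq>0. \<forall>e\<in>duals. \<forall>f\<in>duals. block_form (block bl k) v (tangent e f) =
    c * (\<Sum>p\<in>block bl k. \<Prod>q\<in>block bl k. pattern e f {p} q (v q))"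
proof -
  let ?B = "block bl k"
  let ?H = "{h\<in>PiE slots (\<lambda>q. {p\<in>?B. fst p = fst q}). h ` slots = ?B}"
  have B: "?B \<subseteq> Pos" by (auto simp: block_def)
  have card: "card slots = card ?B"
  proof -
    have "card S = (\<Sum>j\<in>UNIV. card {p\<in>S. fst p = j})" if "finite S" for S :: "('n \<times> nat) set"
      using sum_cnt[OF that] by (simp add: cnt_def)
    then show ?thesis by (simp add: card_slots_factor card_block_factor[OF bl k])
  qed
  have "\<exists>h. bij_betw h {q\<in>slots. fst q = j} {p\<in>?B. fst p = j}" for j
    by (rule finite_same_card_bij) (simp_all add: card_slots_factor card_block_factor[OF bl k])
  then have "\<forall>j. \<exists>h. bij_betw h {q\<in>slots. fst q = j} {p\<in>?B. fst p = j}" by blast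
  from choice[OF this] obtain h where h: "\<And>j. bij_betw (h j) {q\<in>slots. fst q = j} {p\<in>?B. fst p = j}" by blast
  \<comment> \<open>One such bijection, so that their number is not zero.\<close>
  define h0 where "h0 = (\<lambda>q\<in>slots. h (fst q) q)"
  have "h0 \<in> PiE slots (\<lambda>q. {p\<in>?B. fst p = fst q})"
  proof (rule PiE_I)
    fix q assume q: "q \<in> slots"
    then have "h (fst q) q \<in> {p\<in>?B. fst p = fst q}" by (intro bij_betw_apply[OF h]) simp
    then show "h0 q \<in> {p\<in>?B. fst p = fst q}" using q by (simp add: h0_def)
  qed (simp add: h0_def)
  moreover have "h0 ` slots = ?B"
  proof
    show "h0 ` slots \<subseteq> ?B" using calculation by (auto simp: PiE_def Pi_def)
    show "?B \<subseteq> h0 ` slots"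
    proof
      fix p assume "p \<in> ?B"
      then have "p \<in> h (fst p) ` {q\<in>slots. fst q = fst p}" using h[of "fst p"] by (simp add: bij_betw_def)
      then obtain q where "q \<in> slots" "fst q = fst p" "p = h (fst p) q" by auto
      then show "p \<in> h0 ` slots" by (intro image_eqI[of _ _ q]) (auto simp: h0_def)
    qed
  qed
  ultimately have h0: "h0 \<in> ?H" by simp
  have finH: "finite ?H" by (rule finite_subset[of _ "PiE slots (\<lambda>q. {p\<in>?B. fst p = fst q})"]) (auto intro: finite_PiE)
  have "block_form ?B v (tangent e f) = of_nat (card ?H) * (\<Sum>p\<in>?B. \<Prod>q\<in>?B. pattern e f {p} q (v q))"
    if ef: "e \<in> duals" "f \<in> duals" for e f
  proof -
    have "block_form ?B v (tangent e f) = block_form ?B v (\<Sum>p\<in>slots. fscale 1 (form_tensor (pattern e f {p})))"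
      by (simp add: tangent_eq)
    also have "\<dots> = (\<Sum>p\<in>slots. 1 * block_form ?B v (form_tensor (pattern e f {p})))"
      by (rule dual_fspan_sum[OF block_form_dual[unfolded sym_tensor_def]])
        (intro form_tensor_mem[unfolded sym_tensor_def] pattern_slots[OF ef])
    also have "\<dots> = (\<Sum>p\<in>slots. \<Sum>h\<in>?H. \<Prod>q\<in>slots. pattern e f {p} q (v (h q)))"
      unfolding mult_1 by (intro sum.cong refl block_form_form_tensor B v pattern_slots[OF ef])
    also have "\<dots> = (\<Sum>h\<in>?H. \<Sum>p\<in>slots. \<Prod>q\<in>slots. pattern e f {p} q (v (h q)))"
      by (rule sum.swap)
    also have "\<dots> = (\<Sum>h\<in>?H. \<Sum>p\<in>?B. \<Prod>q\<in>?B. pattern e f {p} q (v q))"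
    proof (rule sum.cong[OF refl])
      fix h assume hH: "h \<in> ?H"
      then have im: "h ` slots = ?B" and fst: "\<And>q. q \<in> slots \<Longrightarrow> fst (h q) = fst q" by (auto simp: PiE_def Pi_def)
      have inj: "inj_on h slots" by (rule eq_card_imp_inj_on) (use im card in simp_all)
      have "(\<Sum>p\<in>?B. \<Prod>q\<in>?B. pattern e f {p} q (v q)) = (\<Sum>p\<in>slots. \<Prod>q\<in>slots. pattern e f {h p} (h q) (v (h q)))"
        unfolding im[symmetric] by (simp add: sum.reindex[OF inj] prod.reindex[OF inj])
      also have "\<dots> = (\<Sum>p\<in>slots. \<Prod>q\<in>slots. pattern e f {p} q (v (h q)))"
      proof (intro sum.cong prod.cong refl)
        fix p q assume "p \<in> slots" "q \<in> slots"
        then show "pattern e f {h p} (h q) (v (h q)) = pattern e f {p} q (v (h q))"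
          using inj_on_eq_iff[OF inj, of q p] fst by (simp add: pattern_def)
      qed
      finally show "(\<Sum>p\<in>slots. \<Prod>q\<in>slots. pattern e f {p} q (v (h q))) = (\<Sum>p\<in>?B. \<Prod>q\<in>?B. pattern e f {p} q (v q))" ..
    qed
    finally show ?thesis by simp
  qed
  moreover have "of_nat (card ?H) \<noteq> (0::'k)" using h0 finH by (auto simp: card_eq_0_iff simp del: mem_Collect_eq)
  ultimately show ?thesis by blast
qed

text \<open>A pure tensor corresponds to the product of the block forms of its blocks, up to a
  nonzero scalar. As this works for every valid distribution, different shapes may use different
  blocks.\<close>

lemma ten_to_poly:
  assumes bl: "valid_blocks bl" and A: "A \<in> ten"
  shows "\<exists>p\<in>poly_ring_deg Y r. \<forall>e\<in>duals. \<forall>f\<in>duals. p (tangent e f) = choice_sum bl r A e f"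
  using A
proof (induction rule: ten_induct)
  case zero
  have "0 \<in> poly_ring_deg Y r" by (simp add: poly_ring_deg_def fs.span_zero)
  then show ?case by (intro bexI[of _ 0]) (simp_all add: choice_sum_def ev_def fun_apply)
next
  case (step c v A)
  then obtain p where p: "p \<in> poly_ring_deg Y r"
    "\<And>e f. e \<in> duals \<Longrightarrow> f \<in> duals \<Longrightarrow> p (tangent e f) = choice_sum bl r A e f" by auto
  define L where "L k e f = (\<Sum>p\<in>block bl k. \<Prod>q\<in>block bl k. pattern e f {p} q (v q))" for k e f
  have "\<forall>k. \<exists>c. k < r \<longrightarrow> c \<noteq> 0 \<and> (\<forall>e\<in>duals. \<forall>f\<in>duals. block_form (block bl k) v (tangent e f) = c * L k e f)"
    using block_form_tangent[OF bl _ step(1)] unfolding L_def by blast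
  from choice[OF this] obtain c' where c': "\<And>k. k < r \<Longrightarrow> c' k \<noteq> 0"
    "\<And>k e f. k < r \<Longrightarrow> e \<in> duals \<Longrightarrow> f \<in> duals \<Longrightarrow> block_form (block bl k) v (tangent e f) = c' k * L k e f" by blast
  define ls where "ls = map (\<lambda>k. block_form (block bl k) v) [0..<r]"
  have P: "form_product Y ls \<in> poly_ring_deg Y r"
    unfolding poly_ring_deg_def
    by (rule fs.span_base, rule CollectI, rule exI[of _ ls]) (auto simp: ls_def block_form_dual)
  let ?C = "\<Prod>k<r. c' k"
  have C: "?C \<noteq> 0" using c'(1) by (simp add: prod_zero_iff)
  have val: "form_product Y ls (tangent e f) = ?C * choice_sum bl r (pure v) e f" if ef: "e \<in> duals" "f \<in> duals" for e f
  proof -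
    have "form_product Y ls (tangent e f) = (\<Prod>k<r. block_form (block bl k) v (tangent e f))"
      using tangent_mem[OF ef] by (simp add: form_product_def ls_def prod.list_conv_set_nth atLeast0LessThan)
    also have "\<dots> = (\<Prod>k<r. c' k * L k e f)" by (rule prod.cong) (use c'(2) ef in auto)
    finally show ?thesis by (simp add: prod.distrib choice_sum_pure[OF bl ef] L_def)
  qed
  show ?case
  proof (intro bexI[of _ "fscale (c / ?C) (form_product Y ls) + p"] ballI)
    fix e f assume ef: "e \<in> duals" "f \<in> duals"
    show "(fscale (c / ?C) (form_product Y ls) + p) (tangent e f) = choice_sum bl r (fscale c (pure v) + A) e f"
      using val[OF ef] p(2)[OF ef] C by (simp add: plus_fun_apply fscale_apply choice_sum_def sum.distrib sum_distrib_left)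
  qed (intro poly_ring_deg_add poly_ring_deg_scale P p(1))
qed

end

section \<open>Decomposition of the coordinate ring\<close>

definition second_parts :: "('n \<Rightarrow> nat list) \<Rightarrow> 'n \<Rightarrow> nat" where
  "second_parts lam = (\<lambda>j. nth_part (lam j) 2)"

text \<open>A form of \<open>f_stat\<close> in natural numbers that depends on the second parts
  only.\<close>

definition peak :: "('n::finite \<Rightarrow> nat) \<Rightarrow> ('n \<Rightarrow> nat) \<Rightarrow> nat" where
  "peak d a = Max (range (\<lambda>j. nat \<lceil>real (a j) / real (d j)\<rceil>))"

lemma f_stat_eq: "f_stat d lam = int (peak d (second_parts lam))"
proof -
  have "range (\<lambda>j. \<lceil>real (nth_part (lam j) 2) / real (d j)\<rceil>) = int ` range (\<lambda>j. nat \<lceil>real (second_parts lam j) / real (d j)\<rceil>)"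
  proof -
    have "\<lceil>real x / real y\<rceil> = int (nat \<lceil>real x / real y\<rceil>)" for x y :: nat
    proof -
      have "- 1 < real x / real y" by (rule less_le_trans[of _ 0]) simp_all
      then show ?thesis by simp
    qed
    then show ?thesis unfolding image_image second_parts_def by metis
  qed
  moreover have "Max (int ` range (\<lambda>j. nat \<lceil>real (second_parts lam j) / real (d j)\<rceil>)) = int (peak d (second_parts lam))"
    unfolding peak_def by (rule mono_Max_commute[symmetric]) (auto simp: mono_def)
  ultimately show ?thesis by (simp add: f_stat_def)
qed

lemma e_stat_eq: "e_stat lam = int (\<Sum>j\<in>UNIV. second_parts lam j)"
  by (simp add: e_stat_def second_parts_def)

lemma peak_le:
  assumes "d j > 0"
  shows "a j \<le> peak d a * d j"
proof -
  have "nat \<lceil>real (a j) / real (d j)\<rceil> \<le> peak d a" unfolding peak_def by (rule Max_ge) auto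
  then have "real (a j) / real (d j) \<le> real (peak d a)" by linarith
  then have "real (a j) \<le> real (peak d a * d j)" using assms by (simp add: field_simps)
  then show ?thesis by (simp only: of_nat_le_iff)
qed

text \<open>Take a factor where the maximum is attained: its quotient exceeds the ceiling minus one.
  This is the factor in which a lonely position is found.\<close>

lemma peak_attained:
  assumes "\<And>j. d j > 0" "peak d a > 0"
  obtains j where "(peak d a - 1) * d j < a j"
proof -
  have "peak d a \<in> range (\<lambda>j. nat \<lceil>real (a j) / real (d j)\<rceil>)" unfolding peak_def by (rule Max_in) auto
  then obtain j where j: "peak d a = nat \<lceil>real (a j) / real (d j)\<rceil>" by auto
  then have "real (peak d a - 1) < real (a j) / real (d j)" using assms(2) by linarith
  then have "real ((peak d a - 1) * d j) < real (a j)" using assms(1)[of j] by (simp add: field_simps)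
  then show ?thesis using that by (simp only: of_nat_less_iff)
qed

context segre_veronese
begin

definition good :: "('n \<Rightarrow> nat list) set" where
  "good = {lam. (\<forall>j. partition_of (lam j) (r * d j)) \<and> 0 < tangential_mult d r lam}"

lemma good_iff: "lam \<in> good \<longleftrightarrow> (\<forall>j. partition_of (lam j) (r * d j) \<and> length (lam j) \<le> 2) \<and>
  2 * peak d (second_parts lam) \<le> (\<Sum>j\<in>UNIV. second_parts lam j) \<and> (\<Sum>j\<in>UNIV. second_parts lam j) \<le> r"
proof -
  define E P where "E = (\<Sum>j\<in>UNIV. second_parts lam j)" and "P = peak d (second_parts lam)"
  have "e_stat lam = int E" "f_stat d lam = int P" by (simp_all only: E_def P_def e_stat_eq f_stat_eq)
  then show ?thesis
    unfolding E_def[symmetric] P_def[symmetric] good_def tangential_mult_def by (auto simp: not_less) (meson leD)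
qed

text \<open>Combine \<open>a j \<le> peak d a * d j\<close> with
  \<open>2 * peak d a \<le> r\<close>.\<close>

lemma shape_if_good:
  assumes "2 * peak d a \<le> (\<Sum>j\<in>UNIV. a j)" "(\<Sum>j\<in>UNIV. a j) \<le> r"
  shows "shape a"
  unfolding shape_def
proof
  fix j
  have "2 * a j \<le> 2 * peak d a * d j" using peak_le[of d j a] d_pos by simp
  also have "\<dots> \<le> r * d j" using assms by (intro mult_right_mono) auto
  finally show "2 * a j \<le> r * d j" .
qed

lemma two_row_shapes_good: "lam \<in> good \<Longrightarrow> two_row_shapes scale V d r lam"
  by (intro two_row_shapes.intro two_row_shapes_axioms.intro segre_veronese_axioms) (auto simp: good_iff)

lemma schur_tensor_good:
  assumes "lam \<in> good"
  shows "schur_tensor scale V lam = schur_space (second_parts lam)"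
proof -
  interpret two_row_shapes scale V d r lam by (rule two_row_shapes_good[OF assms])
  have "second = second_parts lam" by (simp add: fun_eq_iff second_def second_parts_def)
  then show ?thesis using schur_tensor_eq by simp
qed

lemma shape_good: "lam \<in> good \<Longrightarrow> shape (second_parts lam)"
  by (rule shape_if_good) (auto simp: good_iff)

lemma second_parts_inj: "inj_on second_parts good"
proof (rule inj_onI)
  fix lam mu assume h: "lam \<in> good" "mu \<in> good" "second_parts lam = second_parts mu"
  show "lam = mu"
  proof
    fix j
    have p: "partition_of (lam j) (r * d j)" "length (lam j) \<le> 2" "partition_of (mu j) (r * d j)" "length (mu j) \<le> 2"
      using h by (auto simp: good_iff)
    have e: "nth_part (lam j) 2 = nth_part (mu j) 2" using fun_cong[OF h(3), of j] by (simp add: second_parts_def)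
    show "lam j = mu j"
      by (cases rule: partition_of_cases[OF p(1,2)]; cases rule: partition_of_cases[OF p(3,4)]) (use e in auto)
  qed
qed

lemma good_exists:
  assumes "2 * peak d a \<le> (\<Sum>j\<in>UNIV. a j)" "(\<Sum>j\<in>UNIV. a j) \<le> r"
  obtains lam where "lam \<in> good" "second_parts lam = a"
proof -
  define lam where "lam j = (if a j > 0 then [r * d j - a j, a j] else if r * d j > 0 then [r * d j] else [])" for j
  have ex: "2 * a j \<le> r * d j" for j using shape_if_good[OF assms] by (simp add: shape_def)
  have "partition_of (lam j) (r * d j) \<and> length (lam j) \<le> 2" for j
  proof (cases "a j > 0")
    case True
    then have "a j \<le> r * d j - a j" "r * d j - a j \<noteq> 0" "r * d j - a j + a j = r * d j" using ex[of j] by linarith+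
    then show ?thesis using True by (simp add: lam_def partition_of_def del: diff_is_0_eq)
  next
    case False
    then show ?thesis by (cases "r * d j") (simp_all add: lam_def partition_of_def)
  qed
  moreover have "second_parts lam = a" by (auto simp: second_parts_def lam_def nth_part_def fun_eq_iff)
  ultimately show ?thesis using that[of lam] assms by (simp add: good_iff)
qed

lemma finite_good: "finite good"
proof -
  have "second_parts ` good \<subseteq> PiE UNIV (\<lambda>_. {..r})"
  proof
    fix a assume "a \<in> second_parts ` good"
    then have "(\<Sum>j\<in>UNIV. a j) \<le> r" by (auto simp: good_iff)
    then have "a j \<le> r" for j using member_le_sum[of j UNIV a] by (meson UNIV_I finite le_trans zero_le)
    then show "a \<in> PiE UNIV (\<lambda>_. {..r})" by (simp add: PiE_UNIV_eq)
  qed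
  then have "finite (second_parts ` good)" by (rule finite_subset) (auto intro: finite_PiE)
  then show ?thesis using second_parts_inj by (rule finite_imageD)
qed

definition blocks_for :: "('n \<Rightarrow> nat list) \<Rightarrow> 'n \<times> nat \<Rightarrow> nat" where
  "blocks_for lam = (SOME bl. valid_blocks bl \<and> leading_coeff bl (second_parts lam) \<noteq> 0)"

lemma blocks_for:
  assumes "lam \<in> good"
  shows "valid_blocks (blocks_for lam)" "leading_coeff (blocks_for lam) (second_parts lam) \<noteq> 0"
proof -
  have "\<exists>bl. valid_blocks bl \<and> leading_coeff bl (second_parts lam) \<noteq> 0"
  proof -
    have "2 * peak d (second_parts lam) \<le> (\<Sum>j\<in>UNIV. second_parts lam j)" "(\<Sum>j\<in>UNIV. second_parts lam j) \<le> r"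
      using assms by (simp_all add: good_iff)
    from good_blocks[OF shape_good[OF assms] peak_le[OF d_pos] this] show ?thesis by blast
  qed
  then have "valid_blocks (blocks_for lam) \<and> leading_coeff (blocks_for lam) (second_parts lam) \<noteq> 0"
    unfolding blocks_for_def by (rule someI_ex)
  then show "valid_blocks (blocks_for lam)" "leading_coeff (blocks_for lam) (second_parts lam) \<noteq> 0" by auto
qed

lemma card_columns_good: "lam \<in> good \<Longrightarrow> card (columns (second_parts lam)) \<le> r"
  by (simp add: good_iff card_columns)

text \<open>The function on the cone that belongs to an element of the direct sum. Every shape
  enters through its own blocks, for which its leading coefficient is nonzero.\<close>

definition total_form :: "(('n \<Rightarrow> nat list) \<Rightarrow> ('n \<Rightarrow> ('v \<Rightarrow> 'k) list) \<Rightarrow> 'k) \<Rightarrow>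
    ('n \<Rightarrow> 'v \<Rightarrow> 'k) \<Rightarrow> ('n \<Rightarrow> 'v \<Rightarrow> 'k) \<Rightarrow> 'k" where
  "total_form A e f = (\<Sum>lam\<in>good. choice_sum (blocks_for lam) r (A lam) e f)"

lemma choice_sum_add: "choice_sum bl s (A + B) e f = choice_sum bl s A e f + choice_sum bl s B e f"
  by (simp add: choice_sum_def sum.distrib)

lemma choice_sum_scale: "choice_sum bl s (fscale c A) e f = c * choice_sum bl s A e f"
  by (simp add: choice_sum_def sum_distrib_left)

lemma choice_sum_zero: "choice_sum bl s 0 e f = 0"
  by (simp add: choice_sum_def ev_def fun_apply)

lemma choice_sum_sum: "choice_sum bl s (\<Sum>i\<in>I. A i) e f = (\<Sum>i\<in>I. choice_sum bl s (A i) e f)"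
  by (induction I rule: infinite_finite_induct) (simp_all add: choice_sum_add choice_sum_zero)

text \<open>Induction on the number \<open>s\<close> of columns. Lowering to size \<open>s\<close>
  removes the shapes with more columns, and those with fewer are zero by induction. The shapes with
  exactly \<open>s\<close> columns are separated by degree, because the second parts determine the
  shape.\<close>

lemma total_form_inject:
  assumes A: "\<And>lam. lam \<in> good \<Longrightarrow> A lam \<in> schur_space (second_parts lam)"
    and zero: "\<And>e f. e \<in> duals \<Longrightarrow> f \<in> duals \<Longrightarrow> total_form A e f = 0"
    and lam: "lam \<in> good"
  shows "A lam = 0"
  using lam
proof (induction "card (columns (second_parts lam))" arbitrary: lam rule: less_induct)
  case less
  define s where "s = card (columns (second_parts lam))"
  define M where "M = {mu\<in>good. card (columns (second_parts mu)) = s}"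
  have fM: "finite M" using finite_good by (simp add: M_def)
  have "(\<Sum>mu\<in>M. leading_coeff (blocks_for mu) (second_parts mu) * ev (A mu) (pattern e f (bottom_row (second_parts mu)))) = 0"
    if ef: "e \<in> duals" "f \<in> duals" for e f
  proof -
    have "0 = (\<Sum>mu\<in>good. choice_sum (blocks_for mu) s (A mu) e f)"
      using zero[unfolded total_form_def] schur_space_ten[OF shape_good A] blocks_for(1) finite_good
        card_columns_good[OF less.prems] ef
      by (intro choice_sum_lower_all[symmetric]) (auto simp: s_def)
    also have "\<dots> = (\<Sum>mu\<in>M. choice_sum (blocks_for mu) s (A mu) e f)"
    proof (rule sum.mono_neutral_right[OF finite_good])
      show "\<forall>mu\<in>good - M. choice_sum (blocks_for mu) s (A mu) e f = 0"
      proof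
        fix mu assume mu: "mu \<in> good - M"
        then have "card (columns (second_parts mu)) \<noteq> s" by (auto simp: M_def)
        then consider "card (columns (second_parts mu)) < s" | "s < card (columns (second_parts mu))" by linarith
        then show "choice_sum (blocks_for mu) s (A mu) e f = 0"
        proof cases
          case 1
          then have "A mu = 0" using less.hyps[of mu] mu by (simp add: s_def)
          then show ?thesis by (simp add: choice_sum_zero)
        next
          case 2
          then show ?thesis using choice_sum_schur_less[OF shape_good A ef] mu by auto
        qed
      qed
    qed (auto simp: M_def)
    also have "\<dots> = (\<Sum>mu\<in>M. leading_coeff (blocks_for mu) (second_parts mu) * ev (A mu) (pattern e f (bottom_row (second_parts mu))))"
    proof (rule sum.cong[OF refl])
      fix mu assume "mu \<in> M"
      then show "choice_sum (blocks_for mu) s (A mu) e f =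
        leading_coeff (blocks_for mu) (second_parts mu) * ev (A mu) (pattern e f (bottom_row (second_parts mu)))"
        using choice_sum_schur[OF shape_good A ef, of mu] by (simp add: M_def)
    qed
    finally show ?thesis by simp
  qed
  then have "(\<Sum>mu\<in>{mu\<in>M. cnt (bottom_row (second_parts mu)) = second_parts lam}.
    leading_coeff (blocks_for mu) (second_parts mu) * ev (A mu) (pattern e f (bottom_row (second_parts mu)))) = 0"
    if "e \<in> duals" "f \<in> duals" for e f
    using that fM by (intro degree_component) (auto simp: M_def intro: schur_space_ten shape_good A bottom_row_subset[THEN subsetD])
  moreover have "{mu\<in>M. cnt (bottom_row (second_parts mu)) = second_parts lam} = {lam}"
    using less.prems inj_onD[OF second_parts_inj] by (auto simp: cnt_bottom_row M_def s_def)
  ultimately have "ev (A lam) (pattern e f (bottom_row (second_parts lam))) = 0" if "e \<in> duals" "f \<in> duals" for e f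
    using that blocks_for(2)[OF less.prems] by simp
  then show ?case using schur_space_inject[OF shape_good A] less.prems by blast
qed

text \<open>Passing through a polynomial gives a tensor \<open>Z\<close> with the same sum of full
  size. The difference, a family over \<open>bool\<close> with two block distributions, can be
  lowered, so the sums of all smaller sizes agree as well.\<close>

lemma choice_sum_transfer:
  assumes bl: "valid_blocks bl" and A: "A \<in> ten"
  obtains Z where "Z \<in> ten"
    "\<And>s e f. s \<le> r \<Longrightarrow> e \<in> duals \<Longrightarrow> f \<in> duals \<Longrightarrow> choice_sum standard_blocks s Z e f = choice_sum bl s A e f"
proof -
  obtain p where p: "p \<in> poly_ring_deg Y r" "\<And>e f. e \<in> duals \<Longrightarrow> f \<in> duals \<Longrightarrow> p (tangent e f) = choice_sum bl r A e f"
    using ten_to_poly[OF bl A] by blast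
  obtain Z where Z: "Z \<in> ten" "\<And>e f. e \<in> duals \<Longrightarrow> f \<in> duals \<Longrightarrow> p (tangent e f) = choice_sum standard_blocks r Z e f"
    using poly_to_ten[OF p(1)] by blast
  have minus: "choice_sum bl' s (- A) e f = - choice_sum bl' s A e f" for bl' s e f
    using choice_sum_scale[of bl' s "- 1" A e f] by simp
  have "(\<Sum>i\<in>UNIV. choice_sum (if i then standard_blocks else bl) s (if i then Z else fscale (- 1) A) e f) = 0"
    if "s \<le> r" "e \<in> duals" "f \<in> duals" for s e f
  proof (rule choice_sum_lower_all)
    show "(if i then Z else fscale (- 1) A) \<in> ten" for i by (cases i) (simp_all only: if_True if_False Z(1) ten_scale[OF A])
    show "valid_blocks (if i then standard_blocks else bl)" for i using bl valid_standard_blocks by simp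
    show "(\<Sum>i\<in>UNIV. choice_sum (if i then standard_blocks else bl) r (if i then Z else fscale (- 1) A) e f) = 0"
      if "e \<in> duals" "f \<in> duals" for e f
      using p(2)[OF that] Z(2)[OF that] by (simp add: UNIV_bool minus)
  qed (use that in auto)
  then have "choice_sum standard_blocks s Z e f = choice_sum bl s A e f" if "s \<le> r" "e \<in> duals" "f \<in> duals" for s e f
    using that by (simp add: UNIV_bool minus)
  with Z(1) show ?thesis by (rule that)
qed

lemma degree_part_bad:
  assumes A: "A \<in> ten" and bl: "valid_blocks bl" and s: "(\<Sum>j\<in>UNIV. a j) = s" "s < 2 * peak d a"
    and zero: "\<And>s' e f. s' < s \<Longrightarrow> e \<in> duals \<Longrightarrow> f \<in> duals \<Longrightarrow> choice_sum bl s' A e f = 0"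
    and ef: "e \<in> duals" "f \<in> duals"
  shows "degree_part bl a A e f = 0"
proof -
  have "peak d a > 0" using s(2) by simp
  then obtain j where j: "(peak d a - 1) * d j < a j" using peak_attained[of d a, OF d_pos] by blast
  show ?thesis
    by (rule degree_part_lonely[where j = j])
      (use A zero ef s lonely_position[where a = a and j = j and f = "peak d a", OF bl j] in auto)
qed

text \<open>The choices are sorted by degree. Degrees with \<open>s < 2 * peak d a\<close>
  contribute nothing by \<open>degree_part_bad\<close>, and all others come from shapes in
  \<open>good\<close> because \<open>s \<le> r\<close>.\<close>

lemma choice_sum_degree_parts:
  assumes s: "s \<le> r" and A: "A \<in> ten" and bl: "valid_blocks bl"
    and zero: "\<And>s' e f. s' < s \<Longrightarrow> e \<in> duals \<Longrightarrow> f \<in> duals \<Longrightarrow> choice_sum bl s' A e f = 0"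
    and ef: "e \<in> duals" "f \<in> duals"
  shows "choice_sum bl s A e f = (\<Sum>lam\<in>{lam\<in>good. card (columns (second_parts lam)) = s}. degree_part bl (second_parts lam) A e f)"
proof -
  let ?M = "{lam\<in>good. card (columns (second_parts lam)) = s}"
  let ?S = "{S\<in>choices bl. card S = s}"
  have inj: "inj_on second_parts ?M" by (rule inj_on_subset[OF second_parts_inj]) auto
  have fM: "finite ?M" using finite_good by simp
  \<comment> \<open>Degrees of good shapes are included even if no choice attains them; their parts
    are then empty sums.\<close>
  let ?D = "cnt ` ?S \<union> second_parts ` ?M"
  have sD: "(\<Sum>j\<in>UNIV. a j) = s" if "a \<in> ?D" for a
    using that by (auto simp: card_columns sum_cnt choices_finite)
  have "choice_sum bl s A e f = (\<Sum>a\<in>?D. \<Sum>S\<in>{S\<in>?S. cnt S = a}. ev A (pattern e f S))"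
    unfolding choice_sum_def by (rule sum.group[symmetric]) (use fM in auto)
  also have "\<dots> = (\<Sum>a\<in>?D. degree_part bl a A e f)"
  proof (rule sum.cong[OF refl])
    fix a assume a: "a \<in> ?D"
    have "card S = s" if "S \<in> choices bl" "cnt S = a" for S
      using sum_cnt[OF choices_finite[OF that(1)]] that(2) sD[OF a] by simp
    then have "{S\<in>?S. cnt S = a} = {S\<in>choices bl. cnt S = a}" by blast
    then show "(\<Sum>S\<in>{S\<in>?S. cnt S = a}. ev A (pattern e f S)) = degree_part bl a A e f"
      by (simp add: degree_part_def)
  qed
  also have "\<dots> = (\<Sum>a\<in>second_parts ` ?M. degree_part bl a A e f)"
  proof (rule sum.mono_neutral_right)
    show "\<forall>a\<in>?D - second_parts ` ?M. degree_part bl a A e f = 0"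
    proof
      fix a assume a: "a \<in> ?D - second_parts ` ?M"
      then have sa: "(\<Sum>j\<in>UNIV. a j) = s" using sD by blast
      have "s < 2 * peak d a"
      proof (rule ccontr)
        assume "\<not> s < 2 * peak d a"
        then obtain lam where "lam \<in> good" "second_parts lam = a"
          using good_exists[of a] sa s by auto
        then have "a \<in> second_parts ` ?M" using sa by (auto simp: card_columns)
        then show False using a by blast
      qed
      then show "degree_part bl a A e f = 0" using degree_part_bad[OF A bl sa _ zero ef] by blast
    qed
  qed (use fM in auto)
  also have "\<dots> = (\<Sum>lam\<in>?M. degree_part bl (second_parts lam) A e f)"
    by (rule sum.reindex[OF inj, unfolded comp_def])
  finally show ?thesis .
qed

text \<open>The sum of size \<open>s\<close>, the lowest that may be nonzero, splits into degree
  parts that come from Schur spaces. Division by the leading coefficients gives \<open>B\<close>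
  with the same sum of size \<open>s\<close>. To subtract it, its summands are first transferred to
  the standard blocks.\<close>

lemma total_form_step:
  assumes s: "s \<le> r" and A: "A \<in> ten"
    and zero: "\<And>s' e f. s' < s \<Longrightarrow> e \<in> duals \<Longrightarrow> f \<in> duals \<Longrightarrow> choice_sum standard_blocks s' A e f = 0"
  obtains B A' where "\<And>lam. lam \<in> good \<Longrightarrow> B lam \<in> schur_space (second_parts lam)" "A' \<in> ten"
    "\<And>e f. e \<in> duals \<Longrightarrow> f \<in> duals \<Longrightarrow> choice_sum standard_blocks r A e f = total_form B e f + choice_sum standard_blocks r A' e f"
    "\<And>s' e f. s' \<le> s \<Longrightarrow> e \<in> duals \<Longrightarrow> f \<in> duals \<Longrightarrow> choice_sum standard_blocks s' A' e f = 0"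
proof -
  let ?M = "{lam\<in>good. card (columns (second_parts lam)) = s}"
  have "\<exists>B. B \<in> schur_space (second_parts lam) \<and> (\<forall>e\<in>duals. \<forall>f\<in>duals.
    ev B (pattern e f (bottom_row (second_parts lam))) = degree_part standard_blocks (second_parts lam) A e f)"
    if "lam \<in> ?M" for lam
  proof -
    have sh: "shape (second_parts lam)" and c: "card (columns (second_parts lam)) = s"
      using shape_good \<open>lam \<in> ?M\<close> by auto
    obtain A' where "A' \<in> schur_space (second_parts lam)"
      "\<And>e f. e \<in> duals \<Longrightarrow> f \<in> duals \<Longrightarrow> ev A' (pattern e f (bottom_row (second_parts lam))) = degree_part standard_blocks (second_parts lam) A e f"
      using degree_part_in_schur[OF sh A valid_standard_blocks zero[unfolded c[symmetric]]] by blast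
    then show ?thesis by blast
  qed
  then have "\<forall>lam. \<exists>B. lam \<in> ?M \<longrightarrow> B \<in> schur_space (second_parts lam) \<and> (\<forall>e\<in>duals. \<forall>f\<in>duals.
    ev B (pattern e f (bottom_row (second_parts lam))) = degree_part standard_blocks (second_parts lam) A e f)" by blast
  from choice[OF this] obtain B0 where B0: "\<And>lam. lam \<in> ?M \<Longrightarrow> B0 lam \<in> schur_space (second_parts lam)"
    "\<And>lam e f. lam \<in> ?M \<Longrightarrow> e \<in> duals \<Longrightarrow> f \<in> duals \<Longrightarrow>
      ev (B0 lam) (pattern e f (bottom_row (second_parts lam))) = degree_part standard_blocks (second_parts lam) A e f" by blast
  define B where "B lam = (if lam \<in> ?M then fscale (inverse (leading_coeff (blocks_for lam) (second_parts lam))) (B0 lam) else 0)" for lam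
  have B: "B lam \<in> schur_space (second_parts lam)" for lam
    using B0(1) by (auto simp: B_def intro: schur_space_scale schur_space_zero)
  have "\<exists>Z. Z \<in> ten \<and> (\<forall>s' e f. s' \<le> r \<longrightarrow> e \<in> duals \<longrightarrow> f \<in> duals \<longrightarrow>
    choice_sum standard_blocks s' Z e f = choice_sum (blocks_for lam) s' (B lam) e f)" if "lam \<in> good" for lam
  proof -
    obtain Z where "Z \<in> ten" "\<And>s e f. s \<le> r \<Longrightarrow> e \<in> duals \<Longrightarrow> f \<in> duals \<Longrightarrow>
      choice_sum standard_blocks s Z e f = choice_sum (blocks_for lam) s (B lam) e f"
      using choice_sum_transfer[OF blocks_for(1)[OF \<open>lam \<in> good\<close>] schur_space_ten[OF shape_good[OF \<open>lam \<in> good\<close>] B]] by blast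
    then show ?thesis by blast
  qed
  then have "\<forall>lam. \<exists>Z. lam \<in> good \<longrightarrow> Z \<in> ten \<and> (\<forall>s' e f. s' \<le> r \<longrightarrow> e \<in> duals \<longrightarrow> f \<in> duals \<longrightarrow>
    choice_sum standard_blocks s' Z e f = choice_sum (blocks_for lam) s' (B lam) e f)" by blast
  from choice[OF this] obtain Z where Z: "\<And>lam. lam \<in> good \<Longrightarrow> Z lam \<in> ten"
    "\<And>lam s' e f. lam \<in> good \<Longrightarrow> s' \<le> r \<Longrightarrow> e \<in> duals \<Longrightarrow> f \<in> duals \<Longrightarrow>
      choice_sum standard_blocks s' (Z lam) e f = choice_sum (blocks_for lam) s' (B lam) e f" by blast
  define A' where "A' = A + fscale (- 1) (\<Sum>lam\<in>good. Z lam)"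
  have A': "choice_sum standard_blocks s' A' e f = choice_sum standard_blocks s' A e f -
    (\<Sum>lam\<in>good. choice_sum (blocks_for lam) s' (B lam) e f)" if "s' \<le> r" "e \<in> duals" "f \<in> duals" for s' e f
    unfolding A'_def choice_sum_add choice_sum_scale choice_sum_sum using Z(2) that by simp
  show ?thesis
  proof (rule that[of B A'])
    show "B lam \<in> schur_space (second_parts lam)" for lam by (rule B)
    show "A' \<in> ten" unfolding A'_def by (intro ten_add ten_scale ten_sum A Z(1))
    show "choice_sum standard_blocks r A e f = total_form B e f + choice_sum standard_blocks r A' e f"
      if "e \<in> duals" "f \<in> duals" for e f
      using A'[OF le_refl that] by (simp add: total_form_def)
    fix s' e f assume s': "s' \<le> s" and ef: "e \<in> duals" "f \<in> duals"
    have sum_M: "(\<Sum>lam\<in>good. choice_sum (blocks_for lam) s' (B lam) e f) = (\<Sum>lam\<in>?M. choice_sum (blocks_for lam) s' (B lam) e f)"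
      by (rule sum.mono_neutral_right) (auto simp: finite_good B_def choice_sum_zero)
    show "choice_sum standard_blocks s' A' e f = 0"
    proof (cases "s' < s")
      case True
      have "choice_sum (blocks_for lam) s' (B lam) e f = 0" if "lam \<in> ?M" for lam
        using that True by (intro choice_sum_schur_less[OF shape_good B ef]) auto
      then show ?thesis using A'[of s' e f] zero[OF True ef] s' s ef by (simp add: sum_M)
    next
      case False
      then have s'_eq: "s' = s" using s' by simp
      have "choice_sum (blocks_for lam) s (B lam) e f = degree_part standard_blocks (second_parts lam) A e f" if lam: "lam \<in> ?M" for lam
      proof -
        have g: "lam \<in> good" and c: "card (columns (second_parts lam)) = s" using lam by auto
        have "choice_sum (blocks_for lam) s (B lam) e f =
          leading_coeff (blocks_for lam) (second_parts lam) * ev (B lam) (pattern e f (bottom_row (second_parts lam)))"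
          using choice_sum_schur[OF shape_good[OF g] B ef] c by simp
        also have "\<dots> = degree_part standard_blocks (second_parts lam) A e f"
          using lam B0(2)[OF lam ef] blocks_for(2)[OF g] by (simp add: B_def)
        finally show ?thesis .
      qed
      then show ?thesis
        using A'[OF s ef] sum_M choice_sum_degree_parts[OF s A valid_standard_blocks zero ef] by (simp add: s'_eq)
    qed
  qed
qed

lemma total_form_add: "total_form (\<lambda>lam. A lam + B lam) e f = total_form A e f + total_form B e f"
  by (simp add: total_form_def choice_sum_add sum.distrib)

text \<open>\<open>total_form_step\<close> is iterated for the sizes from \<open>0\<close> to
  \<open>r\<close>, thus \<open>Suc r\<close> times; the remainder then has vanishing sum of size
  \<open>r\<close> and induces the zero function.\<close>

lemma total_form_surj:
  assumes "p \<in> poly_ring_deg Y r"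
  obtains A where "\<And>lam. lam \<in> good \<Longrightarrow> A lam \<in> schur_space (second_parts lam)"
    "\<And>e f. e \<in> duals \<Longrightarrow> f \<in> duals \<Longrightarrow> p (tangent e f) = total_form A e f"
proof -
  obtain A0 where A0: "A0 \<in> ten" "\<And>e f. e \<in> duals \<Longrightarrow> f \<in> duals \<Longrightarrow> p (tangent e f) = choice_sum standard_blocks r A0 e f"
    using poly_to_ten[OF assms] by blast
  have "\<exists>A A'. (\<forall>lam\<in>good. A lam \<in> schur_space (second_parts lam)) \<and> A' \<in> ten \<and>
    (\<forall>e\<in>duals. \<forall>f\<in>duals. choice_sum standard_blocks r A0 e f = total_form A e f + choice_sum standard_blocks r A' e f) \<and>
    (\<forall>s'<s. \<forall>e\<in>duals. \<forall>f\<in>duals. choice_sum standard_blocks s' A' e f = 0)" if "s \<le> Suc r" for s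
    using that
  proof (induction s)
    case 0
    show ?case
      by (rule exI[of _ "\<lambda>_. 0"], rule exI[of _ A0]) (use A0(1) schur_space_zero in \<open>auto simp: total_form_def choice_sum_zero\<close>)
  next
    case (Suc s)
    then obtain A A' where A: "\<forall>lam\<in>good. A lam \<in> schur_space (second_parts lam)" "A' \<in> ten"
      "\<forall>e\<in>duals. \<forall>f\<in>duals. choice_sum standard_blocks r A0 e f = total_form A e f + choice_sum standard_blocks r A' e f"
      "\<forall>s'<s. \<forall>e\<in>duals. \<forall>f\<in>duals. choice_sum standard_blocks s' A' e f = 0" by auto
    have z: "choice_sum standard_blocks s' A' e f = 0" if "s' < s" "e \<in> duals" "f \<in> duals" for s' e f using A(4) that by blast
    have sr: "s \<le> r" using Suc.prems by simp
    obtain B A'' where B: "\<And>lam. lam \<in> good \<Longrightarrow> B lam \<in> schur_space (second_parts lam)" "A'' \<in> ten"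
      "\<And>e f. e \<in> duals \<Longrightarrow> f \<in> duals \<Longrightarrow> choice_sum standard_blocks r A' e f = total_form B e f + choice_sum standard_blocks r A'' e f"
      "\<And>s' e f. s' \<le> s \<Longrightarrow> e \<in> duals \<Longrightarrow> f \<in> duals \<Longrightarrow> choice_sum standard_blocks s' A'' e f = 0"
      using total_form_step[OF sr A(2) z] by blast
    show ?case
    proof (rule exI[of _ "\<lambda>lam. A lam + B lam"], rule exI[of _ A''], intro conjI ballI allI impI)
      show "A lam + B lam \<in> schur_space (second_parts lam)" if "lam \<in> good" for lam
        using A(1) B(1) that by (auto intro: schur_space_add)
      show "choice_sum standard_blocks r A0 e f = total_form (\<lambda>lam. A lam + B lam) e f + choice_sum standard_blocks r A'' e f"
        if "e \<in> duals" "f \<in> duals" for e f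
        using A(3) B(3)[OF that] that by (simp add: total_form_add)
      show "choice_sum standard_blocks s' A'' e f = 0" if "s' < Suc s" "e \<in> duals" "f \<in> duals" for s' e f
        using B(4) that by simp
    qed (rule B(2))
  qed
  from this[OF le_refl] obtain A A' where A: "\<forall>lam\<in>good. A lam \<in> schur_space (second_parts lam)"
    "\<forall>e\<in>duals. \<forall>f\<in>duals. choice_sum standard_blocks r A0 e f = total_form A e f + choice_sum standard_blocks r A' e f"
    "\<forall>s'<Suc r. \<forall>e\<in>duals. \<forall>f\<in>duals. choice_sum standard_blocks s' A' e f = 0" by auto
  then have "p (tangent e f) = total_form A e f" if "e \<in> duals" "f \<in> duals" for e f
    using that A0(2) by simp
  with A(1) show ?thesis using that by blast
qed

lemma total_form_poly:
  assumes "\<And>lam. lam \<in> good \<Longrightarrow> A lam \<in> schur_space (second_parts lam)"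
  shows "\<exists>p\<in>poly_ring_deg Y r. \<forall>e\<in>duals. \<forall>f\<in>duals. p (tangent e f) = total_form A e f"
proof -
  have "\<forall>lam. \<exists>p. lam \<in> good \<longrightarrow> p \<in> poly_ring_deg Y r \<and>
    (\<forall>e\<in>duals. \<forall>f\<in>duals. p (tangent e f) = choice_sum (blocks_for lam) r (A lam) e f)"
    using ten_to_poly[OF blocks_for(1) schur_space_ten[OF shape_good assms]] by blast
  from choice[OF this] obtain p where p: "\<And>lam. lam \<in> good \<Longrightarrow> p lam \<in> poly_ring_deg Y r"
    "\<And>lam e f. lam \<in> good \<Longrightarrow> e \<in> duals \<Longrightarrow> f \<in> duals \<Longrightarrow> p lam (tangent e f) = choice_sum (blocks_for lam) r (A lam) e f" by blast
  show ?thesis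
  proof (intro bexI[of _ "\<Sum>lam\<in>good. p lam"] ballI)
    show "(\<Sum>lam\<in>good. p lam) \<in> poly_ring_deg Y r"
      using p(1) by (simp add: poly_ring_deg_def fs.span_sum)
    show "(\<Sum>lam\<in>good. p lam) (tangent e f) = total_form A e f" if "e \<in> duals" "f \<in> duals" for e f
      using p(2) that by (simp add: sum_fun_apply total_form_def)
  qed
qed

end

section \<open>The isomorphism of representations\<close>

text \<open>The natural map goes from the direct sum to the cosets, against the direction of
  \<open>rep_iso\<close>. Its inverse is equivariant as soon as the domain is closed under the
  operations.\<close>

lemma rep_iso_converse:
  assumes bij: "bij_betw \<Theta> (rep_carrier B) (rep_carrier A)"
    and add: "\<And>x y. x \<in> rep_carrier B \<Longrightarrow> y \<in> rep_carrier B \<Longrightarrow>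
      rep_add B x y \<in> rep_carrier B \<and> \<Theta> (rep_add B x y) = rep_add A (\<Theta> x) (\<Theta> y)"
    and scale: "\<And>c x. x \<in> rep_carrier B \<Longrightarrow>
      rep_scale B c x \<in> rep_carrier B \<and> \<Theta> (rep_scale B c x) = rep_scale A c (\<Theta> x)"
    and act: "\<And>g x. g \<in> G \<Longrightarrow> x \<in> rep_carrier B \<Longrightarrow>
      rep_act B g x \<in> rep_carrier B \<and> \<Theta> (rep_act B g x) = rep_act A g (\<Theta> x)"
  shows "rep_iso G A B"
proof -
  define \<Phi> where "\<Phi> = the_inv_into (rep_carrier B) \<Theta>"
  have inj: "inj_on \<Theta> (rep_carrier B)" and im: "\<Theta> ` rep_carrier B = rep_carrier A"
    using bij by (auto simp: bij_betw_def)
  have \<Phi>: "\<Phi> (\<Theta> x) = x" if "x \<in> rep_carrier B" for x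
    using that inj by (simp add: \<Phi>_def the_inv_into_f_f)
  have pre: "\<exists>u\<in>rep_carrier B. x = \<Theta> u" if "x \<in> rep_carrier A" for x
    using that im by auto
  show ?thesis
    unfolding rep_iso_def
  proof (intro exI[of _ \<Phi>] conjI ballI allI)
    show "bij_betw \<Phi> (rep_carrier A) (rep_carrier B)"
      unfolding \<Phi>_def by (rule bij_betw_the_inv_into[OF bij])
    fix x assume x: "x \<in> rep_carrier A"
    then obtain u where u: "u \<in> rep_carrier B" "x = \<Theta> u" using pre by blast
    show "\<Phi> (rep_scale A c x) = rep_scale B c (\<Phi> x)" for c
      using scale[OF u(1), of c] u \<Phi> by metis
    show "\<Phi> (rep_act A g x) = rep_act B g (\<Phi> x)" if "g \<in> G" for g
      using act[OF that u(1)] u \<Phi> by metis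
    fix y assume "y \<in> rep_carrier A"
    then obtain w where w: "w \<in> rep_carrier B" "y = \<Theta> w" using pre by blast
    show "\<Phi> (rep_add A x y) = rep_add B (\<Phi> x) (\<Phi> y)"
      using add[OF u(1) w(1)] u w \<Phi> by metis
  qed
qed

lemma poly_ring_deg_subset: "p \<in> poly_ring_deg Z s \<Longrightarrow> p \<in> poly_ring Z"
  unfolding poly_ring_deg_def poly_ring_def by (rule rev_subsetD[OF _ fs.span_mono]) auto

context segre_veronese
begin

lemma GL_permutes:
  assumes "g \<in> GL scale (V j)"
  shows "g permutes V j"
  using assms by (auto simp: GL_def intro: bij_imp_permutes)

lemma GL_inv:
  assumes g: "g \<in> GL scale (V j)"
  shows "inv g \<in> GL scale (V j)"
proof -
  note p = GL_permutes[OF g]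
  have mem: "inv g v \<in> V j" if "v \<in> V j" for v
    using that permutes_in_image[OF permutes_inv[OF p]] by simp
  show ?thesis
    unfolding GL_def
  proof (intro CollectI conjI ballI allI impI)
    show "bij_betw (inv g) (V j) (V j)" by (rule permutes_imp_bij[OF permutes_inv[OF p]])
    show "inv g (v + w) = inv g v + inv g w" if "v \<in> V j" "w \<in> V j" for v w
    proof -
      have "g (inv g v + inv g w) = v + w"
        using GL_closed(3)[OF g mem[OF that(1)] mem[OF that(2)]] by (simp add: permutes_inverses[OF p])
      then show ?thesis by (metis permutes_inverses(2)[OF p])
    qed
    show "inv g (scale c v) = scale c (inv g v)" if "v \<in> V j" for c v
    proof -
      have "g (scale c (inv g v)) = scale c v"
        using GL_closed(4)[OF g mem[OF that]] by (simp add: permutes_inverses[OF p])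
      then show ?thesis by (metis permutes_inverses(2)[OF p])
    qed
    show "inv g v = v" if "v \<notin> V j" for v using that permutes_not_in[OF permutes_inv[OF p]] by blast
  qed
qed

definition pull :: "('n \<Rightarrow> 'v \<Rightarrow> 'v) \<Rightarrow> (('n \<Rightarrow> 'v) \<Rightarrow> 'k) \<Rightarrow> ('n \<Rightarrow> 'v) \<Rightarrow> 'k" where
  "pull g F = (\<lambda>v. F (\<lambda>j. g j (v j)))"

lemma pull_closed:
  assumes g: "g \<in> GL_prod scale V" and F: "F \<in> Y"
  shows "pull g F \<in> Y"
  using F unfolding sym_tensor_def
proof (induction rule: fs.span_induct_alt)
  case base
  have "pull g 0 = 0" by (simp add: pull_def fun_eq_iff fun_apply)
  then show ?case by (simp only: fs.span_zero)
next
  case (step c x y)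
  then obtain \<phi> where \<phi>: "x = (\<lambda>v. \<Prod>j\<in>UNIV. \<Prod>i<d j. \<phi> j i (v j))" "\<forall>j i. \<phi> j i \<in> dual j" by auto
  have "\<forall>j i. \<phi> j i \<circ> g j \<in> dual j" using \<phi>(2) g dual_comp_GL by (auto simp: GL_prod_def)
  moreover have "pull g x = (\<lambda>v. \<Prod>j\<in>UNIV. \<Prod>i<d j. (\<phi> j i \<circ> g j) (v j))" by (simp add: pull_def \<phi>(1))
  ultimately have "pull g x \<in> {\<lambda>v. \<Prod>j\<in>UNIV. \<Prod>i<d j. \<phi> j i (v j) | \<phi>. \<forall>j i. \<phi> j i \<in> dual j}"
    by (intro CollectI exI[of _ "\<lambda>j i. \<phi> j i \<circ> g j"] conjI)
  moreover have "pull g (fscale c x + y) = fscale c (pull g x) + pull g y"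
    by (simp add: pull_def fun_eq_iff fun_apply)
  ultimately show ?case using step(2) by (simp add: fs.span_add fs.span_scale fs.span_base)
qed

lemma GL_prod_inv: "g \<in> GL_prod scale V \<Longrightarrow> (\<lambda>j. inv (g j)) \<in> GL_prod scale V"
  by (auto simp: GL_prod_def GL_inv)

lemma pull_inv:
  assumes "g \<in> GL_prod scale V"
  shows "pull g (pull (\<lambda>j. inv (g j)) F) = F" "pull (\<lambda>j. inv (g j)) (pull g F) = F"
proof -
  have "g j permutes V j" for j using assms GL_permutes by (auto simp: GL_prod_def)
  note inv = permutes_inverses[OF this]
  show "pull g (pull (\<lambda>j. inv (g j)) F) = F" "pull (\<lambda>j. inv (g j)) (pull g F) = F"
    by (simp_all add: pull_def inv)
qed

text \<open>Both directions matter, because linear forms and products of them are set to zero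
  outside \<open>Y\<close> and this cutoff has to commute with the action.\<close>

lemma pull_mem_iff:
  assumes "g \<in> GL_prod scale V"
  shows "pull g F \<in> Y \<longleftrightarrow> F \<in> Y"
  using pull_closed[OF assms, of F] pull_closed[OF GL_prod_inv[OF assms], of "pull g F"] pull_inv(2)[OF assms, of F] by auto

lemma poly_act_eq: "poly_act g p = (\<lambda>F. p (pull g F))"
  by (simp add: poly_act_def pull_def)

lemma poly_act_poly_ring:
  assumes g: "g \<in> GL_prod scale V" and p: "p \<in> poly_ring Y"
  shows "poly_act g p \<in> poly_ring Y"
  using p unfolding poly_ring_def
proof (induction rule: fs.span_induct_alt)
  case base
  have "poly_act g 0 = (0 :: (('n \<Rightarrow> 'v) \<Rightarrow> 'k) \<Rightarrow> 'k)" by (simp add: poly_act_eq fun_eq_iff fun_apply)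
  then show ?case by (simp only: fs.span_zero)
next
  case (step c x y)
  then obtain ls where ls: "x = form_product Y ls" "set ls \<subseteq> dual_space fscale Y" by auto
  have add: "pull g (F + F') = pull g F + pull g F'" "pull g (fscale b F) = fscale b (pull g F)" for F F' b
    by (simp_all add: pull_def fun_eq_iff fun_apply)
  have "l \<circ> pull g \<in> dual_space fscale Y" if "l \<in> dual_space fscale Y" for l
    using that pull_closed[OF g] pull_mem_iff[OF g] unfolding dual_space_def by (auto simp: add)
  then have "set (map (\<lambda>l. l \<circ> pull g) ls) \<subseteq> dual_space fscale Y" using ls(2) by auto
  moreover have "poly_act g x = form_product Y (map (\<lambda>l. l \<circ> pull g) ls)"
    using pull_mem_iff[OF g] by (auto simp: poly_act_eq ls(1) form_product_def fun_eq_iff comp_def)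
  ultimately have "poly_act g x \<in> {form_product Y ls | ls. set ls \<subseteq> dual_space fscale Y}" by blast
  moreover have "poly_act g (fscale c x + y) = fscale c (poly_act g x) + poly_act g y"
    by (simp add: poly_act_eq fun_eq_iff fun_apply)
  ultimately show ?case using step(2) by (simp add: fs.span_add fs.span_scale fs.span_base)
qed

lemma duals_GL: "g \<in> GL_prod scale V \<Longrightarrow> e \<in> duals \<Longrightarrow> (\<lambda>j. e j \<circ> g j) \<in> duals"
  using dual_comp_GL by (auto simp: GL_prod_def duals_def)

lemma pull_tangent: "pull g (tangent e f) = tangent (\<lambda>j. e j \<circ> g j) (\<lambda>j. f j \<circ> g j)"
  by (simp add: pull_def tangent_def tangent_vector_def)

lemma tangential_cone_eq: "tangential_cone scale V d = {tangent e f | e f. e \<in> duals \<and> f \<in> duals}"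
proof -
  have 1: "(\<lambda>j v. of_nat (d j) * f j v) \<in> duals" if "f \<in> duals" for f
    using that by (auto simp: duals_def intro: dual_scale)
  have 2: "\<exists>f'\<in>duals. f = (\<lambda>j v. of_nat (d j) * f' j v)" if "f \<in> duals" for f
  proof (rule bexI)
    show "f = (\<lambda>j v. of_nat (d j) * (inverse (of_nat (d j)) * f j v))"
      using d_pos by (simp add: fun_eq_iff mult.assoc[symmetric])
    show "(\<lambda>j v. inverse (of_nat (d j)) * f j v) \<in> duals" using that by (auto simp: duals_def intro: dual_scale)
  qed
  show ?thesis
    unfolding tangential_cone_def tangent_def
  proof (intro set_eqI iffI)
    fix F assume "F \<in> {tangent_vector d e f | e f. (\<forall>j. e j \<in> dual j) \<and> (\<forall>j. f j \<in> dual j)}"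
    then obtain e f where ef: "F = tangent_vector d e f" "e \<in> duals" "f \<in> duals" by (auto simp: duals_def)
    then show "F \<in> {tangent_vector d e (\<lambda>j v. of_nat (d j) * f j v) | e f. e \<in> duals \<and> f \<in> duals}"
      using 2[OF ef(3)] by auto
  next
    fix F assume "F \<in> {tangent_vector d e (\<lambda>j v. of_nat (d j) * f j v) | e f. e \<in> duals \<and> f \<in> duals}"
    then obtain e f where ef: "F = tangent_vector d e (\<lambda>j v. of_nat (d j) * f j v)" "e \<in> duals" "f \<in> duals" by auto
    then show "F \<in> {tangent_vector d e f | e f. (\<forall>j. e j \<in> dual j) \<and> (\<forall>j. f j \<in> dual j)}"
      using 1[OF ef(3)] unfolding duals_def by blast
  qed
qed

abbreviation ideal :: "((('n \<Rightarrow> 'v) \<Rightarrow> 'k) \<Rightarrow> 'k) set" where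
  "ideal \<equiv> tangential_ideal scale V d"

lemma ideal_iff: "p \<in> ideal \<longleftrightarrow> p \<in> poly_ring Y \<and> (\<forall>e\<in>duals. \<forall>f\<in>duals. p (tangent e f) = 0)"
  by (auto simp: tangential_ideal_def tangential_cone_eq)

lemma poly_ring_closed:
  "p \<in> poly_ring Y \<Longrightarrow> q \<in> poly_ring Y \<Longrightarrow> p + q \<in> poly_ring Y"
  "p \<in> poly_ring Y \<Longrightarrow> q \<in> poly_ring Y \<Longrightarrow> p - q \<in> poly_ring Y"
  "p \<in> poly_ring Y \<Longrightarrow> fscale c p \<in> poly_ring Y"
  by (simp_all add: poly_ring_def fs.span_add fs.span_diff fs.span_scale)

text \<open>Describes a coset of the ideal by the function that its elements induce on the cone. No
  representative has to be chosen, and operations on cosets become operations on functions.\<close>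

definition fibre :: "(('n \<Rightarrow> 'v \<Rightarrow> 'k) \<Rightarrow> ('n \<Rightarrow> 'v \<Rightarrow> 'k) \<Rightarrow> 'k) \<Rightarrow> ((('n \<Rightarrow> 'v) \<Rightarrow> 'k) \<Rightarrow> 'k) set" where
  "fibre w = {p\<in>poly_ring Y. \<forall>e\<in>duals. \<forall>f\<in>duals. p (tangent e f) = w e f}"

lemma coset_eq_fibre:
  assumes "p \<in> fibre w"
  shows "p +o ideal = fibre w"
proof (intro set_eqI iffI)
  fix q assume "q \<in> p +o ideal"
  then obtain b where "q = p + b" "b \<in> ideal" by (auto simp: elt_set_plus_def)
  then show "q \<in> fibre w" using assms by (simp add: fibre_def ideal_iff poly_ring_closed fun_apply)
next
  fix q assume q: "q \<in> fibre w"
  have "q - p \<in> ideal" using q assms by (simp add: fibre_def ideal_iff poly_ring_closed)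
  then show "q \<in> p +o ideal" unfolding elt_set_plus_def by (intro CollectI bexI[of _ "q - p"]) simp_all
qed

lemma fibre_add:
  assumes "p \<in> fibre w" "p' \<in> fibre w'"
  shows "fibre (\<lambda>e f. w e f + w' e f) = fibre w + fibre w'"
proof (intro set_eqI iffI)
  fix q assume q: "q \<in> fibre (\<lambda>e f. w e f + w' e f)"
  have "q - p \<in> fibre w'" using q assms(1) by (simp add: fibre_def poly_ring_closed)
  then show "q \<in> fibre w + fibre w'" using assms(1) set_plus_intro[of p "fibre w" "q - p"] by simp
next
  fix q assume "q \<in> fibre w + fibre w'"
  then obtain a b where "q = a + b" "a \<in> fibre w" "b \<in> fibre w'" by (auto elim: set_plus_elim)
  then show "q \<in> fibre (\<lambda>e f. w e f + w' e f)" by (simp add: fibre_def poly_ring_closed fun_apply)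
qed

lemma fibre_scale:
  assumes "p \<in> fibre w"
  shows "fibre (\<lambda>e f. c * w e f) = fscale c ` fibre w + ideal"
proof (intro set_eqI iffI)
  fix q assume q: "q \<in> fibre (\<lambda>e f. c * w e f)"
  have "q - fscale c p \<in> ideal" using q assms by (simp add: fibre_def ideal_iff poly_ring_closed fscale_apply)
  from set_plus_intro[OF imageI[OF assms, of "fscale c"] this] show "q \<in> fscale c ` fibre w + ideal" by simp
next
  fix q assume "q \<in> fscale c ` fibre w + ideal"
  then obtain a b where "q = fscale c a + b" "a \<in> fibre w" "b \<in> ideal" by (auto elim!: set_plus_elim)
  then show "q \<in> fibre (\<lambda>e f. c * w e f)"
    by (simp add: fibre_def ideal_iff poly_ring_closed plus_fun_apply fscale_apply)
qed

lemma poly_act_fibre: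
  assumes g: "g \<in> GL_prod scale V" and p: "p \<in> fibre w"
  shows "poly_act g p \<in> fibre (\<lambda>e f. w (\<lambda>j. e j \<circ> g j) (\<lambda>j. f j \<circ> g j))"
  using p poly_act_poly_ring[OF g] duals_GL[OF g]
  by (auto simp: fibre_def) (simp add: poly_act_eq pull_tangent)

text \<open>\<open>poly_act_fibre\<close> gives one inclusion; applied to the inverse group element
  it yields the preimages for the other.\<close>

lemma fibre_act:
  assumes g: "g \<in> GL_prod scale V"
  shows "fibre (\<lambda>e f. w (\<lambda>j. e j \<circ> g j) (\<lambda>j. f j \<circ> g j)) = poly_act g ` fibre w"
proof (intro equalityI subsetI)
  fix q assume q: "q \<in> fibre (\<lambda>e f. w (\<lambda>j. e j \<circ> g j) (\<lambda>j. f j \<circ> g j))"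
  let ?h = "\<lambda>j. inv (g j)"
  have id: "(e j \<circ> inv (g j)) \<circ> g j = e j" for e :: "'n \<Rightarrow> 'v \<Rightarrow> 'k" and j
    using g GL_permutes[of "g j" j] by (auto simp: GL_prod_def fun_eq_iff permutes_inverses(2))
  have "poly_act ?h q \<in> fibre w"
    using poly_act_fibre[OF GL_prod_inv[OF g] q] by (simp add: id)
  moreover have "q = poly_act g (poly_act ?h q)" by (simp add: poly_act_eq pull_inv[OF g])
  ultimately show "q \<in> poly_act g ` fibre w" by blast
qed (use poly_act_fibre[OF g] in auto)

lemma total_form_scale: "total_form (\<lambda>lam. fscale c (A lam)) e f = c * total_form A e f"
  by (simp add: total_form_def choice_sum_scale sum_distrib_left)

lemma total_form_act:
  "total_form (\<lambda>lam. tensor_act g (A lam)) e f = total_form A (\<lambda>j. e j \<circ> g j) (\<lambda>j. f j \<circ> g j)"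
proof -
  have "(\<lambda>p. pattern e f S p \<circ> g (fst p)) = pattern (\<lambda>j. e j \<circ> g j) (\<lambda>j. f j \<circ> g j) S" for S
    by (auto simp: pattern_def fun_eq_iff)
  then show ?thesis by (simp add: total_form_def choice_sum_def ev_tensor_act)
qed

text \<open>A family is sent to the set of all polynomials that induce its total form. The fact
  \<open>ex\<close> makes this set the coset of an element of degree \<open>r\<close>; injectivity
  and surjectivity are \<open>total_form_inject\<close> and \<open>total_form_surj\<close>.\<close>

lemma coord_ring_decomposition:
  "rep_iso (GL_prod scale V) (tangential_coord_ring_deg scale V d r)
    (schur_direct_sum scale V {lam. \<forall>j. partition_of (lam j) (r * d j)} (tangential_mult d r))"
proof -
  let ?A = "tangential_coord_ring_deg scale V d r"
  let ?B = "schur_direct_sum scale V {lam. \<forall>j. partition_of (lam j) (r * d j)} (tangential_mult d r)"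
  \<comment> \<open>Multiplicities are at most one, so the copy with number \<open>0\<close> is the
    only one.\<close>
  define total where "total F = total_form (\<lambda>lam. F lam (0::nat))" for F
  have mult: "c < tangential_mult d r lam \<longleftrightarrow> c = 0 \<and> 0 < tangential_mult d r lam" for c lam
    by (auto simp: tangential_mult_def)
  have carrier: "F \<in> rep_carrier ?B \<longleftrightarrow> (\<forall>lam c. if lam \<in> good \<and> c = 0 then F lam c \<in> schur_space (second_parts lam) else F lam c = 0)" for F
  proof -
    have "lam \<in> {lam. \<forall>j. partition_of (lam j) (r * d j)} \<and> c < tangential_mult d r lam \<longleftrightarrow> lam \<in> good \<and> c = 0" for lam c
      using mult[of c lam] unfolding good_def by blast
    then show ?thesis
      by (simp add: schur_direct_sum_def schur_tensor_good cong: if_cong conj_cong)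
  qed
  have carrierI: "F \<in> rep_carrier ?B"
    if "\<And>lam. lam \<in> good \<Longrightarrow> F lam 0 \<in> schur_space (second_parts lam)"
      "\<And>lam c. \<not> (lam \<in> good \<and> c = 0) \<Longrightarrow> F lam c = 0" for F
    unfolding carrier using that by (intro allI) (auto split: if_splits)
  have off: "F lam c = 0" if "F \<in> rep_carrier ?B" "\<not> (lam \<in> good \<and> c = 0)" for F lam c
    using that(1)[unfolded carrier, rule_format, of lam c] that(2) by (simp only: if_False)
  have comp: "F lam 0 \<in> schur_space (second_parts lam)" if "F \<in> rep_carrier ?B" "lam \<in> good" for F lam
    using that carrier by auto
  have ex: "\<exists>p\<in>poly_ring_deg Y r. p \<in> fibre (total F)" if F: "F \<in> rep_carrier ?B" for F
  proof -
    obtain p where "p \<in> poly_ring_deg Y r" "\<forall>e\<in>duals. \<forall>f\<in>duals. p (tangent e f) = total F e f"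
      using total_form_poly[OF comp[OF F]] unfolding total_def by blast
    then show ?thesis using poly_ring_deg_subset unfolding fibre_def by blast
  qed
  have ops: "rep_add ?B F F' = (\<lambda>lam c. F lam c + F' lam c)" "rep_scale ?B a F = (\<lambda>lam c. fscale a (F lam c))"
    "rep_act ?B g F = (\<lambda>lam c. tensor_act g (F lam c))" for F F' a g
    by (simp_all add: schur_direct_sum_def)
  have opsA: "rep_carrier ?A = (\<lambda>p. p +o ideal) ` poly_ring_deg Y r" "rep_add ?A X X' = X + X'"
    "rep_scale ?A c X = fscale c ` X + ideal" "rep_act ?A g X = poly_act g ` X" for X X' c g
    by (simp_all add: tangential_coord_ring_deg_def Let_def)
  show ?thesis
  proof (rule rep_iso_converse[where \<Theta> = "\<lambda>F. fibre (total F)"])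
    show "bij_betw (\<lambda>F. fibre (total F)) (rep_carrier ?B) (rep_carrier ?A)"
      unfolding bij_betw_def
    proof (intro conjI equalityI subsetI)
      show "inj_on (\<lambda>F. fibre (total F)) (rep_carrier ?B)"
      proof (rule inj_onI)
        fix F F' assume F: "F \<in> rep_carrier ?B" "F' \<in> rep_carrier ?B" "fibre (total F) = fibre (total F')"
        obtain p where p: "p \<in> fibre (total F)" using ex[OF F(1)] by auto
        then have "p \<in> fibre (total F')" using F(3) by simp
        with p have "total F e f = total F' e f" if "e \<in> duals" "f \<in> duals" for e f
          using that by (simp add: fibre_def)
        then have zero: "total_form (\<lambda>lam. F lam 0 + fscale (- 1) (F' lam 0)) e f = 0" if "e \<in> duals" "f \<in> duals" for e f
          unfolding total_form_add total_form_scale using that by (simp add: total_def)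
        have "F lam 0 = F' lam 0" if "lam \<in> good" for lam
        proof -
          have "F lam 0 + fscale (- 1) (F' lam 0) = 0"
            by (rule total_form_inject[OF _ zero that]) (intro schur_space_add schur_space_scale comp F)
          then show ?thesis by simp
        qed
        then show "F = F'" using F(1,2) unfolding carrier by (intro ext) metis
      qed
      show "X \<in> rep_carrier ?A" if "X \<in> (\<lambda>F. fibre (total F)) ` rep_carrier ?B" for X
      proof -
        obtain F where F: "F \<in> rep_carrier ?B" "X = fibre (total F)" using \<open>X \<in> _\<close> by auto
        obtain p where "p \<in> poly_ring_deg Y r" "p \<in> fibre (total F)" using ex[OF F(1)] by auto
        then show ?thesis unfolding opsA F(2) using coset_eq_fibre by blast
      qed
      show "X \<in> (\<lambda>F. fibre (total F)) ` rep_carrier ?B" if "X \<in> rep_carrier ?A" for X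
      proof -
        obtain p where p: "p \<in> poly_ring_deg Y r" "X = p +o ideal" using \<open>X \<in> _\<close> opsA by auto
        obtain A where A: "\<And>lam. lam \<in> good \<Longrightarrow> A lam \<in> schur_space (second_parts lam)"
          "\<And>e f. e \<in> duals \<Longrightarrow> f \<in> duals \<Longrightarrow> p (tangent e f) = total_form A e f"
          using total_form_surj[OF p(1)] by blast
        define F where "F lam c = (if lam \<in> good \<and> c = (0::nat) then A lam else 0)" for lam c
        have "F \<in> rep_carrier ?B" unfolding carrier using A(1) by (simp add: F_def)
        moreover have "total F = total_form A" by (simp add: total_def total_form_def F_def fun_eq_iff)
        then have "p \<in> fibre (total F)" using A(2) p(1) poly_ring_deg_subset by (simp add: fibre_def)
        then have "X = fibre (total F)" using p(2) coset_eq_fibre by simp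
        ultimately show ?thesis by blast
      qed
    qed
  next
    fix F F' assume F: "F \<in> rep_carrier ?B" "F' \<in> rep_carrier ?B"
    obtain p p' where "p \<in> fibre (total F)" "p' \<in> fibre (total F')" using ex[OF F(1)] ex[OF F(2)] by auto
    then have "fibre (total (\<lambda>lam c. F lam c + F' lam c)) = fibre (total F) + fibre (total F')"
      using fibre_add[of p "total F" p' "total F'"] by (simp add: total_def total_form_add[abs_def])
    moreover have "(\<lambda>lam c. F lam c + F' lam c) \<in> rep_carrier ?B"
      by (rule carrierI) (use F comp off in \<open>auto intro: schur_space_add\<close>)
    ultimately show "rep_add ?B F F' \<in> rep_carrier ?B \<and> fibre (total (rep_add ?B F F')) = rep_add ?A (fibre (total F)) (fibre (total F'))"
      unfolding ops opsA by blast
  next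
    fix c F assume F: "F \<in> rep_carrier ?B"
    obtain p where "p \<in> fibre (total F)" using ex[OF F] by auto
    then have "fibre (total (\<lambda>lam i. fscale c (F lam i))) = fscale c ` fibre (total F) + ideal"
      using fibre_scale[of p "total F" c] by (simp add: total_def total_form_scale[abs_def])
    moreover have "(\<lambda>lam i. fscale c (F lam i)) \<in> rep_carrier ?B"
      by (rule carrierI) (use F comp off in \<open>auto intro: schur_space_scale\<close>)
    ultimately show "rep_scale ?B c F \<in> rep_carrier ?B \<and> fibre (total (rep_scale ?B c F)) = rep_scale ?A c (fibre (total F))"
      unfolding ops opsA by blast
  next
    fix g F assume g: "g \<in> GL_prod scale V" and F: "F \<in> rep_carrier ?B"
    have "fibre (total (\<lambda>lam i. tensor_act g (F lam i))) = poly_act g ` fibre (total F)"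
      using fibre_act[OF g, of "total F"] by (simp add: total_def total_form_act[abs_def])
    moreover have "tensor_act g 0 = (0 :: ('n \<Rightarrow> ('v \<Rightarrow> 'k) list) \<Rightarrow> 'k)"
      by (auto simp: tensor_act_def fun_eq_iff fun_apply)
    then have "(\<lambda>lam i. tensor_act g (F lam i)) \<in> rep_carrier ?B"
      by (intro carrierI) (use F comp off in \<open>auto intro: tensor_act_schur_space[OF g shape_good]\<close>)
    ultimately show "rep_act ?B g F \<in> rep_carrier ?B \<and> fibre (total (rep_act ?B g F)) = rep_act ?A g (fibre (total F))"
      unfolding ops opsA by blast
  qed
qed

end

theorem theorem1:
  fixes scale :: "'k::field_char_0 \<Rightarrow> 'v::ab_group_add \<Rightarrow> 'v"
    and V :: "'n::finite \<Rightarrow> 'v set"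
    and d :: "'n \<Rightarrow> nat"
    and r :: nat
  assumes "vector_space scale"
    and "\<And>j. fin_dim_subspace scale (V j)"
    and "\<And>j. d j > 0"
  shows "rep_iso (GL_prod scale V)
    (tangential_coord_ring_deg scale V d r)
    (schur_direct_sum scale V {lam. \<forall>j. partition_of (lam j) (r * d j)} (tangential_mult d r))"
proof -
  interpret vector_space scale by (rule assms(1))
  interpret segre_veronese scale V d r
    by unfold_locales (use assms in auto)
  show ?thesis by (rule coord_ring_decomposition)
qed

end
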